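(* Let $\alpha>0$, $\kappa\in(0,2]$, $c_Y>0$ and let $Y\in\mathbf{S}(\alpha,\kappa,c_Y)$. Then for any $R>0$ the limit \[ \mathcal{H}_Y^R:=\lim_{T\to\infty}\mathbf{E}\exp\left(\sup_{t\in[0,T]}\left(\sqrt2\,Y(t)-(1+R)t^\alpha\right)\right) \] exists and satisfies $\mathcal{H}_Y^R\in(0,\infty)$. Furthermore \[ \mathcal{H}_{B_\kappa}^{R/c_1}\;\le\;\mathcal{H}_Y^R\;\le\;\mathcal{H}_{B_\kappa}^{R/c_2}, \] where \[ c_1=\inf_{x\in[0,1)}\frac{V_Y(1,x^{\kappa/\alpha})}{|1-x|^\kappa}\qquad\text{and}\qquad c_2=\sup_{x\in[0,1)}\frac{V_Y(1,x^{\kappa/\alpha})}{|1-x|^\kappa}. \]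
   Context: Class $\mathbf{S}(\alpha,\kappa,c_Y)$ (with $\alpha>0$, $\kappa\in(0,2]$, $c_Y>0$): a centered Gaussian process $Y=\{Y(t):t\ge 0\}$ with a.s. continuous sample paths belongs to $\mathbf{S}(\alpha,\kappa,c_Y)$ if (S1) $Y$ is self-similar with index $\alpha/2$, i.e. for every $a>0$ the processes $\{Y(at):t\ge0\}$ and $\{a^{\alpha/2}Y(t):t\ge0\}$ have the same law, and $\mathbf{Var}(Y(1))=1$ (hence $\mathbf{Var}(Y(t))=t^\alpha$); (S2) $\mathbf{Var}(Y(1)-Y(1-h))=c_Y|h|^\kappa+o(|h|^\kappa)$ as $h\to0$. Notation: $V_Y(s,t)=\mathbf{Var}(Y(s)-Y(t))$. For $\kappa\in(0,2]$, $B_\kappa=\{B_\kappa(t):t\ge0\}$ denotes fractional Brownian motion with Hurst parameter $\kappa/2$, i.e. the centered Gaussian process with a.s. continuous sample paths, stationary increments, $B_\kappa(0)=0$ and $\mathbf{Var}(B_\kappa(t))=t^\kappa$. For $R>0$ the classical Piterbarg constant is $\mathcal{H}_{B_\kappa}^R=\lim_{T\to\infty}\mathbf{E}\exp\left(\sup_{t\in[0,T]}\left(\sqrt2 B_\kappa(t)-(1+R)t^\kappa\right)\right)$, which is well known to be finite and positive. *)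

theory Defs
  imports "HOL-Probability.Probability" "HOL-Library.Landau_Symbols"
begin

text \<open>
  Processes are maps from time to random variables. The time domain is \<open>{0..}\<close>;
  values at negative times are never constrained or used.
\<close>

text \<open>A centered normal law may be degenerate, which \<^const>\<open>normal_density\<close> does not cover.\<close>

definition centered_normal_rv :: "'a measure \<Rightarrow> ('a \<Rightarrow> real) \<Rightarrow> bool" where
  "centered_normal_rv M X \<longleftrightarrow>
     X \<in> borel_measurable M \<and>
     ((AE \<omega> in M. X \<omega> = 0) \<or> (\<exists>\<sigma>>0. distributed M lborel X (normal_density 0 \<sigma>)))"

definition centered_gaussian_process :: "'a measure \<Rightarrow> (real \<Rightarrow> 'a \<Rightarrow> real) \<Rightarrow> bool" where
  "centered_gaussian_process M Y \<longleftrightarrow>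
     prob_space M \<and>
     (\<forall>t\<ge>0. Y t \<in> borel_measurable M) \<and>
     (\<forall>J a. finite J \<and> J \<subseteq> {0..} \<longrightarrow> centered_normal_rv M (\<lambda>\<omega>. \<Sum>t\<in>J. a t * Y t \<omega>))"

definition as_continuous_paths :: "'a measure \<Rightarrow> (real \<Rightarrow> 'a \<Rightarrow> real) \<Rightarrow> bool" where
  "as_continuous_paths M Y \<longleftrightarrow> (AE \<omega> in M. continuous_on {0..} (\<lambda>t. Y t \<omega>))"

definition process_law :: "'a measure \<Rightarrow> (real \<Rightarrow> 'a \<Rightarrow> real) \<Rightarrow> (real \<Rightarrow> real) measure" where
  "process_law M Y =
     distr M (\<Pi>\<^sub>M t\<in>{0..}. (borel :: real measure)) (\<lambda>\<omega>. \<lambda>t\<in>{0..}. Y t \<omega>)"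

definition V_Y :: "'a measure \<Rightarrow> (real \<Rightarrow> 'a \<Rightarrow> real) \<Rightarrow> real \<Rightarrow> real \<Rightarrow> real" where
  "V_Y M Y s t = prob_space.variance M (\<lambda>\<omega>. Y s \<omega> - Y t \<omega>)"

definition self_similar :: "'a measure \<Rightarrow> real \<Rightarrow> (real \<Rightarrow> 'a \<Rightarrow> real) \<Rightarrow> bool" where
  "self_similar M H Y \<longleftrightarrow>
     (\<forall>a>0. process_law M (\<lambda>t. Y (a * t)) = process_law M (\<lambda>t \<omega>. a powr H * Y t \<omega>))"

definition class_S ::
    "'a measure \<Rightarrow> real \<Rightarrow> real \<Rightarrow> real \<Rightarrow> (real \<Rightarrow> 'a \<Rightarrow> real) \<Rightarrow> bool" where
  "class_S M \<alpha> \<kappa> c Y \<longleftrightarrow>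
     centered_gaussian_process M Y \<and>
     as_continuous_paths M Y \<and>
     self_similar M (\<alpha> / 2) Y \<and>
     prob_space.variance M (Y 1) = 1 \<and>
     (\<lambda>h. V_Y M Y 1 (1 - h) - c * \<bar>h\<bar> powr \<kappa>) \<in> o[at 0](\<lambda>h. \<bar>h\<bar> powr \<kappa>)"

text \<open>Fractional Brownian motion with Hurst parameter \<open>\<kappa> / 2\<close>, on an arbitrary probability space.\<close>

definition fractional_bm :: "'a measure \<Rightarrow> real \<Rightarrow> (real \<Rightarrow> 'a \<Rightarrow> real) \<Rightarrow> bool" where
  "fractional_bm M \<kappa> B \<longleftrightarrow>
     centered_gaussian_process M B \<and>
     as_continuous_paths M B \<and>
     (\<forall>s\<ge>0. process_law M (\<lambda>t \<omega>. B (s + t) \<omega> - B s \<omega>) =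
             process_law M (\<lambda>t \<omega>. B t \<omega> - B 0 \<omega>)) \<and>
     (AE \<omega> in M. B 0 \<omega> = 0) \<and>
     (\<forall>t\<ge>0. prob_space.variance M (B t) = t powr \<kappa>)"

text \<open>
  Expectations are taken in \<^typ>\<open>ennreal\<close>, so that a non-integrable exponential gives
  \<open>\<infinity>\<close> rather than the default value of the Bochner integral. The real supremum is a
  genuine one on every continuous path; the remaining paths form a null set and do not
  affect the integral.
\<close>

definition piterbarg_expectation ::
    "'a measure \<Rightarrow> (real \<Rightarrow> 'a \<Rightarrow> real) \<Rightarrow> real \<Rightarrow> real \<Rightarrow> real \<Rightarrow> ennreal" where
  "piterbarg_expectation M Y \<alpha> R T =
     (\<integral>\<^sup>+ \<omega>. ennreal (exp (SUP t\<in>{0..T}. sqrt 2 * Y t \<omega> - (1 + R) * t powr \<alpha>)) \<partial>M)"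

definition piterbarg_constant ::
    "'a measure \<Rightarrow> (real \<Rightarrow> 'a \<Rightarrow> real) \<Rightarrow> real \<Rightarrow> real \<Rightarrow> ennreal" where
  "piterbarg_constant M Y \<alpha> R = Lim at_top (piterbarg_expectation M Y \<alpha> R)"

end

theory Submission
  imports Defs "HOL-Real_Asymp.Real_Asymp"
begin

text \<open>
  After the time change \<open>X t = Y (t powr (\<kappa> / \<alpha>))\<close> the process has variance \<open>t powr \<kappa>\<close>, and by
  self-similarity its variogram lies between \<open>c1 * \<bar>t - s\<bar> powr \<kappa>\<close> and \<open>c2 * \<bar>t - s\<bar> powr \<kappa>\<close>, the
  variograms of time-scaled fractional Brownian motions. The comparison holds because
  \<open>E exp (max (Z i - Var (Z i) / 2 - f i))\<close> is monotone in the variogram of the Gaussian vector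
  \<open>Z\<close>: replace the maximum by a soft maximum and pass from one vector to the other by a Lindeberg
  exchange of small independent increments, whose second-order Taylor terms have the right sign.
  Continuity of the paths carries this over from dyadic grids to \<open>[0, T]\<close>. Expectations increase
  with \<open>T\<close>, so the limit exists; it is finite because a dyadic chaining bound controls
  the oscillation over \<open>[k, k + 1]\<close>, and the penalty \<open>R * t powr \<kappa>\<close> makes the sum over \<open>k\<close> converge.
\<close>

section \<open>Centered normal variables and joint laws\<close>

text \<open>The drift is what permits a comparison of processes whose variances differ at the same
  time. Since \<open>sqrt 2 * Y t\<close> has variance \<open>2 * t powr \<alpha>\<close>, the term
  \<open>t powr \<alpha>\<close> in the exponent is half of it, so every
  \<open>exp (Z i - Var (Z i) / 2)\<close> has mean 1, and a change of variances that leaves all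
  increments alone has no effect. What survives of a small exchange is the increment variance,
  averaged over pairs with the soft-maximum weights and multiplied by \<open>b - 1\<close>, which is
  nonnegative for \<open>b \<ge> 1\<close>. The remaining penalty must be the same function for both
  processes. Fractional Brownian motion run at speed \<open>k powr (1 / \<kappa>)\<close> has
  variance \<open>k * t powr \<kappa>\<close>, and its penalty with parameter \<open>R / k\<close>
  becomes \<open>R * t powr \<kappa>\<close>; this is the origin of \<open>R / c1\<close> and
  \<open>R / c2\<close>. Gaussianity is given only through linear combinations, so joint laws are
  identified by characteristic functions. Finiteness is proved for \<open>Y\<close> itself: the
  comparison speaks of a given fractional Brownian motion, whose existence is not assumed.\<close>

lemma centered_normal_rv_cases:
  assumes "prob_space M" "centered_normal_rv M X"
  obtains (degenerate) "X \<in> borel_measurable M" "AE \<omega> in M. X \<omega> = 0"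
  | (proper) \<sigma> where "X \<in> borel_measurable M" "\<sigma> > 0" "distributed M lborel X (normal_density 0 \<sigma>)"
  using assms unfolding centered_normal_rv_def by auto

text \<open>Completing the square: an exponential tilt only moves the mean, and the factor left over
  is the moment generating function.\<close>

lemma normal_density_tilt:
  assumes "\<sigma> > 0"
  shows "normal_density 0 \<sigma> x * exp (t * x) = exp (t\<^sup>2 * \<sigma>\<^sup>2 / 2) * normal_density (t * \<sigma>\<^sup>2) \<sigma> x"
proof -
  have "- (x - 0)\<^sup>2 / (2 * \<sigma>\<^sup>2) + t * x = t\<^sup>2 * \<sigma>\<^sup>2 / 2 + - (x - t * \<sigma>\<^sup>2)\<^sup>2 / (2 * \<sigma>\<^sup>2)"
    using assms by (simp add: field_simps power2_eq_square)
  then have "exp (- (x - 0)\<^sup>2 / (2 * \<sigma>\<^sup>2)) * exp (t * x)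
      = exp (t\<^sup>2 * \<sigma>\<^sup>2 / 2) * exp (- (x - t * \<sigma>\<^sup>2)\<^sup>2 / (2 * \<sigma>\<^sup>2))"
    by (simp add: mult_exp_exp)
  then show ?thesis by (simp add: normal_density_def)
qed

text \<open>Moments and transforms depend on the law only through the second moment, also when it
  vanishes. After this lemma the degenerate case needs no separate treatment.\<close>

lemma centered_normal_rv_moments:
  assumes "prob_space M" "centered_normal_rv M X"
  shows "integrable M X" "(\<integral>\<omega>. X \<omega> \<partial>M) = 0" "integrable M (\<lambda>\<omega>. (X \<omega>)\<^sup>2)"
    and "integrable M (\<lambda>\<omega>. exp (t * X \<omega>))"
    and "(\<integral>\<omega>. exp (t * X \<omega>) \<partial>M) = exp (t\<^sup>2 * (\<integral>\<omega>. (X \<omega>)\<^sup>2 \<partial>M) / 2)"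
    and "(CLINT \<omega>|M. iexp (X \<omega>)) = of_real (exp (- (\<integral>\<omega>. (X \<omega>)\<^sup>2 \<partial>M) / 2))"
proof -
  interpret prob_space M by fact
  have "integrable M X \<and> (\<integral>\<omega>. X \<omega> \<partial>M) = 0 \<and> integrable M (\<lambda>\<omega>. (X \<omega>)\<^sup>2) \<and>
    integrable M (\<lambda>\<omega>. exp (t * X \<omega>)) \<and>
    (\<integral>\<omega>. exp (t * X \<omega>) \<partial>M) = exp (t\<^sup>2 * (\<integral>\<omega>. (X \<omega>)\<^sup>2 \<partial>M) / 2) \<and>
    (CLINT \<omega>|M. iexp (X \<omega>)) = of_real (exp (- (\<integral>\<omega>. (X \<omega>)\<^sup>2 \<partial>M) / 2))"
    using assms
  proof (cases rule: centered_normal_rv_cases)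
    case degenerate
    note [measurable] = degenerate(1)
    have "integrable M X" "(\<integral>\<omega>. X \<omega> \<partial>M) = 0"
      using degenerate integrable_cong_AE[of X M "\<lambda>_. 0"] integral_cong_AE[of X M "\<lambda>_. 0"] by auto
    moreover have "AE \<omega> in M. (X \<omega>)\<^sup>2 = 0" using degenerate(2) by auto
    then have "integrable M (\<lambda>\<omega>. (X \<omega>)\<^sup>2)" "(\<integral>\<omega>. (X \<omega>)\<^sup>2 \<partial>M) = 0"
      using integrable_cong_AE[of "\<lambda>\<omega>. (X \<omega>)\<^sup>2" M "\<lambda>_. 0"]
        integral_cong_AE[of "\<lambda>\<omega>. (X \<omega>)\<^sup>2" M "\<lambda>_. 0"] by auto
    moreover have "AE \<omega> in M. exp (t * X \<omega>) = 1" using degenerate(2) by auto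
    then have "integrable M (\<lambda>\<omega>. exp (t * X \<omega>))" "(\<integral>\<omega>. exp (t * X \<omega>) \<partial>M) = 1"
      using integrable_cong_AE[of "\<lambda>\<omega>. exp (t * X \<omega>)" M "\<lambda>_. 1"]
        integral_cong_AE[of "\<lambda>\<omega>. exp (t * X \<omega>)" M "\<lambda>_. 1"] prob_space by auto
    moreover have "AE \<omega> in M. iexp (X \<omega>) = 1" using degenerate(2) by auto
    then have "(CLINT \<omega>|M. iexp (X \<omega>)) = 1"
      using integral_cong_AE[of "\<lambda>\<omega>. iexp (X \<omega>)" M "\<lambda>_. 1"] prob_space by auto
    ultimately show ?thesis by simp
  next
    case (proper \<sigma>)
    note [measurable] = proper(1)
    note D = proper(3)
    have m: "has_bochner_integral lborel (\<lambda>x. normal_density 0 \<sigma> x * x\<^sup>2) (\<sigma>\<^sup>2)"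
      using normal_moment_even[of \<sigma> 0 1] proper(2) by simp
    have tilt: "has_bochner_integral lborel (\<lambda>x. normal_density 0 \<sigma> x * exp (t * x)) (exp (t\<^sup>2 * \<sigma>\<^sup>2 / 2))"
      unfolding normal_density_tilt[OF proper(2)]
      using has_bochner_integral_mult_right[of "exp (t\<^sup>2 * \<sigma>\<^sup>2 / 2)" lborel "normal_density (t * \<sigma>\<^sup>2) \<sigma>" 1] proper(2)
      by (simp add: has_bochner_integral_iff)
    have m1: "has_bochner_integral lborel (\<lambda>x. normal_density 0 \<sigma> x * x) 0"
      using normal_moment_nz_1[of \<sigma> 0] proper(2) by simp
    have sq: "(\<integral>\<omega>. (X \<omega>)\<^sup>2 \<partial>M) = \<sigma>\<^sup>2"
      using distributed_integral[OF D, of "\<lambda>x. x\<^sup>2"] m by (simp add: has_bochner_integral_iff)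
    have "distributed M lborel (\<lambda>\<omega>. X \<omega> / \<sigma>) std_normal_density"
      using D normal_standard_normal_convert[of \<sigma> X 0] proper(2) by simp
    then have std: "distr M borel (\<lambda>\<omega>. X \<omega> / \<sigma>) = std_normal_distribution"
      by (simp add: distributed_def cong: distr_cong)
    have "(CLINT \<omega>|M. iexp (X \<omega>)) = (CLINT \<omega>|M. iexp (\<sigma> * (X \<omega> / \<sigma>)))"
      using proper(2) by simp
    also have "\<dots> = char (distr M borel (\<lambda>\<omega>. X \<omega> / \<sigma>)) \<sigma>"
      unfolding char_def by (subst integral_distr) auto
    also have "\<dots> = of_real (exp (- (\<sigma>\<^sup>2) / 2))"
      unfolding std char_std_normal_distribution ..
    finally have cf: "(CLINT \<omega>|M. iexp (X \<omega>)) = of_real (exp (- (\<sigma>\<^sup>2) / 2))" .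
    show ?thesis
      unfolding sq cf
      using distributed_integral[OF D, of "\<lambda>x. x"] distributed_integrable[OF D, of "\<lambda>x. x"]
        distributed_integral[OF D, of "\<lambda>x. exp (t * x)"] distributed_integrable[OF D, of "\<lambda>x. exp (t * x)"]
        distributed_integrable[OF D, of "\<lambda>x. x\<^sup>2"] m m1 tilt
      by (simp add: has_bochner_integral_iff)
  qed
  then show "integrable M X" "(\<integral>\<omega>. X \<omega> \<partial>M) = 0" "integrable M (\<lambda>\<omega>. (X \<omega>)\<^sup>2)"
    "integrable M (\<lambda>\<omega>. exp (t * X \<omega>))"
    "(\<integral>\<omega>. exp (t * X \<omega>) \<partial>M) = exp (t\<^sup>2 * (\<integral>\<omega>. (X \<omega>)\<^sup>2 \<partial>M) / 2)"
    "(CLINT \<omega>|M. iexp (X \<omega>)) = of_real (exp (- (\<integral>\<omega>. (X \<omega>)\<^sup>2 \<partial>M) / 2))"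
    by auto
qed

section \<open>Joint laws from characteristic functions of linear combinations\<close>

text \<open>Dividing the weights by their common mass \<open>q\<close> gives probability laws, to
  which one-dimensional uniqueness applies. The weights are there to carry the coordinates already
  treated when a joint law is identified one coordinate at a time.\<close>

lemma weighted_Levy_uniqueness:
  fixes X :: "'a \<Rightarrow> real" and Y :: "'b \<Rightarrow> real"
  assumes "prob_space M" "prob_space N"
    and [measurable]: "X \<in> borel_measurable M" "Y \<in> borel_measurable N"
      "v \<in> borel_measurable M" "w \<in> borel_measurable N"
    and v: "\<And>\<omega>. 0 \<le> v \<omega>" "\<And>\<omega>. v \<omega> \<le> c" and w: "\<And>\<omega>. 0 \<le> w \<omega>" "\<And>\<omega>. w \<omega> \<le> c"
    and eq: "\<And>t. (CLINT \<omega>|M. of_real (v \<omega>) * iexp (t * X \<omega>)) = (CLINT \<omega>|N. of_real (w \<omega>) * iexp (t * Y \<omega>))"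
    and [measurable]: "B \<in> sets borel"
  shows "(\<integral>\<omega>. v \<omega> * indicator B (X \<omega>) \<partial>M) = (\<integral>\<omega>. w \<omega> * indicator B (Y \<omega>) \<partial>N)"
proof -
  interpret M: prob_space M by fact
  interpret N: prob_space N by fact
  have iv: "integrable M v" using v by (intro M.integrable_const_bound[where B=c]) auto
  have iw: "integrable N w" using w by (intro N.integrable_const_bound[where B=c]) auto
  define q where "q = (\<integral>\<omega>. v \<omega> \<partial>M)"
  \<comment> \<open>Frequency 0 shows that both weights have the same mass.\<close>
  have "complex_of_real (\<integral>\<omega>. v \<omega> \<partial>M) = of_real (\<integral>\<omega>. w \<omega> \<partial>N)"
    using eq[of 0] by simp
  then have q': "q = (\<integral>\<omega>. w \<omega> \<partial>N)" by (simp add: q_def)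
  have "q \<ge> 0" unfolding q_def using v by simp
  show ?thesis
  proof (cases "q = 0")
    case True
    have "AE \<omega> in M. v \<omega> = 0"
      using True integral_nonneg_eq_0_iff_AE[OF iv] v by (simp add: q_def)
    then have 1: "(\<integral>\<omega>. v \<omega> * indicator B (X \<omega>) \<partial>M) = (\<integral>\<omega>. 0 \<partial>M)" by (intro integral_cong_AE) auto
    have "AE \<omega> in N. w \<omega> = 0"
      using True integral_nonneg_eq_0_iff_AE[OF iw] w by (simp add: q')
    then have "(\<integral>\<omega>. w \<omega> * indicator B (Y \<omega>) \<partial>N) = (\<integral>\<omega>. 0 \<partial>N)" by (intro integral_cong_AE) auto
    then show ?thesis using 1 by simp
  next
    case False
    then have q: "q > 0" using \<open>q \<ge> 0\<close> by simp
    define M1 where "M1 = distr (density M (\<lambda>\<omega>. ennreal (v \<omega> / q))) borel X"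
    define M2 where "M2 = distr (density N (\<lambda>\<omega>. ennreal (w \<omega> / q))) borel Y"
    have "emeasure (density M (\<lambda>\<omega>. ennreal (v \<omega> / q))) (space M) = 1"
      using v q iv by (simp add: emeasure_density nn_integral_eq_integral q_def cong: nn_integral_cong)
    then have dM: "prob_space (density M (\<lambda>\<omega>. ennreal (v \<omega> / q)))" by (intro prob_spaceI) simp
    have "emeasure (density N (\<lambda>\<omega>. ennreal (w \<omega> / q))) (space N) = 1"
      using w q iw by (simp add: emeasure_density nn_integral_eq_integral q' cong: nn_integral_cong)
    then have dN: "prob_space (density N (\<lambda>\<omega>. ennreal (w \<omega> / q)))" by (intro prob_spaceI) simp
    have r: "real_distribution M1" "real_distribution M2"
      unfolding M1_def M2_def
      by (auto intro!: prob_space.real_distribution_distr dM dN)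
    have "char M1 t = char M2 t" for t
    proof -
      have "char M1 t = (CLINT \<omega>|density M (\<lambda>\<omega>. ennreal (v \<omega> / q)). iexp (t * X \<omega>))"
        unfolding char_def M1_def by (rule integral_distr) auto
      also have "\<dots> = (CLINT \<omega>|M. (v \<omega> / q) *\<^sub>R iexp (t * X \<omega>))"
        by (rule integral_density) (use v q in auto)
      also have "\<dots> = (CLINT \<omega>|M. (1/q) *\<^sub>R (of_real (v \<omega>) * iexp (t * X \<omega>)))"
        by (rule Bochner_Integration.integral_cong) (simp_all add: scaleR_conv_of_real divide_inverse)
      also have "\<dots> = (CLINT \<omega>|N. (1/q) *\<^sub>R (of_real (w \<omega>) * iexp (t * Y \<omega>)))"
        by (simp only: integral_scaleR_right eq)
      also have "\<dots> = (CLINT \<omega>|N. (w \<omega> / q) *\<^sub>R iexp (t * Y \<omega>))"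
        by (rule Bochner_Integration.integral_cong) (simp_all add: scaleR_conv_of_real divide_inverse)
      also have "\<dots> = (CLINT \<omega>|density N (\<lambda>\<omega>. ennreal (w \<omega> / q)). iexp (t * Y \<omega>))"
        by (rule integral_density[symmetric]) (use w q in auto)
      also have "\<dots> = char M2 t"
        unfolding char_def M2_def by (rule integral_distr[symmetric]) auto
      finally show ?thesis .
    qed
    then have M12: "M1 = M2" using r by (intro Levy_uniqueness) auto
    have "(\<integral>\<omega>. v \<omega> * indicator B (X \<omega>) \<partial>M) / q = (\<integral>x. indicator B x \<partial>M1)"
      unfolding M1_def using v q
      by (subst integral_distr, simp, simp, subst integral_density) auto
    also have "\<dots> = (\<integral>\<omega>. w \<omega> * indicator B (Y \<omega>) \<partial>N) / q"
      unfolding M12 M2_def using w q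
      by (subst integral_distr, simp, simp, subst integral_density) auto
    finally show ?thesis using q by simp
  qed
qed

text \<open>Splits a cosine weight into exponentials with frequencies 0, 1 and -1 in
  \<open>x\<close>, the form in which equality of joint characteristic functions can be
  used.\<close>

lemma iexp_phase_cos:
  "complex_of_real (v * (1 + cos (x + p))) * iexp s =
    of_real v * iexp (0 * x + s) + (iexp p / 2) * (of_real v * iexp (1 * x + s))
      + (iexp (- p) / 2) * (of_real v * iexp ((- 1) * x + s))"
  by (simp add: cos_exp_eq exp_add exp_diff exp_minus algebra_simps of_real_def[symmetric]
      flip: cos_of_real)

text \<open>The weights \<open>1 + cos (\<theta> + p)\<close> are nonnegative, so \<open>weighted_Levy_uniqueness\<close> applies to them,
  and the values at \<open>p = 0, \<pi>, - \<pi> / 2\<close> recover the factor \<open>iexp \<theta>\<close>.\<close>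

lemma cf_indicator_step:
  fixes X :: "'a \<Rightarrow> real" and Y :: "'b \<Rightarrow> real"
  assumes "prob_space M" "prob_space N"
    and [measurable]: "X \<in> borel_measurable M" "Y \<in> borel_measurable N"
      "v \<in> borel_measurable M" "w \<in> borel_measurable N"
      "x \<in> borel_measurable M" "y \<in> borel_measurable N"
    and v: "\<And>\<omega>. 0 \<le> v \<omega>" "\<And>\<omega>. v \<omega> \<le> 1" and w: "\<And>\<omega>. 0 \<le> w \<omega>" "\<And>\<omega>. w \<omega> \<le> 1"
    and eq: "\<And>s t. (CLINT \<omega>|M. of_real (v \<omega>) * iexp (s * x \<omega> + t * X \<omega>)) =
        (CLINT \<omega>|N. of_real (w \<omega>) * iexp (s * y \<omega> + t * Y \<omega>))"
    and [measurable]: "B \<in> sets borel"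
  shows "(CLINT \<omega>|M. of_real (v \<omega> * indicator B (X \<omega>)) * iexp (x \<omega>)) =
         (CLINT \<omega>|N. of_real (w \<omega> * indicator B (Y \<omega>)) * iexp (y \<omega>))"
proof -
  interpret M: prob_space M by fact
  interpret N: prob_space N by fact
  have c: "0 \<le> 1 + cos z" "cos z \<le> 1" for z :: real
    using cos_ge_minus_one[of z] by linarith simp
  have J: "(\<integral>\<omega>. (v \<omega> * (1 + cos (x \<omega> + p))) * indicator B (X \<omega>) \<partial>M) =
      (\<integral>\<omega>. (w \<omega> * (1 + cos (y \<omega> + p))) * indicator B (Y \<omega>) \<partial>N)" for p
  proof (rule weighted_Levy_uniqueness[where c = 2])
    show "prob_space M" "prob_space N" by fact+
    show "0 \<le> v \<omega> * (1 + cos (x \<omega> + p))" "v \<omega> * (1 + cos (x \<omega> + p)) \<le> 2" for \<omega>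
      using v[of \<omega>] mult_mono[of "v \<omega>" 1 "1 + cos (x \<omega> + p)" 2] c[of "x \<omega> + p"]
      by (auto intro!: mult_nonneg_nonneg)
    show "0 \<le> w \<omega> * (1 + cos (y \<omega> + p))" "w \<omega> * (1 + cos (y \<omega> + p)) \<le> 2" for \<omega>
      using w[of \<omega>] mult_mono[of "w \<omega>" 1 "1 + cos (y \<omega> + p)" 2] c[of "y \<omega> + p"]
      by (auto intro!: mult_nonneg_nonneg)
    fix t
    have "(CLINT \<omega>|M. of_real (v \<omega> * (1 + cos (x \<omega> + p))) * iexp (t * X \<omega>)) =
      (CLINT \<omega>|M. of_real (v \<omega>) * iexp (0 * x \<omega> + t * X \<omega>) + (iexp p / 2) * (of_real (v \<omega>) * iexp (1 * x \<omega> + t * X \<omega>))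
        + (iexp (- p) / 2) * (of_real (v \<omega>) * iexp ((- 1) * x \<omega> + t * X \<omega>)))"
      by (simp only: iexp_phase_cos)
    also have "\<dots> = (CLINT \<omega>|M. of_real (v \<omega>) * iexp (0 * x \<omega> + t * X \<omega>)) + (iexp p / 2) * (CLINT \<omega>|M. of_real (v \<omega>) * iexp (1 * x \<omega> + t * X \<omega>))
        + (iexp (- p) / 2) * (CLINT \<omega>|M. of_real (v \<omega>) * iexp ((- 1) * x \<omega> + t * X \<omega>))"
    proof -
      have "integrable M (\<lambda>\<omega>. of_real (v \<omega>) * iexp (s * x \<omega> + t * X \<omega>))" for s
        by (rule M.integrable_const_bound[where B=1]) (use v in \<open>auto simp: norm_mult\<close>)
      then show ?thesis
        by (simp only: Bochner_Integration.integral_add Bochner_Integration.integrable_add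
            integrable_mult_right integral_mult_right_zero)
    qed
    also have "\<dots> = (CLINT \<omega>|N. of_real (w \<omega>) * iexp (0 * y \<omega> + t * Y \<omega>)) + (iexp p / 2) * (CLINT \<omega>|N. of_real (w \<omega>) * iexp (1 * y \<omega> + t * Y \<omega>))
        + (iexp (- p) / 2) * (CLINT \<omega>|N. of_real (w \<omega>) * iexp ((- 1) * y \<omega> + t * Y \<omega>))"
      by (simp only: eq)
    also have "\<dots> = (CLINT \<omega>|N. of_real (w \<omega>) * iexp (0 * y \<omega> + t * Y \<omega>) + (iexp p / 2) * (of_real (w \<omega>) * iexp (1 * y \<omega> + t * Y \<omega>))
        + (iexp (- p) / 2) * (of_real (w \<omega>) * iexp ((- 1) * y \<omega> + t * Y \<omega>)))"
    proof -
      have "integrable N (\<lambda>\<omega>. of_real (w \<omega>) * iexp (s * y \<omega> + t * Y \<omega>))" for s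
        by (rule N.integrable_const_bound[where B=1]) (use w in \<open>auto simp: norm_mult\<close>)
      then show ?thesis
        by (simp only: Bochner_Integration.integral_add Bochner_Integration.integrable_add
            integrable_mult_right integral_mult_right_zero)
    qed
    also have "\<dots> = (CLINT \<omega>|N. of_real (w \<omega> * (1 + cos (y \<omega> + p))) * iexp (t * Y \<omega>))"
      by (simp only: iexp_phase_cos)
    finally show "(CLINT \<omega>|M. of_real (v \<omega> * (1 + cos (x \<omega> + p))) * iexp (t * X \<omega>)) =
      (CLINT \<omega>|N. of_real (w \<omega> * (1 + cos (y \<omega> + p))) * iexp (t * Y \<omega>))" .
  qed auto
  define P where "P = (\<lambda>\<omega>. v \<omega> * indicator B (X \<omega>))"
  define Q where "Q = (\<lambda>\<omega>. w \<omega> * indicator B (Y \<omega>))"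
  have [measurable]: "P \<in> borel_measurable M" "Q \<in> borel_measurable N" by (auto simp: P_def Q_def)
  have P: "\<bar>P \<omega>\<bar> \<le> 1" and Q: "\<bar>Q \<omega>'\<bar> \<le> 1" for \<omega> \<omega>'
    using v[of \<omega>] w[of \<omega>'] by (auto simp: P_def Q_def indicator_def)
  have bd: "\<bar>a * b\<bar> \<le> 1" if "\<bar>a\<bar> \<le> 1" "\<bar>b\<bar> \<le> 1" for a b :: real
    using mult_mono[OF that] by (simp add: abs_mult)
  have iP: "integrable M P" "integrable M (\<lambda>\<omega>. P \<omega> * cos (x \<omega> + p))" for p
    by (rule M.integrable_const_bound[where B=1]; use P bd in auto)+
  have iQ: "integrable N Q" "integrable N (\<lambda>\<omega>. Q \<omega> * cos (y \<omega> + p))" for p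
    by (rule N.integrable_const_bound[where B=1]; use Q bd in auto)+
  have J': "(\<integral>\<omega>. P \<omega> \<partial>M) + (\<integral>\<omega>. P \<omega> * cos (x \<omega> + p) \<partial>M) = (\<integral>\<omega>. Q \<omega> \<partial>N) + (\<integral>\<omega>. Q \<omega> * cos (y \<omega> + p) \<partial>N)" for p
  proof -
    have "(\<integral>\<omega>. P \<omega> \<partial>M) + (\<integral>\<omega>. P \<omega> * cos (x \<omega> + p) \<partial>M) = (\<integral>\<omega>. (v \<omega> * (1 + cos (x \<omega> + p))) * indicator B (X \<omega>) \<partial>M)"
      using iP by (subst Bochner_Integration.integral_add[symmetric])
        (auto intro!: Bochner_Integration.integral_cong simp: P_def algebra_simps)
    also have "\<dots> = (\<integral>\<omega>. Q \<omega> \<partial>N) + (\<integral>\<omega>. Q \<omega> * cos (y \<omega> + p) \<partial>N)"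
      unfolding J using iQ by (subst Bochner_Integration.integral_add[symmetric])
        (auto intro!: Bochner_Integration.integral_cong simp: Q_def algebra_simps)
    finally show ?thesis .
  qed
  have cosJ: "(\<integral>\<omega>. P \<omega> * cos (x \<omega>) \<partial>M) = (\<integral>\<omega>. Q \<omega> * cos (y \<omega>) \<partial>N)"
    using J'[of 0] J'[of pi] by simp
  moreover have "(\<integral>\<omega>. P \<omega> * sin (x \<omega>) \<partial>M) = (\<integral>\<omega>. Q \<omega> * sin (y \<omega>) \<partial>N)"
    using J'[of 0] J'[of pi] J'[of "- (pi / 2)"] by (simp add: cos_diff)
  moreover have "(CLINT \<omega>|M. of_real (P \<omega>) * iexp (x \<omega>)) =
      of_real (\<integral>\<omega>. P \<omega> * cos (x \<omega>) \<partial>M) + \<i> * of_real (\<integral>\<omega>. P \<omega> * sin (x \<omega>) \<partial>M)"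
  proof -
    have i: "integrable M (\<lambda>\<omega>. of_real (P \<omega>) * iexp (x \<omega>))"
      by (rule M.integrable_const_bound[where B=1]) (use P in \<open>auto simp: norm_mult\<close>)
    show ?thesis
      using integral_Re[OF i] integral_Im[OF i]
      by (intro complex_eqI) (simp_all add: Re_exp Im_exp)
  qed
  moreover have "(CLINT \<omega>|N. of_real (Q \<omega>) * iexp (y \<omega>)) =
      of_real (\<integral>\<omega>. Q \<omega> * cos (y \<omega>) \<partial>N) + \<i> * of_real (\<integral>\<omega>. Q \<omega> * sin (y \<omega>) \<partial>N)"
  proof -
    have i: "integrable N (\<lambda>\<omega>. of_real (Q \<omega>) * iexp (y \<omega>))"
      by (rule N.integrable_const_bound[where B=1]) (use Q in \<open>auto simp: norm_mult\<close>)
    show ?thesis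
      using integral_Re[OF i] integral_Im[OF i]
      by (intro complex_eqI) (simp_all add: Re_exp Im_exp)
  qed
  ultimately show ?thesis by (simp add: P_def Q_def)
qed

text \<open>The Cramer-Wold principle. By induction on \<open>S\<close>, the coordinates in
  \<open>S\<close> acquire indicators while the full Fourier factor stays; at \<open>S = I\<close>
  and frequency 0 only probabilities of rectangles remain, and these determine the measure.\<close>

lemma joint_law_eqI:
  fixes X :: "'i \<Rightarrow> 'a \<Rightarrow> real" and Y :: "'i \<Rightarrow> 'b \<Rightarrow> real"
  assumes "prob_space M" "prob_space N" and I: "finite I"
    and X[measurable]: "\<And>i. i \<in> I \<Longrightarrow> X i \<in> borel_measurable M"
    and Y[measurable]: "\<And>i. i \<in> I \<Longrightarrow> Y i \<in> borel_measurable N"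
    and cf: "\<And>a. (CLINT \<omega>|M. iexp (\<Sum>i\<in>I. a i * X i \<omega>)) = (CLINT \<omega>|N. iexp (\<Sum>i\<in>I. a i * Y i \<omega>))"
  shows "distr M (\<Pi>\<^sub>M i\<in>I. borel) (\<lambda>\<omega>. \<lambda>i\<in>I. X i \<omega>) = distr N (\<Pi>\<^sub>M i\<in>I. borel) (\<lambda>\<omega>. \<lambda>i\<in>I. Y i \<omega>)"
proof -
  interpret M: prob_space M by fact
  interpret N: prob_space N by fact
  have *: "(CLINT \<omega>|M. of_real (\<Prod>i\<in>S. indicator (B i) (X i \<omega>)) * iexp (\<Sum>i\<in>I. a i * X i \<omega>)) =
      (CLINT \<omega>|N. of_real (\<Prod>i\<in>S. indicator (B i) (Y i \<omega>)) * iexp (\<Sum>i\<in>I. a i * Y i \<omega>))"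
    if "S \<subseteq> I" and B: "\<And>i. i \<in> I \<Longrightarrow> B i \<in> sets borel" for S B a
    using finite_subset[OF that(1) I] that(1)
  proof (induction S arbitrary: a)
    case empty
    then show ?case using cf[of a] by simp
  next
    case (insert k S)
    have k: "k \<in> I" and S: "S \<subseteq> I" using insert.prems by auto
    \<comment> \<open>An extra frequency \<open>t\<close> on coordinate \<open>k\<close> is absorbed
      into the coefficient vector, so the induction hypothesis, which holds for every
      \<open>a\<close>, gives the two-parameter identity that \<open>cf_indicator_step\<close> asks
      for.\<close>
    have shift: "(\<Sum>i\<in>I. (s * a i + (if i = k then t else 0)) * z i) = s * (\<Sum>i\<in>I. a i * z i) + t * z k"
      for s t and z :: "'i \<Rightarrow> real"
    proof -
      have "(\<Sum>i\<in>I. (s * a i + (if i = k then t else 0)) * z i) = (\<Sum>i\<in>I. s * (a i * z i) + (if k = i then t * z i else 0))"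
        by (rule sum.cong) (auto simp: algebra_simps)
      then show ?thesis using I k by (simp add: sum.distrib sum_distrib_left)
    qed
    have [measurable]: "i \<in> S \<Longrightarrow> X i \<in> borel_measurable M" "i \<in> S \<Longrightarrow> Y i \<in> borel_measurable N"
      "i \<in> S \<Longrightarrow> B i \<in> sets borel" for i
      using S X Y B by auto
    have "(CLINT \<omega>|M. of_real ((\<Prod>i\<in>S. indicator (B i) (X i \<omega>)) * indicator (B k) (X k \<omega>)) * iexp (\<Sum>i\<in>I. a i * X i \<omega>)) =
      (CLINT \<omega>|N. of_real ((\<Prod>i\<in>S. indicator (B i) (Y i \<omega>)) * indicator (B k) (Y k \<omega>)) * iexp (\<Sum>i\<in>I. a i * Y i \<omega>))"
    proof (rule cf_indicator_step)
      show "prob_space M" "prob_space N" by fact+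
      show "X k \<in> borel_measurable M" "Y k \<in> borel_measurable N" "B k \<in> sets borel" using k X Y B by auto
      show "(CLINT \<omega>|M. of_real (\<Prod>i\<in>S. indicator (B i) (X i \<omega>)) * iexp (s * (\<Sum>i\<in>I. a i * X i \<omega>) + t * X k \<omega>)) =
        (CLINT \<omega>|N. of_real (\<Prod>i\<in>S. indicator (B i) (Y i \<omega>)) * iexp (s * (\<Sum>i\<in>I. a i * Y i \<omega>) + t * Y k \<omega>))" for s t
        using insert.IH[OF S, of "\<lambda>i. s * a i + (if i = k then t else 0)"] unfolding shift .
    qed (auto intro!: prod_nonneg prod_le_1)
    then show ?case using insert.hyps by (simp add: mult.commute)
  qed
  have ms: "(\<lambda>\<omega>. \<lambda>i\<in>I. X i \<omega>) \<in> measurable M (\<Pi>\<^sub>M i\<in>I. borel)" "(\<lambda>\<omega>. \<lambda>i\<in>I. Y i \<omega>) \<in> measurable N (\<Pi>\<^sub>M i\<in>I. borel)"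
    by measurable
  show ?thesis
  proof (rule measure_eqI_PiM_finite[OF I])
    fix B :: "'i \<Rightarrow> real set" assume B: "\<And>i. i \<in> I \<Longrightarrow> B i \<in> sets borel"
    have [measurable]: "Pi\<^sub>E I B \<in> sets (\<Pi>\<^sub>M i\<in>I. borel)" using B I by (intro sets_PiM_I_finite) auto
    have "of_real (\<integral>\<omega>. (\<Prod>i\<in>I. indicator (B i) (X i \<omega>)) \<partial>M) = (complex_of_real (\<integral>\<omega>. (\<Prod>i\<in>I. indicator (B i) (Y i \<omega>)) \<partial>N))"
      using *[of I B "\<lambda>_. 0"] B by (simp flip: of_real_prod)
    then have e: "(\<integral>\<omega>. (\<Prod>i\<in>I. indicator (B i) (X i \<omega>)) \<partial>M) = (\<integral>\<omega>. (\<Prod>i\<in>I. indicator (B i) (Y i \<omega>)) \<partial>N :: real)"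
      by simp
    have ind: "(\<Prod>i\<in>I. indicator (B i) (z i)) = (indicator (Pi\<^sub>E I B) (\<lambda>i\<in>I. z i) :: real)" for z
      using I by (auto simp: indicator_def prod_zero_iff PiE_def Pi_def)
    have "measure (distr L (\<Pi>\<^sub>M i\<in>I. borel) f) (Pi\<^sub>E I B) = (\<integral>\<omega>. indicator (Pi\<^sub>E I B) (f \<omega>) \<partial>L)"
      if "f \<in> measurable L (\<Pi>\<^sub>M i\<in>I. borel)" for L :: "'c measure" and f :: "'c \<Rightarrow> 'i \<Rightarrow> real"
      using integral_distr[OF that, of "indicator (Pi\<^sub>E I B) :: _ \<Rightarrow> real"] by simp
    note this[OF ms(1)] this[OF ms(2)]
    then have "measure (distr M (\<Pi>\<^sub>M i\<in>I. borel) (\<lambda>\<omega>. \<lambda>i\<in>I. X i \<omega>)) (Pi\<^sub>E I B) =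
        measure (distr N (\<Pi>\<^sub>M i\<in>I. borel) (\<lambda>\<omega>. \<lambda>i\<in>I. Y i \<omega>)) (Pi\<^sub>E I B)"
      using e unfolding ind by simp
    then show "emeasure (distr M (\<Pi>\<^sub>M i\<in>I. borel) (\<lambda>\<omega>. \<lambda>i\<in>I. X i \<omega>)) (Pi\<^sub>E I B) =
        emeasure (distr N (\<Pi>\<^sub>M i\<in>I. borel) (\<lambda>\<omega>. \<lambda>i\<in>I. Y i \<omega>)) (Pi\<^sub>E I B)"
      using M.prob_space_distr[OF ms(1)] N.prob_space_distr[OF ms(2)]
      by (simp add: finite_measure.emeasure_eq_measure prob_space.finite_measure)
  next
    show "range (\<lambda>_::nat. Pi\<^sub>E I (\<lambda>_. UNIV :: real set)) \<subseteq> prod_algebra I (\<lambda>_. borel)"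
      using I by (auto intro!: prod_algebraI_finite)
    show "(\<Union>i::nat. Pi\<^sub>E I (\<lambda>_. UNIV :: real set)) = space (\<Pi>\<^sub>M i\<in>I. borel)"
      by (simp add: space_PiM)
    show "emeasure (distr M (\<Pi>\<^sub>M i\<in>I. borel) (\<lambda>\<omega>. \<lambda>i\<in>I. X i \<omega>)) (Pi\<^sub>E I (\<lambda>_. UNIV)) \<noteq> \<infinity>"
      using M.prob_space_distr[OF ms(1)]
      by (simp add: finite_measure.emeasure_eq_measure prob_space.finite_measure)
  qed auto
qed

section \<open>Gaussian comparison\<close>

definition gaussian_family :: "'a measure \<Rightarrow> 'i set \<Rightarrow> ('i \<Rightarrow> 'a \<Rightarrow> real) \<Rightarrow> bool" where
  "gaussian_family M I W \<longleftrightarrow> prob_space M \<and> finite I \<and>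
     (\<forall>a. centered_normal_rv M (\<lambda>\<omega>. \<Sum>i\<in>I. a i * W i \<omega>))"

lemma gaussian_familyD:
  assumes "gaussian_family M I W"
  shows "prob_space M" "finite I" "centered_normal_rv M (\<lambda>\<omega>. \<Sum>i\<in>I. a i * W i \<omega>)"
  using assms unfolding gaussian_family_def by auto

lemma gaussian_family_single:
  assumes "gaussian_family M I W" "i \<in> I"
  shows "centered_normal_rv M (W i)"
proof -
  have "centered_normal_rv M (\<lambda>\<omega>. \<Sum>k\<in>I. (if i = k then 1 else 0) * W k \<omega>)"
    by (rule gaussian_familyD(3)[OF assms(1)])
  moreover have "(\<Sum>k\<in>I. (if i = k then 1 else 0) * W k \<omega>) = W i \<omega>" for \<omega>
    using assms by (simp add: gaussian_family_def if_distrib[of "\<lambda>x. x * _"] cong: if_cong)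
  ultimately show ?thesis by simp
qed

lemma gaussian_family_diff:
  assumes "gaussian_family M I W" "i \<in> I" "j \<in> I"
  shows "centered_normal_rv M (\<lambda>\<omega>. W i \<omega> - W j \<omega>)"
proof -
  have "centered_normal_rv M (\<lambda>\<omega>. \<Sum>k\<in>I. ((if i = k then 1 else 0) - (if j = k then 1 else 0)) * W k \<omega>)"
    by (rule gaussian_familyD(3)[OF assms(1)])
  moreover have "(\<Sum>k\<in>I. ((if i = k then 1 else 0) - (if j = k then 1 else 0)) * W k \<omega>) = W i \<omega> - W j \<omega>" for \<omega>
    using assms by (simp add: gaussian_family_def if_distrib[of "\<lambda>x. x * _"] left_diff_distrib sum_subtractf cong: if_cong)
  ultimately show ?thesis by simp
qed

lemma gaussian_family_measurable:
  assumes "gaussian_family M I W" "i \<in> I"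
  shows "W i \<in> borel_measurable M"
  using gaussian_family_single[OF assms] unfolding centered_normal_rv_def by blast

section \<open>Second-order expansion of the soft maximum\<close>

text \<open>Maclaurin's formula for
  \<open>(\<Sum>i\<in>I. p i * exp (b * (r * v i))) powr (1 / b)\<close> as a function of
  \<open>r\<close>, taken at \<open>r = 1\<close>. Every derivative is this function times a
  polynomial in the ratios \<open>q k\<close>, which are moments of \<open>b * v i\<close> under
  tilted weights and hence at most \<open>(b * A) ^ k\<close> in absolute value.\<close>

lemma softmax_taylor:
  fixes p v :: "'i \<Rightarrow> real"
  assumes I: "finite I" and b: "b \<ge> 1" and p: "\<And>i. i \<in> I \<Longrightarrow> p i \<ge> 0" and p1: "(\<Sum>i\<in>I. p i) = 1"
    and v: "\<And>i. i \<in> I \<Longrightarrow> \<bar>v i\<bar> \<le> A"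
  shows "\<bar>(\<Sum>i\<in>I. p i * exp (b * v i)) powr (1 / b) -
      (1 + (\<Sum>i\<in>I. p i * v i) + ((1 - b) * (\<Sum>i\<in>I. p i * v i)\<^sup>2 + b * (\<Sum>i\<in>I. p i * (v i)\<^sup>2)) / 2)\<bar>
    \<le> b\<^sup>2 * A ^ 3 * exp A"
proof -
  obtain i0 where i0: "i0 \<in> I" "p i0 > 0"
    using p p1 by (metis sum.neutral order.not_eq_order_implies_strict zero_neq_one)
  have A: "A \<ge> 0" using v[OF i0(1)] by linarith
  define g where "g = 1 / b"
  have g: "0 < g" "g \<le> 1" "g * b = 1" using b by (auto simp: g_def)
  define S where "S k r = (\<Sum>i\<in>I. p i * (b * v i) ^ k * exp (b * (r * v i)))" for k :: nat and r
  have S_pos: "S 0 r > 0" for r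
    unfolding S_def by (rule sum_pos2[OF I i0(1)]) (use i0 p in auto)
  have S_deriv [derivative_intros]: "(S k has_real_derivative S (Suc k) r) (at r)" for k r
    unfolding S_def by (auto intro!: derivative_eq_intros sum.cong simp: mult_ac)
  have S_bound: "\<bar>S k r\<bar> \<le> (b * A) ^ k * S 0 r" for k r
  proof -
    have "\<bar>S k r\<bar> \<le> (\<Sum>i\<in>I. \<bar>p i * (b * v i) ^ k * exp (b * (r * v i))\<bar>)"
      unfolding S_def by (rule sum_abs)
    also have "\<dots> \<le> (\<Sum>i\<in>I. (b * A) ^ k * (p i * exp (b * (r * v i))))"
    proof (rule sum_mono)
      fix i assume i: "i \<in> I"
      have "\<bar>b * v i\<bar> \<le> b * A"
        using v[OF i] b by (simp add: abs_mult)
      then have "\<bar>(b * v i) ^ k\<bar> \<le> (b * A) ^ k"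
        unfolding power_abs by (rule power_mono) simp
      then have "\<bar>(b * v i) ^ k\<bar> * (p i * exp (b * (r * v i))) \<le> (b * A) ^ k * (p i * exp (b * (r * v i)))"
        using p[OF i] by (intro mult_right_mono) auto
      then show "\<bar>p i * (b * v i) ^ k * exp (b * (r * v i))\<bar> \<le> (b * A) ^ k * (p i * exp (b * (r * v i)))"
        using p[OF i] by (simp add: abs_mult mult_ac)
    qed
    also have "\<dots> = (b * A) ^ k * S 0 r" by (simp add: S_def sum_distrib_left)
    finally show ?thesis .
  qed
  define q where "q k r = S k r / S 0 r" for k r
  have q_bound: "\<bar>q k r\<bar> \<le> (b * A) ^ k" for k r
    using S_bound[of k r] S_pos[of r] by (simp add: q_def abs_divide divide_le_eq)
  have q_deriv: "(q k has_real_derivative q (Suc k) r - q k r * q 1 r) (at r)" for k r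
  proof -
    have "((\<lambda>r. S k r / S 0 r) has_real_derivative (S (Suc k) r * S 0 r - S k r * S (Suc 0) r) / (S 0 r * S 0 r)) (at r)"
      using S_pos[of r] by (intro DERIV_divide S_deriv) simp
    moreover have "(S (Suc k) r * S 0 r - S k r * S (Suc 0) r) / (S 0 r * S 0 r) = q (Suc k) r - q k r * q 1 r"
      using S_pos[of r] by (simp add: q_def diff_divide_distrib)
    ultimately show ?thesis by (simp add: q_def[abs_def])
  qed
  define d0 where "d0 r = exp (g * ln (S 0 r))" for r
  have d0_deriv: "(d0 has_real_derivative d0 r * (g * q 1 r)) (at r)" for r
    unfolding d0_def q_def using S_pos[of r]
    by (auto intro!: derivative_eq_intros)
  \<comment> \<open>The first three derivatives, obtained by iterating
    \<open>d0' = d0 * g * q 1\<close> and \<open>q k' = q (k + 1) - q k * q 1\<close>.\<close>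
  define d where "d m = (if m = 0 then d0 else if m = 1 then (\<lambda>r. d0 r * (g * q 1 r))
    else if m = 2 then (\<lambda>r. d0 r * (g * (g - 1) * (q 1 r)\<^sup>2 + g * q 2 r))
    else (\<lambda>r. d0 r * (g * (g - 1) * (g - 2) * (q 1 r) ^ 3 + 3 * g * (g - 1) * q 1 r * q 2 r + g * q 3 r)))" for m :: nat
  note q_deriv' = q_deriv[of 1] q_deriv[of 2]
  have D: "(d m has_real_derivative d (Suc m) t) (at t)" if "m < 3" for m t
  proof -
    have "m = 0 \<or> m = 1 \<or> m = 2" using that by auto
    then consider "m = 0" | "m = 1" | "m = 2" by blast
    then show ?thesis
    proof cases
      case 1 then show ?thesis using d0_deriv by (simp add: d_def)
    next
      case 2
      have "((\<lambda>r. d0 r * (g * q 1 r)) has_real_derivative d0 t * (g * (g - 1) * (q 1 t)\<^sup>2 + g * q 2 t)) (at t)"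
        by (rule derivative_eq_intros d0_deriv q_deriv' refl)+
          (simp add: algebra_simps power2_eq_square numeral_2_eq_2)
      then show ?thesis using 2 by (simp add: d_def numeral_2_eq_2)
    next
      case 3
      have "((\<lambda>r. d0 r * (g * (g - 1) * (q 1 r)\<^sup>2 + g * q 2 r)) has_real_derivative
        d0 t * (g * (g - 1) * (g - 2) * (q 1 t) ^ 3 + 3 * g * (g - 1) * q 1 t * q 2 t + g * q 3 t)) (at t)"
        by (rule derivative_eq_intros d0_deriv q_deriv' refl)+
          (simp add: algebra_simps power2_eq_square power3_eq_cube eval_nat_numeral)
      then show ?thesis using 3 by (simp add: d_def)
    qed
  qed
  obtain t where t: "0 < t" "t < 1" and tay: "d0 1 = (\<Sum>m<3. d m 0 / fact m * 1 ^ m) + d 3 t / fact 3 * 1 ^ 3"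
    using Maclaurin[of 1 3 d d0] D by (auto simp: d_def)
  have pv: "(\<Sum>i\<in>I. p i * (b * v i)) = b * (\<Sum>i\<in>I. p i * v i)"
    "(\<Sum>i\<in>I. p i * (b * v i)\<^sup>2) = b\<^sup>2 * (\<Sum>i\<in>I. p i * (v i)\<^sup>2)"
    by (simp_all add: sum_distrib_left mult_ac power_mult_distrib)
  have S00: "S 0 0 = 1" using p1 by (simp add: S_def)
  have q0: "q 1 0 = b * (\<Sum>i\<in>I. p i * v i)" "q 2 0 = b\<^sup>2 * (\<Sum>i\<in>I. p i * (v i)\<^sup>2)"
    unfolding q_def S00 using pv by (simp_all add: S_def)
  have gb: "g * (b * x) = x" "g * (b\<^sup>2 * x) = b * x" "g * (g - 1) * (b * x)\<^sup>2 = (1 - b) * x\<^sup>2" for x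
  proof -
    show "g * (b * x) = x" "g * (b\<^sup>2 * x) = b * x"
      using g(3) by (simp_all add: power2_eq_square flip: mult.assoc)
    have "g * (g - 1) * (b * x)\<^sup>2 = (g * b) * (g * b - b) * x\<^sup>2" by (simp add: power2_eq_square algebra_simps)
    then show "g * (g - 1) * (b * x)\<^sup>2 = (1 - b) * x\<^sup>2" using g(3) by simp
  qed
  have d00: "d0 0 = 1" by (simp add: d0_def S00)
  have sum3: "(\<Sum>m<3. d m 0 / fact m * 1 ^ m) = 1 + (\<Sum>i\<in>I. p i * v i) + ((1 - b) * (\<Sum>i\<in>I. p i * v i)\<^sup>2 + b * (\<Sum>i\<in>I. p i * (v i)\<^sup>2)) / 2"
  proof -
    have "{..<3::nat} = {0, 1, 2}" by auto
    then show ?thesis by (simp add: d_def d00 q0 gb del: One_nat_def)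
  qed
  have d01: "d0 1 = (\<Sum>i\<in>I. p i * exp (b * v i)) powr (1 / b)"
    using S_pos[of 1] by (simp add: d0_def powr_def S_def g_def)
  have "S 0 t \<le> exp (b * A)"
  proof -
    have "S 0 t \<le> (\<Sum>i\<in>I. p i * exp (b * A))"
      unfolding S_def
    proof (rule sum_mono)
      fix i assume i: "i \<in> I"
      have "t * v i \<le> \<bar>t * v i\<bar>" by simp
      also have "\<dots> \<le> 1 * A" unfolding abs_mult using t v[OF i] A by (intro mult_mono) auto
      finally have "b * (t * v i) \<le> b * A" using b by simp
      then show "p i * (b * v i) ^ 0 * exp (b * (t * v i)) \<le> p i * exp (b * A)"
        using p[OF i] by (simp add: mult_left_mono)
    qed
    then show ?thesis using p1 by (simp flip: sum_distrib_right)
  qed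
  then have "ln (S 0 t) \<le> b * A" using S_pos[of t] by (metis ln_exp ln_le_cancel_iff exp_gt_zero)
  then have "g * ln (S 0 t) \<le> g * (b * A)" using g by (intro mult_left_mono) auto
  then have d0t: "0 \<le> d0 t" "d0 t \<le> exp A" using gb(1)[of A] by (auto simp: d0_def)
  let ?m = "b * A"
  \<comment> \<open>With \<open>0 < g \<le> 1\<close> the coefficients are at most
    \<open>2 * g\<close>, \<open>3 * g\<close> and \<open>g\<close>. Their sum \<open>6 * g\<close>
    cancels the \<open>fact 3\<close> of the remainder, and
    \<open>g * (b * A) ^ 3 = b\<^sup>2 * A ^ 3\<close>.\<close>
  have "\<bar>g * (g - 1) * (g - 2) * (q 1 t) ^ 3 + 3 * g * (g - 1) * q 1 t * q 2 t + g * q 3 t\<bar> \<le> 6 * g * ?m ^ 3"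
  proof -
    have m: "?m \<ge> 0" using A b by simp
    have "\<bar>g * (g - 1) * (g - 2) * (q 1 t) ^ 3\<bar> \<le> (g * 1 * 2) * ?m ^ 3"
      unfolding abs_mult power_abs using g q_bound[of 1 t] m
      by (intro mult_mono power_mono) auto
    moreover have "\<bar>3 * g * (g - 1) * q 1 t * q 2 t\<bar> \<le> 3 * g * 1 * ?m * ?m\<^sup>2"
      unfolding abs_mult using g q_bound[of 1 t] q_bound[of 2 t] m
      by (intro mult_mono) auto
    moreover have "\<bar>g * q 3 t\<bar> \<le> g * ?m ^ 3"
      unfolding abs_mult using g q_bound[of 3 t] by (intro mult_mono) auto
    ultimately show ?thesis by (simp add: power2_eq_square power3_eq_cube)
  qed
  then have "\<bar>d 3 t\<bar> \<le> exp A * (6 * g * ?m ^ 3)"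
    unfolding d_def using d0t by (auto simp: abs_mult intro!: mult_mono)
  moreover have "g * ?m ^ 3 = b\<^sup>2 * A ^ 3"
    using g(3) by (simp add: power_mult_distrib power2_eq_square power3_eq_cube flip: mult.assoc)
  moreover have "exp A * (6 * g * ?m ^ 3) = 6 * (g * ?m ^ 3) * exp A" by simp
  ultimately have "\<bar>d 3 t / 6\<bar> \<le> b\<^sup>2 * A ^ 3 * exp A"
    by simp
  moreover have "fact 3 = (6::real)" by (simp add: fact_numeral)
  ultimately show ?thesis
    using tay sum3 d01 by simp
qed

text \<open>A sum is at most \<open>card I\<close> times its largest term. This reduces an
  exponential of several dependent variables to exponentials of single ones.\<close>

lemma exp_sum_le_sum_exp:
  fixes a :: "'i \<Rightarrow> real"
  assumes "finite I" "I \<noteq> {}"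
  shows "exp (\<Sum>i\<in>I. a i) \<le> (\<Sum>i\<in>I. exp (card I * a i))"
proof -
  define m where "m = Max (a ` I)"
  have "m \<in> a ` I" unfolding m_def using assms by (intro Max_in) auto
  then obtain i where i: "i \<in> I" "a i = m" by auto
  have "(\<Sum>i\<in>I. a i) \<le> of_nat (card I) * m"
    using assms by (intro sum_bounded_above) (auto simp: m_def)
  then have "exp (\<Sum>i\<in>I. a i) \<le> exp (card I * a i)" using i by simp
  also have "\<dots> \<le> (\<Sum>i\<in>I. exp (card I * a i))"
    using assms i by (intro member_le_sum) auto
  finally show ?thesis .
qed

lemma gaussian_family_exp_integrable:
  assumes W: "gaussian_family M I W"
  shows "integrable M (\<lambda>\<omega>. exp (t * (\<Sum>i\<in>I. \<bar>W i \<omega>\<bar> + c i)))"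
proof (cases "I = {}")
  case True
  interpret prob_space M using W by (rule gaussian_familyD)
  show ?thesis using True by simp
next
  case False
  interpret prob_space M using W by (rule gaussian_familyD)
  note I = gaussian_familyD(2)[OF W]
  note [measurable] = gaussian_family_measurable[OF W]
  define n where "n = real (card I)"
  have exp_int: "integrable M (\<lambda>\<omega>. exp (s * W i \<omega>))" if "i \<in> I" for i s
    by (rule centered_normal_rv_moments[OF prob_space_axioms gaussian_family_single[OF W that]])
  show ?thesis
  proof (rule Bochner_Integration.integrable_bound)
    show "integrable M (\<lambda>\<omega>. \<Sum>i\<in>I. exp (n * (t * c i)) * (exp ((n * t) * W i \<omega>) + exp ((- n * t) * W i \<omega>)))"
      by (intro Bochner_Integration.integrable_sum integrable_mult_right Bochner_Integration.integrable_add exp_int)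
    show "AE \<omega> in M. norm (exp (t * (\<Sum>i\<in>I. \<bar>W i \<omega>\<bar> + c i)))
      \<le> norm (\<Sum>i\<in>I. exp (n * (t * c i)) * (exp ((n * t) * W i \<omega>) + exp ((- n * t) * W i \<omega>)))"
    proof (rule AE_I2)
      fix \<omega>
      have "exp (t * (\<Sum>i\<in>I. \<bar>W i \<omega>\<bar> + c i)) \<le> (\<Sum>i\<in>I. exp (n * (t * (\<bar>W i \<omega>\<bar> + c i))))"
        unfolding n_def sum_distrib_left by (rule exp_sum_le_sum_exp[OF I False])
      also have "\<dots> \<le> (\<Sum>i\<in>I. exp (n * (t * c i)) * (exp ((n * t) * W i \<omega>) + exp ((- n * t) * W i \<omega>)))"
      proof (rule sum_mono)
        fix i
        have "exp ((n * t) * \<bar>w\<bar>) \<le> exp ((n * t) * w) + exp ((- n * t) * w)" for w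
          by (cases "w \<ge> 0") (auto simp: abs_if)
        then have "exp (n * (t * c i)) * exp ((n * t) * \<bar>W i \<omega>\<bar>) \<le> exp (n * (t * c i)) * (exp ((n * t) * W i \<omega>) + exp ((- n * t) * W i \<omega>))"
          by (intro mult_left_mono) auto
        then show "exp (n * (t * (\<bar>W i \<omega>\<bar> + c i))) \<le> exp (n * (t * c i)) * (exp ((n * t) * W i \<omega>) + exp ((- n * t) * W i \<omega>))"
          by (simp add: algebra_simps mult_exp_exp)
      qed
      finally show "norm (exp (t * (\<Sum>i\<in>I. \<bar>W i \<omega>\<bar> + c i)))
        \<le> norm (\<Sum>i\<in>I. exp (n * (t * c i)) * (exp ((n * t) * W i \<omega>) + exp ((- n * t) * W i \<omega>)))"
        by simp
    qed
  qed measurable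
qed

text \<open>With the drift \<open>- h * c i / 2\<close> the first-order effect of a Gaussian increment of variance \<open>h\<close>
  depends on \<open>W\<close> only through its variogram.\<close>

lemma softmax_step:
  fixes W :: "'i \<Rightarrow> 'a \<Rightarrow> real" and M :: "'a measure"
  defines "c \<equiv> \<lambda>i. \<integral>\<omega>. (W i \<omega>)\<^sup>2 \<partial>M"
  assumes W: "gaussian_family M I W" and b: "b \<ge> 1"
  shows "\<exists>K\<ge>0. \<forall>h p. 0 < h \<longrightarrow> h \<le> 1 \<longrightarrow> (\<forall>i\<in>I. p i \<ge> 0) \<longrightarrow> (\<Sum>i\<in>I. p i) = 1 \<longrightarrow>
      integrable M (\<lambda>\<omega>. (\<Sum>i\<in>I. p i * exp (b * (sqrt h * W i \<omega> - h * c i / 2))) powr (1 / b)) \<and>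
      \<bar>(\<integral>\<omega>. (\<Sum>i\<in>I. p i * exp (b * (sqrt h * W i \<omega> - h * c i / 2))) powr (1 / b) \<partial>M) -
       (1 + h / 2 * (b - 1) * ((\<Sum>i\<in>I. \<Sum>j\<in>I. p i * p j * (\<integral>\<omega>. (W i \<omega> - W j \<omega>)\<^sup>2 \<partial>M)) / 2))\<bar>
      \<le> K * (h * sqrt h)"
proof -
  interpret prob_space M using W by (rule gaussian_familyD)
  note I = gaussian_familyD(2)[OF W]
  note [measurable] = gaussian_family_measurable[OF W]
  note single = centered_normal_rv_moments[OF prob_space_axioms gaussian_family_single[OF W]]
  note diff = centered_normal_rv_moments[OF prob_space_axioms gaussian_family_diff[OF W]]
  have c: "c i \<ge> 0" for i by (simp add: c_def)
  \<comment> \<open>One random variable that dominates all coordinates and drifts at once; its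
    exponential moments make the Taylor remainder integrable.\<close>
  define A where "A \<omega> = (\<Sum>i\<in>I. \<bar>W i \<omega>\<bar> + c i)" for \<omega>
  have A0: "A \<omega> \<ge> 0" for \<omega> using c by (auto simp: A_def intro!: sum_nonneg)
  have [measurable]: "A \<in> borel_measurable M" unfolding A_def by measurable
  have A_int: "integrable M (\<lambda>\<omega>. exp (4 * A \<omega>))"
    unfolding A_def by (rule gaussian_family_exp_integrable[OF W])
  define Cs where "Cs = (\<Sum>i\<in>I. c i)"
  have cCs: "c i \<le> Cs" if "i \<in> I" for i
    unfolding Cs_def using c I that by (intro member_le_sum) auto
  have Cs: "Cs \<ge> 0" using c by (auto simp: Cs_def intro!: sum_nonneg)
  \<comment> \<open>The first term pays for the Taylor remainder, the second for the terms of order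
    \<open>h\<^sup>2\<close> produced by the squared drift. Neither depends on \<open>h\<close> or
    on the weights \<open>p\<close>.\<close>
  define K where "K = b\<^sup>2 * (\<integral>\<omega>. exp (4 * A \<omega>) \<partial>M) + 2 * b * Cs\<^sup>2"
  have "K \<ge> 0" using b by (auto simp: K_def intro!: add_nonneg_nonneg)
  then show ?thesis
  proof (intro exI[of _ K] conjI[of "0 \<le> K"] allI impI)
    fix h :: real and p :: "'i \<Rightarrow> real"
    assume h: "0 < h" "h \<le> 1" and p': "\<forall>i\<in>I. p i \<ge> 0" and p1: "(\<Sum>i\<in>I. p i) = 1"
    have p: "p i \<ge> 0" if "i \<in> I" for i using p' that by blast
    define s where "s = sqrt h"
    have s: "0 < s" "s \<le> 1" "s * s = h" using h by (auto simp: s_def)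
    have hs: "h \<le> s" using s mult_left_mono[of s 1 s] by simp
    define v where "v i \<omega> = s * W i \<omega> - h * c i / 2" for i \<omega>
    define G where "G \<omega> = (\<Sum>i\<in>I. p i * exp (b * v i \<omega>)) powr (1 / b)" for \<omega>
    define T where "T \<omega> = 1 + (\<Sum>i\<in>I. p i * v i \<omega>) + ((1 - b) * (\<Sum>i\<in>I. p i * v i \<omega>)\<^sup>2 + b * (\<Sum>i\<in>I. p i * (v i \<omega>)\<^sup>2)) / 2" for \<omega>
    have [measurable]: "v i \<in> borel_measurable M" if "i \<in> I" for i
      unfolding v_def using that by measurable
    have [measurable]: "G \<in> borel_measurable M" unfolding G_def by measurable
    have GT: "\<bar>G \<omega> - T \<omega>\<bar> \<le> b\<^sup>2 * (h * s) * exp (4 * A \<omega>)" for \<omega>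
    proof -
      have v_le: "\<bar>v i \<omega>\<bar> \<le> s * A \<omega>" if i: "i \<in> I" for i
      proof -
        have "\<bar>v i \<omega>\<bar> \<le> s * \<bar>W i \<omega>\<bar> + h * c i / 2"
          using s h c[of i] abs_triangle_ineq4[of "s * W i \<omega>" "h * c i / 2"] by (simp add: v_def abs_mult)
        also have "h * c i / 2 \<le> s * c i" using hs c[of i] s mult_right_mono[OF hs c[of i]]
          mult_nonneg_nonneg[of h "c i"] h by linarith
        also have "s * \<bar>W i \<omega>\<bar> + s * c i = s * (\<bar>W i \<omega>\<bar> + c i)" by (simp add: algebra_simps)
        also have "\<dots> \<le> s * A \<omega>"
          unfolding A_def using i I c s by (intro mult_left_mono member_le_sum) auto
        finally show ?thesis by simp
      qed
      have 1: "\<bar>G \<omega> - T \<omega>\<bar> \<le> b\<^sup>2 * (s * A \<omega>) ^ 3 * exp (s * A \<omega>)"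
        unfolding G_def T_def by (rule softmax_taylor[OF I b p p1 v_le])
      \<comment> \<open>The cube supplies the order \<open>h * sqrt h\<close>; the exponent 4
        collects \<open>A ^ 3 \<le> exp (3 * A)\<close> and
        \<open>exp (s * A) \<le> exp A\<close>.\<close>
      have 2: "(s * A \<omega>) ^ 3 * exp (s * A \<omega>) \<le> ((h * s) * exp (3 * A \<omega>)) * exp (A \<omega>)"
      proof (rule mult_mono)
        have "A \<omega> ^ 3 \<le> exp (A \<omega>) ^ 3"
          using A0[of \<omega>] exp_ge_add_one_self[of "A \<omega>"] by (intro power_mono) linarith+
        then have "(h * s) * A \<omega> ^ 3 \<le> (h * s) * exp (3 * A \<omega>)"
          using s h by (intro mult_left_mono) (auto simp flip: exp_of_nat_mult)
        moreover have "(s * A \<omega>) ^ 3 = (h * s) * A \<omega> ^ 3"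
          by (simp add: power3_eq_cube mult_ac flip: s(3))
        ultimately show "(s * A \<omega>) ^ 3 \<le> (h * s) * exp (3 * A \<omega>)" by simp
        have "s * A \<omega> \<le> 1 * A \<omega>" using s A0 by (intro mult_right_mono) auto
        then show "exp (s * A \<omega>) \<le> exp (A \<omega>)" by simp
      qed (use s h in auto)
      have "b\<^sup>2 * ((s * A \<omega>) ^ 3 * exp (s * A \<omega>)) \<le> b\<^sup>2 * (((h * s) * exp (3 * A \<omega>)) * exp (A \<omega>))"
        by (rule mult_left_mono[OF 2]) simp
      also have "((h * s) * exp (3 * A \<omega>)) * exp (A \<omega>) = (h * s) * exp (4 * A \<omega>)"
        by (simp add: mult_exp_exp)
      finally show ?thesis using 1 by (simp only: mult.assoc)
    qed
    define N where "N \<omega> = (\<Sum>i\<in>I. p i * W i \<omega>)" for \<omega>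
    define Q where "Q \<omega> = (\<Sum>i\<in>I. p i * (W i \<omega>)\<^sup>2)" for \<omega>
    define L where "L \<omega> = (\<Sum>i\<in>I. p i * c i * W i \<omega>)" for \<omega>
    define P where "P \<omega> = (\<Sum>i\<in>I. \<Sum>j\<in>I. p i * p j * (W i \<omega> - W j \<omega>)\<^sup>2) / 2" for \<omega>
    define c1 where "c1 = (\<Sum>i\<in>I. p i * c i)"
    define c2 where "c2 = (\<Sum>i\<in>I. p i * (c i)\<^sup>2)"
    define D where "D = (\<Sum>i\<in>I. \<Sum>j\<in>I. p i * p j * (\<integral>\<omega>. (W i \<omega> - W j \<omega>)\<^sup>2 \<partial>M)) / 2"
    have N: "has_bochner_integral M N 0"
      unfolding N_def has_bochner_integral_iff using single by (auto simp: Bochner_Integration.integral_sum)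
    have L: "has_bochner_integral M L 0"
      unfolding L_def has_bochner_integral_iff using single by (auto simp: Bochner_Integration.integral_sum)
    have Q: "has_bochner_integral M Q c1"
      unfolding Q_def has_bochner_integral_iff c1_def using single(3) by (auto simp: Bochner_Integration.integral_sum c_def)
    have P: "has_bochner_integral M P D"
      unfolding P_def has_bochner_integral_iff D_def using diff(3) by (auto simp: Bochner_Integration.integral_sum)
    \<comment> \<open>Variance under the weights \<open>p\<close> equals half the mean squared
      difference of two independent draws. This is where the variogram enters.\<close>
    have QP: "(N \<omega>)\<^sup>2 = Q \<omega> - P \<omega>" for \<omega>
    proof -
      have "2 * P \<omega> = (\<Sum>i\<in>I. \<Sum>j\<in>I. p j * (p i * (W i \<omega>)\<^sup>2) + p i * (p j * (W j \<omega>)\<^sup>2) - 2 * ((p i * W i \<omega>) * (p j * W j \<omega>)))"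
        unfolding P_def by (simp add: power2_eq_square algebra_simps)
      also have "\<dots> = (\<Sum>i\<in>I. \<Sum>j\<in>I. p j * (p i * (W i \<omega>)\<^sup>2)) + (\<Sum>i\<in>I. \<Sum>j\<in>I. p i * (p j * (W j \<omega>)\<^sup>2)) - 2 * (\<Sum>i\<in>I. \<Sum>j\<in>I. (p i * W i \<omega>) * (p j * W j \<omega>))"
        by (simp add: sum.distrib sum_subtractf sum_distrib_left)
      also have "(\<Sum>i\<in>I. \<Sum>j\<in>I. p j * (p i * (W i \<omega>)\<^sup>2)) = Q \<omega>"
        using p1 by (simp add: Q_def flip: sum_distrib_right)
      also have "(\<Sum>i\<in>I. \<Sum>j\<in>I. p i * (p j * (W j \<omega>)\<^sup>2)) = Q \<omega>"
        using p1 by (simp add: Q_def flip: sum_distrib_left sum_distrib_right)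
      also have "(\<Sum>i\<in>I. \<Sum>j\<in>I. (p i * W i \<omega>) * (p j * W j \<omega>)) = (N \<omega>)\<^sup>2"
        by (simp add: N_def power2_eq_square sum_product)
      finally show ?thesis by simp
    qed
    have N2: "has_bochner_integral M (\<lambda>\<omega>. (N \<omega>)\<^sup>2) (c1 - D)"
      unfolding QP by (rule has_bochner_integral_diff[OF Q P])
    have T_eq: "T \<omega> = (1 - h * c1 / 2 + (1 - b) / 2 * (h\<^sup>2 * c1\<^sup>2 / 4) + b / 2 * (h\<^sup>2 * c2 / 4))
        + ((s - (1 - b) / 2 * (s * h * c1)) * N \<omega> + ((1 - b) / 2 * h) * (N \<omega>)\<^sup>2 + (b / 2 * h) * Q \<omega>
        - (b / 2 * (s * h)) * L \<omega>)" for \<omega>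
    proof -
      have 1: "(\<Sum>i\<in>I. p i * v i \<omega>) = s * N \<omega> - h * c1 / 2"
        unfolding v_def N_def c1_def
        by (simp add: sum_distrib_left sum_subtractf sum_divide_distrib right_diff_distrib mult_ac)
      have "(\<Sum>i\<in>I. p i * (v i \<omega>)\<^sup>2) = (\<Sum>i\<in>I. h * (p i * (W i \<omega>)\<^sup>2) - s * h * (p i * c i * W i \<omega>) + h\<^sup>2 / 4 * (p i * (c i)\<^sup>2))"
        unfolding v_def using s(3)
        by (intro sum.cong) (simp_all add: power2_eq_square algebra_simps flip: s(3))
      also have "\<dots> = h * Q \<omega> - s * h * L \<omega> + h\<^sup>2 / 4 * c2"
        by (simp add: Q_def L_def c2_def sum.distrib sum_subtractf sum_distrib_left)
      finally have 2: "(\<Sum>i\<in>I. p i * (v i \<omega>)\<^sup>2) = h * Q \<omega> - s * h * L \<omega> + h\<^sup>2 / 4 * c2" .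
      have 3: "(s * N \<omega> - h * c1 / 2)\<^sup>2 = h * (N \<omega>)\<^sup>2 - s * h * c1 * N \<omega> + h\<^sup>2 * c1\<^sup>2 / 4"
        by (simp add: power2_eq_square algebra_simps flip: s(3))
      show ?thesis
        unfolding T_def 1 2 3 by (simp add: field_simps)
    qed
    have T: "has_bochner_integral M T ((1 - h * c1 / 2 + (1 - b) / 2 * (h\<^sup>2 * c1\<^sup>2 / 4) + b / 2 * (h\<^sup>2 * c2 / 4))
        + ((s - (1 - b) / 2 * (s * h * c1)) * 0 + ((1 - b) / 2 * h) * (c1 - D) + (b / 2 * h) * c1 - (b / 2 * (s * h)) * 0))"
      (is "has_bochner_integral M T ?ET")
    proof -
      have "has_bochner_integral M (\<lambda>_. x) x" for x :: real
        by (simp add: has_bochner_integral_iff prob_space)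
      then show ?thesis
        unfolding T_eq
        by (rule has_bochner_integral_add)
          (intro has_bochner_integral_add has_bochner_integral_diff has_bochner_integral_mult_right N N2 Q L)
    qed
    \<comment> \<open>At order \<open>h\<close> the drift contributes \<open>- c1 / 2\<close> and
      the quadratic terms \<open>(1 - b) * c1 / 2 + b * c1 / 2\<close>. These cancel, so individual
      variances disappear and only \<open>D\<close> is left.\<close>
    have ET: "?ET = 1 + h / 2 * (b - 1) * D + h\<^sup>2 * ((1 - b) * c1\<^sup>2 + b * c2) / 8"
      by (simp add: field_simps)
    have R_int: "integrable M (\<lambda>\<omega>. b\<^sup>2 * (h * s) * exp (4 * A \<omega>))"
      using A_int by simp
    have GT_int: "integrable M (\<lambda>\<omega>. G \<omega> - T \<omega>)"
      by (rule Bochner_Integration.integrable_bound[OF R_int])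
        (use GT T h s in \<open>auto simp: has_bochner_integral_iff\<close>)
    have G_int: "integrable M G"
      using Bochner_Integration.integrable_add[OF GT_int, of T] T by (simp add: has_bochner_integral_iff)
    have "(\<integral>\<omega>. G \<omega> \<partial>M) - ?ET = (\<integral>\<omega>. G \<omega> - T \<omega> \<partial>M)"
      using T G_int by (simp add: has_bochner_integral_iff)
    then have "\<bar>(\<integral>\<omega>. G \<omega> \<partial>M) - ?ET\<bar> \<le> (\<integral>\<omega>. \<bar>G \<omega> - T \<omega>\<bar> \<partial>M)"
      using integral_abs_bound[of M "\<lambda>\<omega>. G \<omega> - T \<omega>"] by simp
    also have "\<dots> \<le> (\<integral>\<omega>. b\<^sup>2 * (h * s) * exp (4 * A \<omega>) \<partial>M)"
      by (intro integral_mono R_int integrable_abs GT_int GT)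
    finally have 1: "\<bar>(\<integral>\<omega>. G \<omega> \<partial>M) - ?ET\<bar> \<le> b\<^sup>2 * (\<integral>\<omega>. exp (4 * A \<omega>) \<partial>M) * (h * s)"
      by (simp add: mult_ac)
    have c1: "0 \<le> c1" "c1 \<le> Cs"
      using p p1 c cCs sum_mono[of I "\<lambda>i. p i * c i" "\<lambda>i. p i * Cs"]
      by (auto simp: c1_def intro!: sum_nonneg mult_left_mono simp flip: sum_distrib_right)
    have "(\<Sum>i\<in>I. p i * (c i)\<^sup>2) \<le> (\<Sum>i\<in>I. p i * Cs\<^sup>2)"
      using p c cCs by (intro sum_mono mult_left_mono power_mono) auto
    then have c2: "0 \<le> c2" "c2 \<le> Cs\<^sup>2"
      using p p1 by (auto simp: c2_def intro!: sum_nonneg simp flip: sum_distrib_right)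
    have "\<bar>(1 - b) * c1\<^sup>2\<bar> \<le> b * Cs\<^sup>2"
      unfolding abs_mult using b c1 by (intro mult_mono) (auto intro!: power_mono)
    moreover have "\<bar>b * c2\<bar> \<le> b * Cs\<^sup>2"
      unfolding abs_mult using b c2 by (intro mult_mono) auto
    ultimately have "\<bar>(1 - b) * c1\<^sup>2 + b * c2\<bar> \<le> 2 * b * Cs\<^sup>2" by linarith
    moreover have "h\<^sup>2 \<le> h * s" using hs h by (simp add: power2_eq_square)
    ultimately have "h\<^sup>2 * \<bar>(1 - b) * c1\<^sup>2 + b * c2\<bar> \<le> (h * s) * (2 * b * Cs\<^sup>2)"
      using h s by (intro mult_mono) auto
    moreover have "\<bar>h\<^sup>2 * ((1 - b) * c1\<^sup>2 + b * c2) / 8\<bar> = h\<^sup>2 * \<bar>(1 - b) * c1\<^sup>2 + b * c2\<bar> / 8"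
      "h\<^sup>2 * \<bar>(1 - b) * c1\<^sup>2 + b * c2\<bar> \<ge> 0"
      by (simp_all add: abs_mult)
    moreover have "(h * s) * (2 * b * Cs\<^sup>2) = 2 * b * Cs\<^sup>2 * (h * s)" by simp
    ultimately have 2: "\<bar>h\<^sup>2 * ((1 - b) * c1\<^sup>2 + b * c2) / 8\<bar> \<le> 2 * b * Cs\<^sup>2 * (h * s)"
      by linarith
    have "\<bar>(\<integral>\<omega>. G \<omega> \<partial>M) - (1 + h / 2 * (b - 1) * D)\<bar> \<le> K * (h * s)"
      using 1 2 unfolding ET K_def distrib_right by linarith
    then show "integrable M (\<lambda>\<omega>. (\<Sum>i\<in>I. p i * exp (b * (sqrt h * W i \<omega> - h * c i / 2))) powr (1 / b)) \<and>
      \<bar>(\<integral>\<omega>. (\<Sum>i\<in>I. p i * exp (b * (sqrt h * W i \<omega> - h * c i / 2))) powr (1 / b) \<partial>M) -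
       (1 + h / 2 * (b - 1) * ((\<Sum>i\<in>I. \<Sum>j\<in>I. p i * p j * (\<integral>\<omega>. (W i \<omega> - W j \<omega>)\<^sup>2 \<partial>M)) / 2))\<bar>
      \<le> K * (h * sqrt h)"
      using G_int unfolding G_def v_def D_def s_def by simp
  qed
qed

section \<open>Soft maximum and exchange of increments\<close>

text \<open>The \<open>b\<close>-norm of the vector with entries \<open>exp (u i)\<close>. It
  approximates the exponential of the maximum, not the maximum itself.\<close>

definition softmax :: "real \<Rightarrow> 'i set \<Rightarrow> ('i \<Rightarrow> real) \<Rightarrow> real" where
  "softmax b I u = (\<Sum>i\<in>I. exp (b * u i)) powr (1 / b)"

lemma softmax_nonneg: "0 \<le> softmax b I u"
  by (simp add: softmax_def)

lemma softmax_cong: "(\<And>i. i \<in> I \<Longrightarrow> u i = v i) \<Longrightarrow> softmax b I u = softmax b I v"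
  by (simp add: softmax_def)

lemma softmax_measurable [measurable]:
  assumes [measurable]: "\<And>i. i \<in> I \<Longrightarrow> (\<lambda>x. u x i) \<in> borel_measurable M"
  shows "(\<lambda>x. softmax b I (u x)) \<in> borel_measurable M"
  unfolding softmax_def by measurable

lemma exp_le_softmax:
  assumes "finite I" "i \<in> I" "b > 0"
  shows "exp (u i) \<le> softmax b I u"
proof -
  have "exp (u i) = exp (b * u i) powr (1 / b)"
    using assms by (simp add: powr_def)
  also have "\<dots> \<le> softmax b I u"
    unfolding softmax_def using assms by (intro powr_mono2 member_le_sum) auto
  finally show ?thesis .
qed

lemma softmax_le:
  assumes "finite I" "b > 0" and le: "\<And>i. i \<in> I \<Longrightarrow> u i \<le> m"
  shows "softmax b I u \<le> real (card I) powr (1 / b) * exp m"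
proof -
  have "(\<Sum>i\<in>I. exp (b * u i)) \<le> real (card I) * exp (b * m)"
    using assms by (intro sum_bounded_above) auto
  then have "softmax b I u \<le> (real (card I) * exp (b * m)) powr (1 / b)"
    unfolding softmax_def using assms by (intro powr_mono2 sum_nonneg) auto
  also have "\<dots> = real (card I) powr (1 / b) * exp m"
    using assms by (simp add: powr_mult powr_def[of "exp _"])
  finally show ?thesis .
qed

text \<open>A crude majorant whose Gaussian expectation is explicit. The factor
  \<open>card I\<close> enters only a constant that is later multiplied by a null sequence.\<close>

lemma softmax_le_sum:
  assumes "finite I" "b \<ge> 1"
  shows "softmax b I u \<le> real (card I) * (\<Sum>i\<in>I. exp (u i))"
proof (cases "I = {}")
  case True
  then show ?thesis by (simp add: softmax_def)
next
  case False
  define m where "m = Max (u ` I)"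
  have "m \<in> u ` I" unfolding m_def using assms False by (intro Max_in) auto
  then obtain i where i: "i \<in> I" "u i = m" by auto
  have "softmax b I u \<le> real (card I) powr (1 / b) * exp m"
    using assms by (intro softmax_le) (auto simp: m_def)
  also have "\<dots> \<le> real (card I) powr 1 * (\<Sum>i\<in>I. exp (u i))"
  proof (rule mult_mono)
    have "card I \<ge> 1" using assms False by (simp add: Suc_le_eq card_gt_0_iff)
    then show "real (card I) powr (1 / b) \<le> real (card I) powr 1"
      using assms by (intro powr_mono) auto
    show "exp m \<le> (\<Sum>i\<in>I. exp (u i))"
      unfolding i(2)[symmetric] using assms i by (intro member_le_sum) auto
  qed auto
  finally show ?thesis by simp
qed

text \<open>Normalizing \<open>exp (b * u i)\<close> to weights \<open>p\<close> factors
  \<open>softmax b I u\<close> out, after which the expansions for \<open>X\<close> and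
  \<open>Y\<close> differ at order \<open>h\<close> only in the averaged variogram, ordered by
  \<open>V\<close>. The constant \<open>K\<close> is uniform in \<open>u\<close>, so the step may be
  integrated over a random \<open>u\<close> and iterated.\<close>

lemma softmax_compare_step:
  fixes X :: "'i \<Rightarrow> 'a \<Rightarrow> real" and Y :: "'i \<Rightarrow> 'b \<Rightarrow> real"
    and M :: "'a measure" and N :: "'b measure"
  defines "cX \<equiv> \<lambda>i. \<integral>\<omega>. (X i \<omega>)\<^sup>2 \<partial>M" and "cY \<equiv> \<lambda>i. \<integral>\<omega>. (Y i \<omega>)\<^sup>2 \<partial>N"
  assumes X: "gaussian_family M I X" and Y: "gaussian_family N I Y" and b: "b \<ge> 1" and ne: "I \<noteq> {}"
    and V: "\<And>i j. i \<in> I \<Longrightarrow> j \<in> I \<Longrightarrow>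
      (\<integral>\<omega>. (X i \<omega> - X j \<omega>)\<^sup>2 \<partial>M) \<le> (\<integral>\<omega>. (Y i \<omega> - Y j \<omega>)\<^sup>2 \<partial>N)"
  shows "\<exists>K\<ge>0. \<forall>h u. 0 < h \<longrightarrow> h \<le> 1 \<longrightarrow>
      (\<integral>\<^sup>+\<omega>. ennreal (softmax b I (\<lambda>i. u i + sqrt h * X i \<omega> - h * cX i / 2)) \<partial>M) \<le>
      (\<integral>\<^sup>+\<omega>. ennreal (softmax b I (\<lambda>i. u i + sqrt h * Y i \<omega> - h * cY i / 2)) \<partial>N)
       + ennreal (K * (h * sqrt h)) * ennreal (softmax b I u)"
proof -
  note I = gaussian_familyD(2)[OF X]
  have cX: "(\<integral>\<omega>. (X i \<omega>)\<^sup>2 \<partial>M) = cX i" and cY: "(\<integral>\<omega>. (Y i \<omega>)\<^sup>2 \<partial>N) = cY i" for i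
    by (simp_all add: cX_def cY_def)
  from softmax_step[OF X b, unfolded cX] obtain K1 where K1: "K1 \<ge> 0"
    and st1: "0 < h \<Longrightarrow> h \<le> 1 \<Longrightarrow> \<forall>i\<in>I. p i \<ge> 0 \<Longrightarrow> (\<Sum>i\<in>I. p i) = 1 \<Longrightarrow>
      integrable M (\<lambda>\<omega>. (\<Sum>i\<in>I. p i * exp (b * (sqrt h * X i \<omega> - h * cX i / 2))) powr (1 / b)) \<and>
      \<bar>(\<integral>\<omega>. (\<Sum>i\<in>I. p i * exp (b * (sqrt h * X i \<omega> - h * cX i / 2))) powr (1 / b) \<partial>M) -
       (1 + h / 2 * (b - 1) * ((\<Sum>i\<in>I. \<Sum>j\<in>I. p i * p j * (\<integral>\<omega>. (X i \<omega> - X j \<omega>)\<^sup>2 \<partial>M)) / 2))\<bar>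
      \<le> K1 * (h * sqrt h)" for h p
    by blast
  from softmax_step[OF Y b, unfolded cY] obtain K2 where K2: "K2 \<ge> 0"
    and st2: "0 < h \<Longrightarrow> h \<le> 1 \<Longrightarrow> \<forall>i\<in>I. p i \<ge> 0 \<Longrightarrow> (\<Sum>i\<in>I. p i) = 1 \<Longrightarrow>
      integrable N (\<lambda>\<omega>. (\<Sum>i\<in>I. p i * exp (b * (sqrt h * Y i \<omega> - h * cY i / 2))) powr (1 / b)) \<and>
      \<bar>(\<integral>\<omega>. (\<Sum>i\<in>I. p i * exp (b * (sqrt h * Y i \<omega> - h * cY i / 2))) powr (1 / b) \<partial>N) -
       (1 + h / 2 * (b - 1) * ((\<Sum>i\<in>I. \<Sum>j\<in>I. p i * p j * (\<integral>\<omega>. (Y i \<omega> - Y j \<omega>)\<^sup>2 \<partial>N)) / 2))\<bar>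
      \<le> K2 * (h * sqrt h)" for h p
    by blast
  have "K1 + K2 \<ge> 0" using K1 K2 by simp
  then show ?thesis
  proof (intro exI[of _ "K1 + K2"] conjI allI impI)
    fix h :: real and u :: "'i \<Rightarrow> real" assume h: "0 < h" "h \<le> 1"
    define S where "S = (\<Sum>i\<in>I. exp (b * u i))"
    have S: "S > 0" unfolding S_def using I ne by (intro sum_pos) auto
    define p where "p i = exp (b * u i) / S" for i
    have p: "p i \<ge> 0" for i using S by (simp add: p_def)
    have p1: "(\<Sum>i\<in>I. p i) = 1" using S by (simp add: p_def S_def flip: sum_divide_distrib)
    have fac: "softmax b I (\<lambda>i. u i + v i - w i) = softmax b I u * (\<Sum>i\<in>I. p i * exp (b * (v i - w i))) powr (1 / b)" for v w
    proof -
      have "(\<Sum>i\<in>I. exp (b * (u i + v i - w i))) = S * (\<Sum>i\<in>I. p i * exp (b * (v i - w i)))"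
        unfolding sum_distrib_left using S
        by (intro sum.cong) (auto simp: p_def algebra_simps simp flip: exp_add)
      then show ?thesis
        using S p by (simp add: softmax_def powr_mult sum_nonneg flip: S_def)
    qed
    define meanX where "meanX = (\<integral>\<omega>. (\<Sum>i\<in>I. p i * exp (b * (sqrt h * X i \<omega> - h * cX i / 2))) powr (1 / b) \<partial>M)"
    define meanY where "meanY = (\<integral>\<omega>. (\<Sum>i\<in>I. p i * exp (b * (sqrt h * Y i \<omega> - h * cY i / 2))) powr (1 / b) \<partial>N)"
    note s1 = st1[OF h ballI[OF p] p1] and s2 = st2[OF h ballI[OF p] p1]
    have meanX: "(\<integral>\<^sup>+\<omega>. ennreal (softmax b I (\<lambda>i. u i + sqrt h * X i \<omega> - h * cX i / 2)) \<partial>M) = ennreal (softmax b I u * meanX)"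
      unfolding fac meanX_def using s1
      by (subst nn_integral_eq_integral) (auto simp: softmax_nonneg)
    have meanY: "(\<integral>\<^sup>+\<omega>. ennreal (softmax b I (\<lambda>i. u i + sqrt h * Y i \<omega> - h * cY i / 2)) \<partial>N) = ennreal (softmax b I u * meanY)"
      unfolding fac meanY_def using s2
      by (subst nn_integral_eq_integral) (auto simp: softmax_nonneg)
    have "(\<Sum>i\<in>I. \<Sum>j\<in>I. p i * p j * (\<integral>\<omega>. (X i \<omega> - X j \<omega>)\<^sup>2 \<partial>M)) \<le> (\<Sum>i\<in>I. \<Sum>j\<in>I. p i * p j * (\<integral>\<omega>. (Y i \<omega> - Y j \<omega>)\<^sup>2 \<partial>N))"
      using p V by (intro sum_mono mult_left_mono) auto
    then have "h / 2 * (b - 1) * ((\<Sum>i\<in>I. \<Sum>j\<in>I. p i * p j * (\<integral>\<omega>. (X i \<omega> - X j \<omega>)\<^sup>2 \<partial>M)) / 2)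
      \<le> h / 2 * (b - 1) * ((\<Sum>i\<in>I. \<Sum>j\<in>I. p i * p j * (\<integral>\<omega>. (Y i \<omega> - Y j \<omega>)\<^sup>2 \<partial>N)) / 2)"
      using h b by (intro mult_left_mono) auto
    then have "meanX \<le> meanY + (K1 + K2) * (h * sqrt h)"
      using s1 s2 unfolding meanX_def[symmetric] meanY_def[symmetric] distrib_right by linarith
    from mult_left_mono[OF this softmax_nonneg[of b I u]]
    have le: "softmax b I u * meanX \<le> softmax b I u * meanY + (K1 + K2) * (h * sqrt h) * softmax b I u"
      by (simp add: algebra_simps)
    have "meanY \<ge> 0" by (simp add: meanY_def)
    show "(\<integral>\<^sup>+\<omega>. ennreal (softmax b I (\<lambda>i. u i + sqrt h * X i \<omega> - h * cX i / 2)) \<partial>M) \<le>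
      (\<integral>\<^sup>+\<omega>. ennreal (softmax b I (\<lambda>i. u i + sqrt h * Y i \<omega> - h * cY i / 2)) \<partial>N)
       + ennreal ((K1 + K2) * (h * sqrt h)) * ennreal (softmax b I u)"
    proof -
      have "ennreal (softmax b I u * meanX) \<le> ennreal (softmax b I u * meanY + (K1 + K2) * (h * sqrt h) * softmax b I u)"
        by (rule ennreal_leI[OF le])
      also have "\<dots> = ennreal (softmax b I u * meanY) + ennreal ((K1 + K2) * (h * sqrt h) * softmax b I u)"
        using K1 K2 h \<open>meanY \<ge> 0\<close> softmax_nonneg[of b I u] by (intro ennreal_plus mult_nonneg_nonneg) auto
      finally show ?thesis
        unfolding meanX meanY by (simp add: ennreal_mult'' softmax_nonneg)
    qed
  qed
qed

text \<open>Characteristic functions of independent copies multiply, so the variances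
  \<open>a\<close> and \<open>h\<close> add. The product space supplies the copy, which lets an
  increment be split off a vector that lives on one given space.\<close>

lemma gaussian_family_independent_sum:
  assumes X: "gaussian_family M I X" and a: "a \<ge> 0" "h \<ge> 0"
    and G: "G \<in> borel_measurable (\<Pi>\<^sub>M i\<in>I. (borel :: real measure))"
  shows "(\<integral>\<^sup>+\<omega>. \<integral>\<^sup>+\<omega>'. G (\<lambda>i\<in>I. sqrt a * X i \<omega> + sqrt h * X i \<omega>') \<partial>M \<partial>M) =
    (\<integral>\<^sup>+\<omega>. G (\<lambda>i\<in>I. sqrt (a + h) * X i \<omega>) \<partial>M)"
proof -
  interpret prob_space M using X by (rule gaussian_familyD)
  interpret P: pair_prob_space M M ..
  note I = gaussian_familyD(2)[OF X]
  note [measurable] = gaussian_family_measurable[OF X]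
  have cf: "(CLINT \<omega>|M. iexp (s * (\<Sum>i\<in>I. t i * X i \<omega>))) = of_real (exp (- (s\<^sup>2 * (\<integral>\<omega>. (\<Sum>i\<in>I. t i * X i \<omega>)\<^sup>2 \<partial>M)) / 2))" for s t
  proof -
    have "s * (\<Sum>i\<in>I. t i * X i \<omega>) = (\<Sum>i\<in>I. (s * t i) * X i \<omega>)" for \<omega>
      by (simp add: sum_distrib_left mult_ac)
    then have "centered_normal_rv M (\<lambda>\<omega>. s * (\<Sum>i\<in>I. t i * X i \<omega>))"
      using gaussian_familyD(3)[OF X, of "\<lambda>i. s * t i"] by simp
    from centered_normal_rv_moments(6)[OF prob_space_axioms this] show ?thesis
      by (simp add: power_mult_distrib)
  qed
  have law: "distr (M \<Otimes>\<^sub>M M) (\<Pi>\<^sub>M i\<in>I. borel) (\<lambda>\<omega>. \<lambda>i\<in>I. sqrt a * X i (fst \<omega>) + sqrt h * X i (snd \<omega>)) =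
    distr M (\<Pi>\<^sub>M i\<in>I. borel) (\<lambda>\<omega>. \<lambda>i\<in>I. sqrt (a + h) * X i \<omega>)"
  proof (rule joint_law_eqI[OF P.prob_space_axioms prob_space_axioms I])
    fix t :: "'b \<Rightarrow> real"
    define Z where "Z \<omega> = (\<Sum>i\<in>I. t i * X i \<omega>)" for \<omega>
    have [measurable]: "Z \<in> borel_measurable M" unfolding Z_def by measurable
    have 1: "(\<Sum>i\<in>I. t i * (sqrt a * X i (fst \<omega>) + sqrt h * X i (snd \<omega>))) = sqrt a * Z (fst \<omega>) + sqrt h * Z (snd \<omega>)" for \<omega>
      by (simp add: Z_def sum_distrib_left sum.distrib algebra_simps)
    have 2: "(\<Sum>i\<in>I. t i * (sqrt (a + h) * X i \<omega>)) = sqrt (a + h) * Z \<omega>" for \<omega>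
      by (simp add: Z_def sum_distrib_left mult_ac)
    have int: "integrable (M \<Otimes>\<^sub>M M) (\<lambda>\<omega>. iexp (sqrt a * Z (fst \<omega>) + sqrt h * Z (snd \<omega>)))"
      by (rule P.integrable_const_bound[where B=1]) auto
    have "(CLINT \<omega>|M \<Otimes>\<^sub>M M. iexp (sqrt a * Z (fst \<omega>) + sqrt h * Z (snd \<omega>))) =
        (CLINT x|M. CLINT y|M. iexp (sqrt a * Z x) * iexp (sqrt h * Z y))"
      using P.integral_fst'[OF int] by (simp add: distrib_left exp_add)
    also have "\<dots> = (CLINT x|M. iexp (sqrt a * Z x)) * (CLINT y|M. iexp (sqrt h * Z y))"
      by simp
    also have "\<dots> = (CLINT x|M. iexp (sqrt (a + h) * Z x))"
      unfolding Z_def cf using a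
      by (simp add: algebra_simps add_divide_distrib mult_exp_exp flip: exp_add of_real_mult)
    finally show "(CLINT \<omega>|M \<Otimes>\<^sub>M M. iexp (\<Sum>i\<in>I. t i * (sqrt a * X i (fst \<omega>) + sqrt h * X i (snd \<omega>)))) =
        (CLINT \<omega>|M. iexp (\<Sum>i\<in>I. t i * (sqrt (a + h) * X i \<omega>)))"
      unfolding 1 2 .
  qed measurable
  have ms: "(\<lambda>\<omega>. \<lambda>i\<in>I. sqrt a * X i (fst \<omega>) + sqrt h * X i (snd \<omega>)) \<in> measurable (M \<Otimes>\<^sub>M M) (\<Pi>\<^sub>M i\<in>I. borel)"
    "(\<lambda>\<omega>. \<lambda>i\<in>I. sqrt (a + h) * X i \<omega>) \<in> measurable M (\<Pi>\<^sub>M i\<in>I. borel)"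
    by measurable
  have "(\<integral>\<^sup>+\<omega>. \<integral>\<^sup>+\<omega>'. G (\<lambda>i\<in>I. sqrt a * X i \<omega> + sqrt h * X i \<omega>') \<partial>M \<partial>M) =
     (\<integral>\<^sup>+\<omega>. G (\<lambda>i\<in>I. sqrt a * X i (fst \<omega>) + sqrt h * X i (snd \<omega>)) \<partial>(M \<Otimes>\<^sub>M M))"
    using nn_integral_fst[OF measurable_compose[OF ms(1) G]] by simp
  also have "\<dots> = (\<integral>\<^sup>+x. G x \<partial>distr (M \<Otimes>\<^sub>M M) (\<Pi>\<^sub>M i\<in>I. borel) (\<lambda>\<omega>. \<lambda>i\<in>I. sqrt a * X i (fst \<omega>) + sqrt h * X i (snd \<omega>)))"
    by (rule nn_integral_distr[OF ms(1), symmetric]) (simp add: G)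
  also have "\<dots> = (\<integral>\<^sup>+\<omega>. G (\<lambda>i\<in>I. sqrt (a + h) * X i \<omega>) \<partial>M)"
    unfolding law by (rule nn_integral_distr[OF ms(2)]) (simp add: G)
  finally show ?thesis .
qed

lemma gaussian_family_exp_moment:
  assumes X: "gaussian_family M I X" and "i \<in> I"
  shows "(\<integral>\<^sup>+\<omega>. ennreal (exp (t * X i \<omega>)) \<partial>M) = ennreal (exp (t\<^sup>2 * (\<integral>\<omega>. (X i \<omega>)\<^sup>2 \<partial>M) / 2))"
proof -
  note m = centered_normal_rv_moments[OF gaussian_familyD(1)[OF X] gaussian_family_single[OF assms]]
  show ?thesis using m(4,5) by (subst nn_integral_eq_integral) auto
qed

lemma softmax_gaussian_compare:
  fixes X :: "'i \<Rightarrow> 'a \<Rightarrow> real" and Y :: "'i \<Rightarrow> 'b \<Rightarrow> real"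
    and M :: "'a measure" and N :: "'b measure"
  defines "cX \<equiv> \<lambda>i. \<integral>\<omega>. (X i \<omega>)\<^sup>2 \<partial>M" and "cY \<equiv> \<lambda>i. \<integral>\<omega>. (Y i \<omega>)\<^sup>2 \<partial>N"
  assumes X: "gaussian_family M I X" and Y: "gaussian_family N I Y" and b: "b \<ge> 1" and ne: "I \<noteq> {}"
    and V: "\<And>i j. i \<in> I \<Longrightarrow> j \<in> I \<Longrightarrow>
      (\<integral>\<omega>. (X i \<omega> - X j \<omega>)\<^sup>2 \<partial>M) \<le> (\<integral>\<omega>. (Y i \<omega> - Y j \<omega>)\<^sup>2 \<partial>N)"
  shows "(\<integral>\<^sup>+\<omega>. ennreal (softmax b I (\<lambda>i. X i \<omega> - cX i / 2 - f i)) \<partial>M) \<le>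
    (\<integral>\<^sup>+\<omega>. ennreal (softmax b I (\<lambda>i. Y i \<omega> - cY i / 2 - f i)) \<partial>N)"
proof -
  interpret M: prob_space M using X by (rule gaussian_familyD)
  interpret N: prob_space N using Y by (rule gaussian_familyD)
  interpret P: pair_sigma_finite M N ..
  note I = gaussian_familyD(2)[OF X]
  note [measurable] = gaussian_family_measurable[OF X] gaussian_family_measurable[OF Y]
  \<comment> \<open>\<open>Psi 1 0\<close> and \<open>Psi 0 1\<close> are the two sides; each step trades an increment of \<open>X\<close> for one of \<open>Y\<close> at cost
    \<open>O(h powr (3 / 2))\<close>, hence \<open>n\<close> steps with \<open>h = 1 / n\<close> cost \<open>O(1 / sqrt n)\<close>.\<close>
  define d where "d a a' i = (a * cX i + a' * cY i) / 2 + f i" for a a' i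
  define Psi where "Psi a a' = (\<integral>\<^sup>+x. \<integral>\<^sup>+y. ennreal (softmax b I (\<lambda>i. sqrt a * X i x + sqrt a' * Y i y - d a a' i)) \<partial>N \<partial>M)" for a a'
  from softmax_compare_step[OF X Y b ne V]
  obtain K where K: "K \<ge> 0" and step: "\<And>h u. 0 < h \<Longrightarrow> h \<le> 1 \<Longrightarrow>
      (\<integral>\<^sup>+\<omega>. ennreal (softmax b I (\<lambda>i. u i + sqrt h * X i \<omega> - h * cX i / 2)) \<partial>M) \<le>
      (\<integral>\<^sup>+\<omega>. ennreal (softmax b I (\<lambda>i. u i + sqrt h * Y i \<omega> - h * cY i / 2)) \<partial>N)
       + ennreal (K * (h * sqrt h)) * ennreal (softmax b I u)"
    unfolding cX_def cY_def by blast
  define C where "C = real (card I) * (\<Sum>i\<in>I. exp (- f i))"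
  have C: "C \<ge> 0" by (auto simp: C_def intro!: sum_nonneg mult_nonneg_nonneg)
  \<comment> \<open>The drift in \<open>d\<close> normalizes the exponential moments exactly, so the
    bound depends on neither \<open>a\<close> nor \<open>a'\<close> and serves every step of the
    exchange.\<close>
  have Psi_le: "Psi a a' \<le> ennreal C" if a: "a \<ge> 0" "a' \<ge> 0" for a a'
  proof -
    have "Psi a a' \<le> (\<integral>\<^sup>+x. \<integral>\<^sup>+y. (\<Sum>i\<in>I. ennreal (card I * exp (- d a a' i)) * (ennreal (exp (sqrt a * X i x)) * ennreal (exp (sqrt a' * Y i y)))) \<partial>N \<partial>M)"
      unfolding Psi_def
    proof (intro nn_integral_mono)
      fix x y
      have "softmax b I (\<lambda>i. sqrt a * X i x + sqrt a' * Y i y - d a a' i) \<le> card I * (\<Sum>i\<in>I. exp (sqrt a * X i x + sqrt a' * Y i y - d a a' i))"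
        by (rule softmax_le_sum[OF I b])
      also have "\<dots> = (\<Sum>i\<in>I. (card I * exp (- d a a' i)) * (exp (sqrt a * X i x) * exp (sqrt a' * Y i y)))"
        by (simp add: sum_distrib_left exp_diff exp_add exp_minus field_simps)
      finally show "ennreal (softmax b I (\<lambda>i. sqrt a * X i x + sqrt a' * Y i y - d a a' i)) \<le> (\<Sum>i\<in>I. ennreal (card I * exp (- d a a' i)) * (ennreal (exp (sqrt a * X i x)) * ennreal (exp (sqrt a' * Y i y))))"
        by (simp add: ennreal_leI flip: ennreal_mult')
    qed
    also have "\<dots> = (\<Sum>i\<in>I. ennreal (card I * exp (- d a a' i)) * ((\<integral>\<^sup>+x. ennreal (exp (sqrt a * X i x)) \<partial>M) * (\<integral>\<^sup>+y. ennreal (exp (sqrt a' * Y i y)) \<partial>N)))"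
      by (simp add: nn_integral_sum nn_integral_cmult nn_integral_multc)
    also have "\<dots> = (\<Sum>i\<in>I. ennreal (card I * exp (- f i)))"
    proof (rule sum.cong)
      fix i assume i: "i \<in> I"
      have e: "exp (- d a a' i) * (exp ((sqrt a)\<^sup>2 * cX i / 2) * exp ((sqrt a')\<^sup>2 * cY i / 2)) = exp (- f i)"
        using a by (simp add: d_def mult_exp_exp add_divide_distrib)
      show "ennreal (card I * exp (- d a a' i)) * ((\<integral>\<^sup>+x. ennreal (exp (sqrt a * X i x)) \<partial>M) * (\<integral>\<^sup>+y. ennreal (exp (sqrt a' * Y i y)) \<partial>N)) = ennreal (card I * exp (- f i))"
        unfolding gaussian_family_exp_moment[OF X i] gaussian_family_exp_moment[OF Y i]
          e[symmetric] cX_def[symmetric] cY_def[symmetric]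
        by (simp add: cX_def cY_def mult.assoc flip: ennreal_mult')
    qed simp
    also have "\<dots> = ennreal C"
      by (simp add: C_def sum_distrib_left)
    finally show ?thesis .
  qed
  have Psi_step: "Psi (a + h) a' \<le> Psi a (a' + h) + ennreal (K * (h * sqrt h) * C)"
    if a: "a \<ge> 0" "a' \<ge> 0" and h: "0 < h" "h \<le> 1" for a a' h
  proof -
    define u where "u x y i = sqrt a * X i x + sqrt a' * Y i y - d a a' i" for x y i
    \<comment> \<open>The order of integration is swapped so that, for fixed \<open>y\<close>, the
      vector \<open>X\<close> can be split into a part of size \<open>a\<close> and a fresh
      increment of size \<open>h\<close>.\<close>
    have "Psi (a + h) a' = (\<integral>\<^sup>+y. \<integral>\<^sup>+x. ennreal (softmax b I (\<lambda>i. sqrt (a + h) * X i x + sqrt a' * Y i y - d (a + h) a' i)) \<partial>M \<partial>N)"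
      unfolding Psi_def by (rule P.Fubini'[symmetric]) measurable
    also have "\<dots> = (\<integral>\<^sup>+y. \<integral>\<^sup>+x. \<integral>\<^sup>+z. ennreal (softmax b I (\<lambda>i. u x y i + sqrt h * X i z - h * cX i / 2)) \<partial>M \<partial>M \<partial>N)"
    proof (rule nn_integral_cong)
      fix y
      define G where "G = (\<lambda>w. ennreal (softmax b I (\<lambda>i. w i + (sqrt a' * Y i y - d (a + h) a' i))))"
      have "G \<in> borel_measurable (\<Pi>\<^sub>M i\<in>I. (borel :: real measure))" unfolding G_def by measurable
      from gaussian_family_independent_sum[OF X a(1) less_imp_le[OF h(1)] this]
      have "(\<integral>\<^sup>+x. \<integral>\<^sup>+z. G (\<lambda>i\<in>I. sqrt a * X i x + sqrt h * X i z) \<partial>M \<partial>M) = (\<integral>\<^sup>+x. G (\<lambda>i\<in>I. sqrt (a + h) * X i x) \<partial>M)" .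
      moreover have "G (\<lambda>i\<in>I. sqrt a * X i x + sqrt h * X i z) = ennreal (softmax b I (\<lambda>i. u x y i + sqrt h * X i z - h * cX i / 2))" for x z
        unfolding G_def by (intro arg_cong[where f=ennreal] softmax_cong) (simp add: u_def d_def algebra_simps add_divide_distrib)
      moreover have "G (\<lambda>i\<in>I. sqrt (a + h) * X i x) = ennreal (softmax b I (\<lambda>i. sqrt (a + h) * X i x + sqrt a' * Y i y - d (a + h) a' i))" for x
        unfolding G_def by (intro arg_cong[where f=ennreal] softmax_cong) simp
      ultimately show "(\<integral>\<^sup>+x. ennreal (softmax b I (\<lambda>i. sqrt (a + h) * X i x + sqrt a' * Y i y - d (a + h) a' i)) \<partial>M) =
          (\<integral>\<^sup>+x. \<integral>\<^sup>+z. ennreal (softmax b I (\<lambda>i. u x y i + sqrt h * X i z - h * cX i / 2)) \<partial>M \<partial>M)"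
        by simp
    qed
    also have "\<dots> \<le> (\<integral>\<^sup>+y. \<integral>\<^sup>+x. (\<integral>\<^sup>+z. ennreal (softmax b I (\<lambda>i. u x y i + sqrt h * Y i z - h * cY i / 2)) \<partial>N)
        + ennreal (K * (h * sqrt h)) * ennreal (softmax b I (u x y)) \<partial>M \<partial>N)"
      by (intro nn_integral_mono step h)
    also have "\<dots> = (\<integral>\<^sup>+x. \<integral>\<^sup>+y. (\<integral>\<^sup>+z. ennreal (softmax b I (\<lambda>i. u x y i + sqrt h * Y i z - h * cY i / 2)) \<partial>N)
        + ennreal (K * (h * sqrt h)) * ennreal (softmax b I (u x y)) \<partial>N \<partial>M)"
      unfolding u_def by (rule P.Fubini') measurable
    also have "\<dots> = (\<integral>\<^sup>+x. \<integral>\<^sup>+y. (\<integral>\<^sup>+z. ennreal (softmax b I (\<lambda>i. u x y i + sqrt h * Y i z - h * cY i / 2)) \<partial>N) \<partial>N \<partial>M)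
        + ennreal (K * (h * sqrt h)) * Psi a a'"
      unfolding Psi_def u_def
      by (subst nn_integral_add, measurable, subst nn_integral_add, measurable)
        (simp add: nn_integral_cmult)
    also have "(\<integral>\<^sup>+x. \<integral>\<^sup>+y. (\<integral>\<^sup>+z. ennreal (softmax b I (\<lambda>i. u x y i + sqrt h * Y i z - h * cY i / 2)) \<partial>N) \<partial>N \<partial>M) = Psi a (a' + h)"
      unfolding Psi_def
    proof (rule nn_integral_cong)
      fix x
      define G where "G = (\<lambda>w. ennreal (softmax b I (\<lambda>i. w i + (sqrt a * X i x - d a (a' + h) i))))"
      have "G \<in> borel_measurable (\<Pi>\<^sub>M i\<in>I. (borel :: real measure))" unfolding G_def by measurable
      from gaussian_family_independent_sum[OF Y a(2) less_imp_le[OF h(1)] this]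
      have "(\<integral>\<^sup>+y. \<integral>\<^sup>+z. G (\<lambda>i\<in>I. sqrt a' * Y i y + sqrt h * Y i z) \<partial>N \<partial>N) = (\<integral>\<^sup>+y. G (\<lambda>i\<in>I. sqrt (a' + h) * Y i y) \<partial>N)" .
      moreover have "G (\<lambda>i\<in>I. sqrt a' * Y i y + sqrt h * Y i z) = ennreal (softmax b I (\<lambda>i. u x y i + sqrt h * Y i z - h * cY i / 2))" for y z
        unfolding G_def by (intro arg_cong[where f=ennreal] softmax_cong) (simp add: u_def d_def algebra_simps add_divide_distrib)
      moreover have "G (\<lambda>i\<in>I. sqrt (a' + h) * Y i y) = ennreal (softmax b I (\<lambda>i. sqrt a * X i x + sqrt (a' + h) * Y i y - d a (a' + h) i))" for y
        unfolding G_def by (intro arg_cong[where f=ennreal] softmax_cong) simp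
      ultimately show "(\<integral>\<^sup>+y. \<integral>\<^sup>+z. ennreal (softmax b I (\<lambda>i. u x y i + sqrt h * Y i z - h * cY i / 2)) \<partial>N \<partial>N) =
          (\<integral>\<^sup>+y. ennreal (softmax b I (\<lambda>i. sqrt a * X i x + sqrt (a' + h) * Y i y - d a (a' + h) i)) \<partial>N)"
        by simp
    qed
    also have "Psi a (a' + h) + ennreal (K * (h * sqrt h)) * Psi a a' \<le> Psi a (a' + h) + ennreal (K * (h * sqrt h)) * ennreal C"
      by (intro add_left_mono mult_left_mono Psi_le a) simp
    also have "ennreal (K * (h * sqrt h)) * ennreal C = ennreal (K * (h * sqrt h) * C)"
      using C by (simp add: ennreal_mult'')
    finally show ?thesis .
  qed
  have Psi_n: "Psi 1 0 \<le> Psi 0 1 + ennreal (K * C * (1 / sqrt (Suc n)))" for n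
  proof -
    define h where "h = 1 / real (Suc n)"
    have h: "0 < h" "h \<le> 1" by (auto simp: h_def)
    have "Psi 1 0 \<le> Psi (1 - k * h) (k * h) + ennreal (k * (K * (h * sqrt h) * C))" if "k \<le> Suc n" for k :: nat
      using that
    proof (induction k)
      case 0
      then show ?case by simp
    next
      case (Suc k)
      have e: "1 - real k * h = (1 - real (Suc k) * h) + h" "real k * h + h = real (Suc k) * h"
        by (auto simp: algebra_simps)
      have "real (Suc k) * h \<le> 1" using Suc.prems by (simp add: h_def divide_le_eq)
      then have "Psi (1 - real k * h) (real k * h) \<le> Psi (1 - real (Suc k) * h) (real (Suc k) * h) + ennreal (K * (h * sqrt h) * C)"
        using Psi_step[of "1 - real (Suc k) * h" "real k * h" h] h unfolding e by simp
      then have "Psi 1 0 \<le> Psi (1 - real (Suc k) * h) (real (Suc k) * h) + ennreal (K * (h * sqrt h) * C) + ennreal (k * (K * (h * sqrt h) * C))"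
        using Suc by (meson Suc_leD add_right_mono order_trans)
      also have "\<dots> = Psi (1 - real (Suc k) * h) (real (Suc k) * h) + (ennreal (K * (h * sqrt h) * C) + ennreal (k * (K * (h * sqrt h) * C)))"
        by (simp only: add.assoc)
      also have "ennreal (K * (h * sqrt h) * C) + ennreal (k * (K * (h * sqrt h) * C)) = ennreal (real (Suc k) * (K * (h * sqrt h) * C))"
        using K C h by (subst ennreal_plus[symmetric]) (auto simp: algebra_simps)
      finally show ?case .
    qed
    from this[of "Suc n"] have "Psi 1 0 \<le> Psi (1 - real (Suc n) * h) (real (Suc n) * h) + ennreal (real (Suc n) * (K * (h * sqrt h) * C))" by simp
    moreover have "real (Suc n) * h = 1" by (simp add: h_def)
    \<comment> \<open>The number of steps cancels the factor \<open>h\<close>; what is left is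
      \<open>sqrt h\<close>.\<close>
    moreover have "real (Suc n) * (K * (h * sqrt h) * C) = K * C * (1 / sqrt (Suc n))"
    proof -
      have "real (Suc n) * (K * (h * sqrt h) * C) = (real (Suc n) * h) * (K * C * sqrt h)" by (simp only: mult_ac)
      then show ?thesis using \<open>real (Suc n) * h = 1\<close> by (simp add: h_def real_sqrt_divide)
    qed
    ultimately show ?thesis by simp
  qed
  have "Psi 1 0 \<le> Psi 0 1 + 0"
  proof (rule tendsto_lowerbound)
    have "(\<lambda>n. K * C * (1 / sqrt (Suc n))) \<longlonglongrightarrow> K * C * 0"
      by (intro tendsto_mult tendsto_const) real_asymp
    then have "(\<lambda>n. ennreal (K * C * (1 / sqrt (Suc n)))) \<longlonglongrightarrow> ennreal 0"
      using tendsto_ennrealI by fastforce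
    then show "(\<lambda>n. Psi 0 1 + ennreal (K * C * (1 / sqrt (Suc n)))) \<longlonglongrightarrow> Psi 0 1 + 0"
      by (intro tendsto_add tendsto_const) simp
  qed (use Psi_n in auto)
  moreover have "Psi 1 0 = (\<integral>\<^sup>+\<omega>. ennreal (softmax b I (\<lambda>i. X i \<omega> - cX i / 2 - f i)) \<partial>M)"
    by (simp add: Psi_def d_def N.emeasure_space_1 diff_diff_eq)
  moreover have "Psi 0 1 = (\<integral>\<^sup>+\<omega>. ennreal (softmax b I (\<lambda>i. Y i \<omega> - cY i / 2 - f i)) \<partial>N)"
    by (simp add: Psi_def d_def M.emeasure_space_1 diff_diff_eq)
  ultimately show ?thesis by simp
qed

text \<open>The soft maximum with parameter \<open>b\<close> exceeds the exponential of the maximum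
  by at most the factor \<open>card I powr (1 / b)\<close>, which tends to 1 along
  \<open>b = n + 1\<close>.\<close>

lemma exp_max_gaussian_compare:
  fixes X :: "'i \<Rightarrow> 'a \<Rightarrow> real" and Y :: "'i \<Rightarrow> 'b \<Rightarrow> real"
    and M :: "'a measure" and N :: "'b measure"
  defines "cX \<equiv> \<lambda>i. \<integral>\<omega>. (X i \<omega>)\<^sup>2 \<partial>M" and "cY \<equiv> \<lambda>i. \<integral>\<omega>. (Y i \<omega>)\<^sup>2 \<partial>N"
  assumes X: "gaussian_family M I X" and Y: "gaussian_family N I Y" and ne: "I \<noteq> {}"
    and V: "\<And>i j. i \<in> I \<Longrightarrow> j \<in> I \<Longrightarrow>
      (\<integral>\<omega>. (X i \<omega> - X j \<omega>)\<^sup>2 \<partial>M) \<le> (\<integral>\<omega>. (Y i \<omega> - Y j \<omega>)\<^sup>2 \<partial>N)"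
  shows "(\<integral>\<^sup>+\<omega>. ennreal (exp (MAX i\<in>I. X i \<omega> - cX i / 2 - f i)) \<partial>M) \<le>
    (\<integral>\<^sup>+\<omega>. ennreal (exp (MAX i\<in>I. Y i \<omega> - cY i / 2 - f i)) \<partial>N)"
proof -
  note I = gaussian_familyD(2)[OF X]
  note [measurable] = gaussian_family_measurable[OF Y]
  define L where "L = (\<integral>\<^sup>+\<omega>. ennreal (exp (MAX i\<in>I. Y i \<omega> - cY i / 2 - f i)) \<partial>N)"
  have le: "(\<integral>\<^sup>+\<omega>. ennreal (exp (MAX i\<in>I. X i \<omega> - cX i / 2 - f i)) \<partial>M) \<le> ennreal (real (card I) powr (1 / real (Suc n))) * L" for n
  proof -
    define b where "b = real (Suc n)"
    have b: "b \<ge> 1" by (simp add: b_def)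
    have "exp (MAX i\<in>I. X i \<omega> - cX i / 2 - f i) \<le> softmax b I (\<lambda>i. X i \<omega> - cX i / 2 - f i)" for \<omega>
    proof -
      have "(MAX i\<in>I. X i \<omega> - cX i / 2 - f i) \<in> (\<lambda>i. X i \<omega> - cX i / 2 - f i) ` I"
        using I ne by (intro Max_in) auto
      then obtain i where "i \<in> I" "(MAX i\<in>I. X i \<omega> - cX i / 2 - f i) = X i \<omega> - cX i / 2 - f i" by auto
      then show ?thesis using exp_le_softmax[OF I, of i b "\<lambda>i. X i \<omega> - cX i / 2 - f i"] b by simp
    qed
    then have "(\<integral>\<^sup>+\<omega>. ennreal (exp (MAX i\<in>I. X i \<omega> - cX i / 2 - f i)) \<partial>M) \<le> (\<integral>\<^sup>+\<omega>. ennreal (softmax b I (\<lambda>i. X i \<omega> - cX i / 2 - f i)) \<partial>M)"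
      by (intro nn_integral_mono ennreal_leI)
    also have "\<dots> \<le> (\<integral>\<^sup>+\<omega>. ennreal (softmax b I (\<lambda>i. Y i \<omega> - cY i / 2 - f i)) \<partial>N)"
      unfolding cX_def cY_def by (rule softmax_gaussian_compare[OF X Y b ne V])
    also have "\<dots> \<le> (\<integral>\<^sup>+\<omega>. ennreal (real (card I) powr (1 / b)) * ennreal (exp (MAX i\<in>I. Y i \<omega> - cY i / 2 - f i)) \<partial>N)"
      unfolding ennreal_mult'[OF powr_ge_zero, symmetric]
      using I b by (intro nn_integral_mono ennreal_leI softmax_le) auto
    also have "\<dots> = ennreal (real (card I) powr (1 / b)) * L"
      unfolding L_def using I by (intro nn_integral_cmult) measurable
    finally show ?thesis by (simp add: b_def)
  qed
  show ?thesis
  \<comment> \<open>An infinite right-hand side is set aside because multiplication by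
    \<open>L\<close> is used as a continuous map of the factor, which requires \<open>L\<close> to
    be finite.\<close>
  proof (cases "L = \<top>")
    case True
    then show ?thesis by (simp add: L_def)
  next
    case False
    have "(\<integral>\<^sup>+\<omega>. ennreal (exp (MAX i\<in>I. X i \<omega> - cX i / 2 - f i)) \<partial>M) \<le> L * 1"
    proof (rule tendsto_lowerbound)
      have pos: "real (card I) > 0" using I ne by (simp add: card_gt_0_iff)
      have "(\<lambda>n. 1 / real (Suc n)) \<longlonglongrightarrow> 0" by real_asymp
      then have "(\<lambda>n. real (card I) powr (1 / real (Suc n))) \<longlonglongrightarrow> real (card I) powr 0"
        using pos by (intro tendsto_powr tendsto_const) auto
      then have "(\<lambda>n. ennreal (real (card I) powr (1 / real (Suc n)))) \<longlonglongrightarrow> ennreal 1"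
        using pos by (intro tendsto_ennrealI) simp
      then show "(\<lambda>n. L * ennreal (real (card I) powr (1 / real (Suc n)))) \<longlonglongrightarrow> L * 1"
        using False by (intro ennreal_tendsto_cmult) (simp_all add: less_top)
    qed (use le in \<open>auto simp: mult.commute\<close>)
    then show ?thesis by (simp add: L_def)
  qed
qed

section \<open>Processes on a time interval\<close>

text \<open>Rounding the relative position \<open>s\<close> of \<open>t\<close> down to multiples of
  \<open>1 / 2 ^ n\<close> gives grid points of the interval converging to \<open>t\<close>.\<close>

lemma continuous_le_dyadic:
  fixes g :: "real \<Rightarrow> real"
  assumes g: "continuous_on {a..b} g" and t: "t \<in> {a..b}"
    and le: "\<And>n j. j \<le> 2 ^ n \<Longrightarrow> g (a + (b - a) * (real j / 2 ^ n)) \<le> B"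
  shows "g t \<le> B"
proof -
  define s where "s = (if a = b then 0 else (t - a) / (b - a))"
  have s: "0 \<le> s" "s \<le> 1" "t = a + (b - a) * s"
    using t by (auto simp: s_def field_simps)
  define j where "j n = nat \<lfloor>s * 2 ^ n\<rfloor>" for n :: nat
  have j: "real (j n) = of_int \<lfloor>s * 2 ^ n\<rfloor>" for n
    using s by (simp add: j_def)
  have j_le: "j n \<le> 2 ^ n" for n
  proof -
    have "real (j n) \<le> s * 2 ^ n" unfolding j by simp
    also have "\<dots> \<le> 1 * 2 ^ n" using s by (intro mult_right_mono) auto
    finally have "real (j n) \<le> real (2 ^ n)" by simp
    then show ?thesis by (simp only: of_nat_le_iff)
  qed
  have bounds: "s - 1 / 2 ^ n \<le> real (j n) / 2 ^ n" "real (j n) / 2 ^ n \<le> s" for n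
  proof -
    have "(s * 2 ^ n - 1) / 2 ^ n \<le> real (j n) / 2 ^ n"
      unfolding j by (rule divide_right_mono) (linarith, simp)
    then show "s - 1 / 2 ^ n \<le> real (j n) / 2 ^ n" by (simp add: diff_divide_distrib)
    show "real (j n) / 2 ^ n \<le> s" unfolding j by (simp add: divide_le_eq)
  qed
  have "(\<lambda>n. real (j n) / 2 ^ n) \<longlonglongrightarrow> s"
  proof (rule tendsto_sandwich)
    show "(\<lambda>n. s - 1 / 2 ^ n) \<longlonglongrightarrow> s" by real_asymp
    show "(\<lambda>n. s) \<longlonglongrightarrow> s" by simp
  qed (use bounds in auto)
  then have lim: "(\<lambda>n. a + (b - a) * (real (j n) / 2 ^ n)) \<longlonglongrightarrow> t"
    unfolding s(3) by (intro tendsto_intros)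
  have "real (j n) / 2 ^ n \<le> 1" for n using j_le[of n] by simp
  then have mem: "a + (b - a) * (real (j n) / 2 ^ n) \<in> {a..b}" for n
    using t mult_left_mono[of "real (j n) / 2 ^ n" 1 "b - a"] by auto
  have "(\<lambda>n. g (a + (b - a) * (real (j n) / 2 ^ n))) \<longlonglongrightarrow> g t"
    by (rule continuous_on_tendsto_compose[OF g lim t]) (use mem in auto)
  then show ?thesis by (rule tendsto_upperbound) (use le[OF j_le] in auto)
qed

text \<open>Step halving makes the grids nested, so the maxima over them increase with
  \<open>n\<close> and monotone convergence applies.\<close>

definition dyadic_grid :: "real \<Rightarrow> nat \<Rightarrow> real set" where
  "dyadic_grid T n = (\<lambda>j. T * (real j / 2 ^ n)) ` {..2 ^ n}"

lemma dyadic_grid: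
  assumes "T \<ge> 0"
  shows "finite (dyadic_grid T n)" "dyadic_grid T n \<noteq> {}" "dyadic_grid T n \<subseteq> {0..T}"
    and "dyadic_grid T n \<subseteq> dyadic_grid T (Suc n)"
proof -
  show "finite (dyadic_grid T n)" "dyadic_grid T n \<noteq> {}" by (auto simp: dyadic_grid_def)
  have "T * (real j / 2 ^ n) \<le> T * 1" if "j \<le> 2 ^ n" for j
    using assms that by (intro mult_left_mono) auto
  then show "dyadic_grid T n \<subseteq> {0..T}" using assms by (auto simp: dyadic_grid_def)
  show "dyadic_grid T n \<subseteq> dyadic_grid T (Suc n)"
  proof
    fix t assume "t \<in> dyadic_grid T n"
    then obtain j where "j \<le> 2 ^ n" "t = T * (real j / 2 ^ n)" by (auto simp: dyadic_grid_def)
    then have "2 * j \<le> 2 ^ Suc n" "t = T * (real (2 * j) / 2 ^ Suc n)" by auto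
    then show "t \<in> dyadic_grid T (Suc n)" unfolding dyadic_grid_def by blast
  qed
qed

lemma exp_SUP_eq_dyadic:
  fixes g :: "real \<Rightarrow> real"
  assumes g: "continuous_on {0..T} g" and T: "T \<ge> 0"
  shows "ennreal (exp (SUP t\<in>{0..T}. g t)) = (SUP n. ennreal (exp (MAX t\<in>dyadic_grid T n. g t)))"
proof -
  obtain t0 where t0: "t0 \<in> {0..T}" "\<And>t. t \<in> {0..T} \<Longrightarrow> g t \<le> g t0"
    using continuous_attains_sup[OF compact_Icc _ g] T by auto
  have sup: "(SUP t\<in>{0..T}. g t) = g t0"
    using t0 by (intro cSup_eq_maximum) auto
  define B where "B = (SUP n. ennreal (exp (MAX t\<in>dyadic_grid T n. g t)))"
  have B: "B \<le> ennreal (exp (g t0))"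
    unfolding B_def
  proof (intro SUP_least ennreal_leI)
    fix n
    have "(MAX t\<in>dyadic_grid T n. g t) \<le> g t0"
      using dyadic_grid[OF T, of n] t0 by (subst Max_le_iff) auto
    then show "exp (MAX t\<in>dyadic_grid T n. g t) \<le> exp (g t0)" by simp
  qed
  then have "B < \<top>" by (rule le_less_trans) simp
  then have B': "ennreal (enn2real B) = B" by simp
  have "exp (g t0) \<le> enn2real B"
  proof (rule continuous_le_dyadic[of 0 T "\<lambda>t. exp (g t)"])
    fix n j :: nat assume "j \<le> 2 ^ n"
    then have "T * (real j / 2 ^ n) \<in> dyadic_grid T n" by (auto simp: dyadic_grid_def)
    then have "g (T * (real j / 2 ^ n)) \<le> (MAX t\<in>dyadic_grid T n. g t)"
      using dyadic_grid[OF T, of n] by (intro Max_ge) auto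
    then have "ennreal (exp (g (T * (real j / 2 ^ n)))) \<le> ennreal (exp (MAX t\<in>dyadic_grid T n. g t))"
      by (intro ennreal_leI) simp
    also have "\<dots> \<le> B" unfolding B_def by (rule SUP_upper) simp
    finally have "ennreal (exp (g (T * (real j / 2 ^ n)))) \<le> ennreal (enn2real B)" by (simp add: B')
    then show "exp (g (0 + (T - 0) * (real j / 2 ^ n))) \<le> enn2real B"
      by (simp add: ennreal_le_iff)
  qed (use g t0 in \<open>auto intro!: continuous_intros\<close>)
  then have "ennreal (exp (g t0)) \<le> B" using ennreal_leI[of "exp (g t0)" "enn2real B"] by (simp add: B')
  then show ?thesis using B unfolding sup B_def by simp
qed

text \<open>The integrand is replaced almost everywhere by a countable supremum, so measurability is
  asked only of the finite maxima and never of the supremum over an interval.\<close>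

lemma nn_integral_exp_SUP_eq_dyadic:
  fixes g :: "real \<Rightarrow> 'a \<Rightarrow> real"
  assumes cont: "AE \<omega> in M. continuous_on {0..T} (\<lambda>t. g t \<omega>)" and T: "T \<ge> 0"
    and g: "\<And>t. t \<in> {0..T} \<Longrightarrow> g t \<in> borel_measurable M"
  shows "(\<integral>\<^sup>+\<omega>. ennreal (exp (SUP t\<in>{0..T}. g t \<omega>)) \<partial>M) =
    (SUP n. \<integral>\<^sup>+\<omega>. ennreal (exp (MAX t\<in>dyadic_grid T n. g t \<omega>)) \<partial>M)"
proof -
  have "(\<integral>\<^sup>+\<omega>. ennreal (exp (SUP t\<in>{0..T}. g t \<omega>)) \<partial>M) = (\<integral>\<^sup>+\<omega>. (SUP n. ennreal (exp (MAX t\<in>dyadic_grid T n. g t \<omega>))) \<partial>M)"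
    using cont by (intro nn_integral_cong_AE) (auto simp: exp_SUP_eq_dyadic T)
  also have "\<dots> = (SUP n. \<integral>\<^sup>+\<omega>. ennreal (exp (MAX t\<in>dyadic_grid T n. g t \<omega>)) \<partial>M)"
  proof (rule nn_integral_monotone_convergence_SUP)
    show "incseq (\<lambda>n \<omega>. ennreal (exp (MAX t\<in>dyadic_grid T n. g t \<omega>)))"
    proof (intro incseq_SucI le_funI ennreal_leI)
      fix n \<omega>
      have "(MAX t\<in>dyadic_grid T n. g t \<omega>) \<le> (MAX t\<in>dyadic_grid T (Suc n). g t \<omega>)"
        using dyadic_grid[OF T] by (intro Max_mono image_mono) auto
      then show "exp (MAX t\<in>dyadic_grid T n. g t \<omega>) \<le> exp (MAX t\<in>dyadic_grid T (Suc n). g t \<omega>)" by simp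
    qed
    fix n
    have [measurable]: "g t \<in> borel_measurable M" if "t \<in> dyadic_grid T n" for t
      using g[of t] dyadic_grid(3)[OF T, of n] that by auto
    show "(\<lambda>\<omega>. ennreal (exp (MAX t\<in>dyadic_grid T n. g t \<omega>))) \<in> borel_measurable M"
      using dyadic_grid(1)[OF T, of n] by measurable
  qed
  finally show ?thesis .
qed

lemma centered_gaussian_processD:
  assumes "centered_gaussian_process M Y"
  shows "prob_space M" "t \<ge> 0 \<Longrightarrow> Y t \<in> borel_measurable M"
    and "finite J \<Longrightarrow> J \<subseteq> {0..} \<Longrightarrow> centered_normal_rv M (\<lambda>\<omega>. \<Sum>t\<in>J. a t * Y t \<omega>)"
  using assms unfolding centered_gaussian_process_def by auto

lemma gaussian_process_family:
  assumes Y: "centered_gaussian_process M Y" and J: "finite J" "J \<subseteq> {0..}"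
  shows "gaussian_family M J (\<lambda>t \<omega>. r * Y t \<omega>)"
  unfolding gaussian_family_def
proof (intro conjI allI)
  show "prob_space M" "finite J" using centered_gaussian_processD(1)[OF Y] J by auto
  show "centered_normal_rv M (\<lambda>\<omega>. \<Sum>t\<in>J. a t * (r * Y t \<omega>))" for a
    using centered_gaussian_processD(3)[OF Y J, of "\<lambda>t. a t * r"] by (simp add: mult.assoc)
qed

text \<open>Linear combinations in the definition of a Gaussian process are indexed by sets of
  times. Injectivity carries the coefficients over to the image set without merging any of
  them.\<close>

lemma gaussian_process_time_change:
  assumes Y: "centered_gaussian_process M Y" and inj: "inj_on \<tau> {0..}" and pos: "\<And>t. t \<ge> 0 \<Longrightarrow> \<tau> t \<ge> 0"
  shows "centered_gaussian_process M (\<lambda>t. Y (\<tau> t))"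
  unfolding centered_gaussian_process_def
proof (intro conjI allI impI)
  show "prob_space M" by (rule centered_gaussian_processD[OF Y])
  show "Y (\<tau> t) \<in> borel_measurable M" if "t \<ge> 0" for t
    using that by (intro centered_gaussian_processD[OF Y] pos)
  fix J :: "real set" and a assume J: "finite J \<and> J \<subseteq> {0..}"
  have injJ: "inj_on \<tau> J" using inj J inj_on_subset by blast
  have "centered_normal_rv M (\<lambda>\<omega>. \<Sum>t\<in>\<tau> ` J. a (the_inv_into J \<tau> t) * Y t \<omega>)"
    using J pos by (intro centered_gaussian_processD(3)[OF Y]) auto
  moreover have "(\<Sum>t\<in>\<tau> ` J. a (the_inv_into J \<tau> t) * Y t \<omega>) = (\<Sum>t\<in>J. a t * Y (\<tau> t) \<omega>)" for \<omega>
    using injJ by (simp add: sum.reindex the_inv_into_f_f)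
  ultimately show "centered_normal_rv M (\<lambda>\<omega>. \<Sum>t\<in>J. a t * Y (\<tau> t) \<omega>)" by simp
qed

text \<open>The vectors are \<open>sqrt 2\<close> times the processes, whose half variances are
  \<open>vX\<close> and \<open>vZ\<close>. The comparison holds on each grid and survives the
  supremum over grids.\<close>

lemma exp_SUP_gaussian_compare:
  assumes X: "centered_gaussian_process M X" and Z: "centered_gaussian_process N Z"
    and contX: "AE \<omega> in M. continuous_on {0..T} (\<lambda>t. X t \<omega>)"
    and contZ: "AE \<omega> in N. continuous_on {0..T} (\<lambda>t. Z t \<omega>)"
    and vX: "\<And>t. t \<in> {0..T} \<Longrightarrow> (\<integral>\<omega>. (X t \<omega>)\<^sup>2 \<partial>M) = vX t"
    and vZ: "\<And>t. t \<in> {0..T} \<Longrightarrow> (\<integral>\<omega>. (Z t \<omega>)\<^sup>2 \<partial>N) = vZ t"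
    and cont: "continuous_on {0..T} vX" "continuous_on {0..T} vZ" "continuous_on {0..T} f"
    and V: "\<And>s t. s \<in> {0..T} \<Longrightarrow> t \<in> {0..T} \<Longrightarrow> (\<integral>\<omega>. (X s \<omega> - X t \<omega>)\<^sup>2 \<partial>M) \<le> (\<integral>\<omega>. (Z s \<omega> - Z t \<omega>)\<^sup>2 \<partial>N)"
    and T: "T \<ge> 0"
  shows "(\<integral>\<^sup>+\<omega>. ennreal (exp (SUP t\<in>{0..T}. sqrt 2 * X t \<omega> - vX t - f t)) \<partial>M) \<le>
    (\<integral>\<^sup>+\<omega>. ennreal (exp (SUP t\<in>{0..T}. sqrt 2 * Z t \<omega> - vZ t - f t)) \<partial>N)"
proof -
  have "(\<integral>\<^sup>+\<omega>. ennreal (exp (MAX t\<in>dyadic_grid T n. sqrt 2 * X t \<omega> - vX t - f t)) \<partial>M) \<le>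
    (\<integral>\<^sup>+\<omega>. ennreal (exp (MAX t\<in>dyadic_grid T n. sqrt 2 * Z t \<omega> - vZ t - f t)) \<partial>N)" for n
  proof -
    note G = dyadic_grid[OF T, of n]
    have G0: "dyadic_grid T n \<subseteq> {0..}" using G(3) by auto
    have sq: "(sqrt 2 * x - sqrt 2 * y)\<^sup>2 = 2 * (x - y)\<^sup>2" for x y :: real
      by (simp add: power_mult_distrib flip: right_diff_distrib)
    have "(\<integral>\<^sup>+\<omega>. ennreal (exp (MAX t\<in>dyadic_grid T n. sqrt 2 * X t \<omega> - (\<integral>\<omega>. (sqrt 2 * X t \<omega>)\<^sup>2 \<partial>M) / 2 - f t)) \<partial>M) \<le>
      (\<integral>\<^sup>+\<omega>. ennreal (exp (MAX t\<in>dyadic_grid T n. sqrt 2 * Z t \<omega> - (\<integral>\<omega>. (sqrt 2 * Z t \<omega>)\<^sup>2 \<partial>N) / 2 - f t)) \<partial>N)"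
    proof (intro exp_max_gaussian_compare gaussian_process_family X Z G G0)
      fix s t assume "s \<in> dyadic_grid T n" "t \<in> dyadic_grid T n"
      then have "s \<in> {0..T}" "t \<in> {0..T}" using G(3) by blast+
      from V[OF this] show "(\<integral>\<omega>. (sqrt 2 * X s \<omega> - sqrt 2 * X t \<omega>)\<^sup>2 \<partial>M) \<le> (\<integral>\<omega>. (sqrt 2 * Z s \<omega> - sqrt 2 * Z t \<omega>)\<^sup>2 \<partial>N)"
        unfolding sq by simp
    qed
    moreover have "(\<lambda>t. sqrt 2 * X t \<omega> - (\<integral>\<omega>. (sqrt 2 * X t \<omega>)\<^sup>2 \<partial>M) / 2 - f t) ` dyadic_grid T n = (\<lambda>t. sqrt 2 * X t \<omega> - vX t - f t) ` dyadic_grid T n" for \<omega>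
      using G(3) vX by (intro image_cong) (auto simp: power_mult_distrib)
    moreover have "(\<lambda>t. sqrt 2 * Z t \<omega> - (\<integral>\<omega>. (sqrt 2 * Z t \<omega>)\<^sup>2 \<partial>N) / 2 - f t) ` dyadic_grid T n = (\<lambda>t. sqrt 2 * Z t \<omega> - vZ t - f t) ` dyadic_grid T n" for \<omega>
      using G(3) vZ by (intro image_cong) (auto simp: power_mult_distrib)
    ultimately show ?thesis by simp
  qed
  then have "(SUP n. \<integral>\<^sup>+\<omega>. ennreal (exp (MAX t\<in>dyadic_grid T n. sqrt 2 * X t \<omega> - vX t - f t)) \<partial>M) \<le>
    (SUP n. \<integral>\<^sup>+\<omega>. ennreal (exp (MAX t\<in>dyadic_grid T n. sqrt 2 * Z t \<omega> - vZ t - f t)) \<partial>N)"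
    by (intro SUP_mono) auto
  moreover have "(\<integral>\<^sup>+\<omega>. ennreal (exp (SUP t\<in>{0..T}. sqrt 2 * X t \<omega> - vX t - f t)) \<partial>M) =
    (SUP n. \<integral>\<^sup>+\<omega>. ennreal (exp (MAX t\<in>dyadic_grid T n. sqrt 2 * X t \<omega> - vX t - f t)) \<partial>M)"
  proof (rule nn_integral_exp_SUP_eq_dyadic[OF _ T])
    show "AE \<omega> in M. continuous_on {0..T} (\<lambda>t. sqrt 2 * X t \<omega> - vX t - f t)"
      using contX by eventually_elim (intro continuous_intros cont)
    fix t :: real assume "t \<in> {0..T}"
    then have [measurable]: "X t \<in> borel_measurable M"
      by (intro centered_gaussian_processD[OF X]) simp
    show "(\<lambda>\<omega>. sqrt 2 * X t \<omega> - vX t - f t) \<in> borel_measurable M" by measurable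
  qed
  moreover have "(\<integral>\<^sup>+\<omega>. ennreal (exp (SUP t\<in>{0..T}. sqrt 2 * Z t \<omega> - vZ t - f t)) \<partial>N) =
    (SUP n. \<integral>\<^sup>+\<omega>. ennreal (exp (MAX t\<in>dyadic_grid T n. sqrt 2 * Z t \<omega> - vZ t - f t)) \<partial>N)"
  proof (rule nn_integral_exp_SUP_eq_dyadic[OF _ T])
    show "AE \<omega> in N. continuous_on {0..T} (\<lambda>t. sqrt 2 * Z t \<omega> - vZ t - f t)"
      using contZ by eventually_elim (intro continuous_intros cont)
    fix t :: real assume "t \<in> {0..T}"
    then have [measurable]: "Z t \<in> borel_measurable N"
      by (intro centered_gaussian_processD[OF Z]) simp
    show "(\<lambda>\<omega>. sqrt 2 * Z t \<omega> - vZ t - f t) \<in> borel_measurable N" by measurable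
  qed
  ultimately show ?thesis by simp
qed

lemma tendsto_SUP_at_top:
  fixes F :: "real \<Rightarrow> ennreal"
  assumes "\<And>S T. 0 \<le> S \<Longrightarrow> S \<le> T \<Longrightarrow> F S \<le> F T"
  shows "(F \<longlongrightarrow> (SUP T\<in>{0..}. F T)) at_top"
proof (rule order_tendstoI)
  fix a assume "a < (SUP T\<in>{0..}. F T)"
  then obtain S where S: "S \<ge> 0" "a < F S" by (auto simp: less_SUP_iff)
  show "eventually (\<lambda>T. a < F T) at_top"
    using eventually_ge_at_top[of S]
  proof eventually_elim
    case (elim T)
    with S assms[of S T] show ?case by auto
  qed
next
  fix a assume a: "(SUP T\<in>{0..}. F T) < a"
  show "eventually (\<lambda>T. F T < a) at_top"
    using eventually_ge_at_top[of 0]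
  proof eventually_elim
    case (elim T)
    then show ?case using a SUP_upper[of T "{0..}" F] by auto
  qed
qed

lemma piterbarg_expectation_mono:
  assumes c: "as_continuous_paths M Y" and \<alpha>: "\<alpha> > 0" and ST: "0 \<le> S" "S \<le> T"
  shows "piterbarg_expectation M Y \<alpha> R S \<le> piterbarg_expectation M Y \<alpha> R T"
  unfolding piterbarg_expectation_def
proof (rule nn_integral_mono_AE)
  from c show "AE \<omega> in M. ennreal (exp (SUP t\<in>{0..S}. sqrt 2 * Y t \<omega> - (1 + R) * t powr \<alpha>))
      \<le> ennreal (exp (SUP t\<in>{0..T}. sqrt 2 * Y t \<omega> - (1 + R) * t powr \<alpha>))"
    unfolding as_continuous_paths_def
  proof eventually_elim
    case (elim \<omega>)
    have "continuous_on {0..T} (\<lambda>t. sqrt 2 * Y t \<omega> - (1 + R) * t powr \<alpha>)"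
      by (intro continuous_intros continuous_on_powr' continuous_on_subset[OF elim]) (use \<alpha> in auto)
    \<comment> \<open>A supremum of reals is monotone in the index set only for bounded sets;
      compactness provides the bound.\<close>
    then have "bdd_above ((\<lambda>t. sqrt 2 * Y t \<omega> - (1 + R) * t powr \<alpha>) ` {0..T})"
      by (intro bounded_imp_bdd_above compact_imp_bounded compact_continuous_image compact_Icc)
    then have "(SUP t\<in>{0..S}. sqrt 2 * Y t \<omega> - (1 + R) * t powr \<alpha>) \<le> (SUP t\<in>{0..T}. sqrt 2 * Y t \<omega> - (1 + R) * t powr \<alpha>)"
      by (rule cSUP_subset_mono[rotated]) (use ST in auto)
    then show ?case by (intro ennreal_leI) simp
  qed
qed

text \<open>Monotonicity in the horizon gives convergence in \<open>ennreal\<close> before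
  finiteness is known, and it identifies the value chosen by \<open>Lim\<close> with a supremum, the
  form used in all later estimates.\<close>

lemma piterbarg_constant_limit:
  assumes c: "as_continuous_paths M Y" and \<alpha>: "\<alpha> > 0"
  shows "(piterbarg_expectation M Y \<alpha> R \<longlongrightarrow> piterbarg_constant M Y \<alpha> R) at_top"
    and "piterbarg_constant M Y \<alpha> R = (SUP T\<in>{0..}. piterbarg_expectation M Y \<alpha> R T)"
proof -
  have lim: "(piterbarg_expectation M Y \<alpha> R \<longlongrightarrow> (SUP T\<in>{0..}. piterbarg_expectation M Y \<alpha> R T)) at_top"
    by (rule tendsto_SUP_at_top) (rule piterbarg_expectation_mono[OF c \<alpha>])
  show eq: "piterbarg_constant M Y \<alpha> R = (SUP T\<in>{0..}. piterbarg_expectation M Y \<alpha> R T)"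
    unfolding piterbarg_constant_def by (rule tendsto_Lim[OF trivial_limit_at_top_linorder lim])
  show "(piterbarg_expectation M Y \<alpha> R \<longlongrightarrow> piterbarg_constant M Y \<alpha> R) at_top"
    unfolding eq by (rule lim)
qed

section \<open>Chaining\<close>

text \<open>The weights \<open>(1 - r) * r ^ m\<close> sum to at most 1, so some level \<open>m\<close> carries the whole exponent;
  if it exceeds \<open>ln 4\<close>, multiplying it by \<open>m + 2\<close> gains the factor \<open>4 ^ (m + 1)\<close>, which later beats the
  \<open>2 ^ m\<close> terms of that level.\<close>

lemma exp_chain_le:
  fixes d :: "nat \<Rightarrow> nat \<Rightarrow> real"
  assumes r: "0 < r" "r < 1" and l: "l \<ge> 0"
  shows "exp (l * (\<Sum>m\<le>n. MAX i\<in>{..<2 ^ m}. d m i)) \<le>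
    4 + (\<Sum>m\<le>n. \<Sum>i<2 ^ m. exp (real (m + 2) * (l * d m i / ((1 - r) * r ^ m)) - real (m + 1) * ln 4))"
proof -
  define D where "D m = (MAX i\<in>{..<2 ^ m}. d m i)" for m
  define w where "w m = (1 - r) * r ^ m" for m
  define T where "T m i = exp (real (m + 2) * (l * d m i / w m) - real (m + 1) * ln 4)" for m i
  define Q where "Q = l * (\<Sum>m\<le>n. D m)"
  have w: "w m > 0" for m using r by (simp add: w_def)
  have sw: "(\<Sum>m\<le>n. w m) \<le> 1"
  proof -
    have "(\<Sum>m\<le>n. w m) = 1 - r ^ Suc n"
      using one_diff_power_eq[of r "Suc n"] by (simp add: w_def sum_distrib_left lessThan_Suc_atMost)
    then show ?thesis using r by simp
  qed
  have "exp Q \<le> 4 + (\<Sum>m\<le>n. \<Sum>i<2 ^ m. T m i)"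
  proof (cases "Q \<le> ln 4")
    case True
    then have "exp Q \<le> exp (ln 4)" by (subst exp_le_cancel_iff)
    then have "exp Q \<le> 4" by simp
    moreover have "(\<Sum>m\<le>n. \<Sum>i<2 ^ m. T m i) \<ge> 0" by (auto simp: T_def intro!: sum_nonneg)
    ultimately show ?thesis by linarith
  next
    case False
    moreover have "ln 4 > (0::real)" by simp
    ultimately have Q: "Q > ln 4" "Q > 0" by linarith+
    have "\<exists>m\<le>n. Q * w m \<le> l * D m"
    proof (rule ccontr)
      assume "\<not> (\<exists>m\<le>n. Q * w m \<le> l * D m)"
      then have "l * D m < Q * w m" if "m \<le> n" for m using that by (meson not_le)
      then have "(\<Sum>m\<le>n. l * D m) < (\<Sum>m\<le>n. Q * w m)"
        by (intro sum_strict_mono) auto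
      also have "\<dots> \<le> Q * 1" unfolding sum_distrib_left[symmetric] using Q sw by (intro mult_left_mono) auto
      finally show False by (simp add: Q_def sum_distrib_left)
    qed
    then obtain m where m: "m \<le> n" "Q * w m \<le> l * D m" by blast
    have "D m \<in> d m ` {..<2 ^ m}" unfolding D_def by (intro Max_in) (auto simp: lessThan_empty_iff)
    then obtain i where i: "i < 2 ^ m" "D m = d m i" by auto
    have "Q \<le> l * d m i / w m" using m i w[of m] by (simp add: le_divide_eq)
    then have "real (m + 2) * Q \<le> real (m + 2) * (l * d m i / w m)" by (intro mult_left_mono) auto
    moreover have "real (m + 1) * ln 4 \<le> real (m + 1) * Q" using Q by (intro mult_left_mono) auto
    moreover have "real (m + 2) * Q = Q + real (m + 1) * Q" by (simp add: algebra_simps)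
    ultimately have "exp Q \<le> T m i" unfolding T_def by (subst exp_le_cancel_iff) linarith
    also have "\<dots> \<le> (\<Sum>i<2 ^ m. T m i)"
      using i by (intro member_le_sum) (auto simp: T_def)
    also have "\<dots> \<le> (\<Sum>m\<le>n. \<Sum>i<2 ^ m. T m i)"
      using m by (intro member_le_sum[of m "{..n}" "\<lambda>m. \<Sum>i<2 ^ m. T m i"]) (auto simp: T_def intro!: sum_nonneg)
    finally show ?thesis by simp
  qed
  then show ?thesis unfolding Q_def D_def T_def w_def .
qed

text \<open>A point of even index already belongs to the coarser grid, and one of odd index is a
  single step away from such a point; each level therefore costs at most one increment.\<close>

lemma dyadic_increments:
  fixes x :: "nat \<Rightarrow> nat \<Rightarrow> real"
  assumes refine: "\<And>n j. x (Suc n) (2 * j) = x n j"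
  shows "j \<le> 2 ^ n \<Longrightarrow> \<bar>x n j - x 0 0\<bar> \<le> (\<Sum>m\<le>n. MAX i\<in>{..<2 ^ m}. \<bar>x m (Suc i) - x m i\<bar>)"
proof (induction n arbitrary: j)
  case 0
  then have "j = 0 \<or> j = Suc 0" by auto
  then show ?case by (auto simp: lessThan_Suc)
next
  case (Suc n)
  have step: "\<bar>x (Suc n) (Suc i) - x (Suc n) i\<bar> \<le> (MAX i\<in>{..<2 ^ Suc n}. \<bar>x (Suc n) (Suc i) - x (Suc n) i\<bar>)"
    if "i < 2 ^ Suc n" for i
    using that by (intro Max_ge) auto
  have nn: "0 \<le> (MAX i\<in>{..<2 ^ Suc n}. \<bar>x (Suc n) (Suc i) - x (Suc n) i\<bar>)"
    by (rule order_trans[OF abs_ge_zero step[of 0]]) simp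
  show ?case
  proof (cases "even j")
    case True
    then obtain k where k: "j = 2 * k" by auto
    then have "k \<le> 2 ^ n" using Suc.prems by simp
    from Suc.IH[OF this] nn show ?thesis by (simp add: k refine)
  next
    case False
    then obtain k where k: "j = Suc (2 * k)" using oddE by fastforce
    then have k': "2 * k < 2 ^ Suc n" "k \<le> 2 ^ n" using Suc.prems by auto
    have "\<bar>x (Suc n) j - x 0 0\<bar> \<le> \<bar>x n k - x 0 0\<bar> + \<bar>x (Suc n) j - x (Suc n) (2 * k)\<bar>"
      by (simp add: refine)
    also have "\<dots> \<le> (\<Sum>m\<le>n. MAX i\<in>{..<2 ^ m}. \<bar>x m (Suc i) - x m i\<bar>) + (MAX i\<in>{..<2 ^ Suc n}. \<bar>x (Suc n) (Suc i) - x (Suc n) i\<bar>)"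
      unfolding k by (intro add_mono Suc.IH step k')
    finally show ?thesis by simp
  qed
qed

lemma nn_integral_exp_abs_le:
  assumes "prob_space M" "centered_normal_rv M X" and v: "(\<integral>\<omega>. (X \<omega>)\<^sup>2 \<partial>M) \<le> v"
  shows "(\<integral>\<^sup>+\<omega>. ennreal (exp (t * \<bar>X \<omega>\<bar> - s)) \<partial>M) \<le> ennreal (2 * exp (t\<^sup>2 * v / 2 - s))"
proof -
  note m = centered_normal_rv_moments[OF assms(1,2)]
  have "(\<integral>\<^sup>+\<omega>. ennreal (exp (t * \<bar>X \<omega>\<bar> - s)) \<partial>M) \<le> (\<integral>\<^sup>+\<omega>. ennreal (exp (- s) * (exp (t * X \<omega>) + exp ((- t) * X \<omega>))) \<partial>M)"
  proof (intro nn_integral_mono ennreal_leI)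
    fix \<omega>
    have "exp (t * \<bar>X \<omega>\<bar>) \<le> exp (t * X \<omega>) + exp ((- t) * X \<omega>)"
      by (cases "X \<omega> \<ge> 0") auto
    then have "exp (- s) * exp (t * \<bar>X \<omega>\<bar>) \<le> exp (- s) * (exp (t * X \<omega>) + exp ((- t) * X \<omega>))" by simp
    then show "exp (t * \<bar>X \<omega>\<bar> - s) \<le> exp (- s) * (exp (t * X \<omega>) + exp ((- t) * X \<omega>))"
      by (simp add: exp_diff exp_minus field_simps)
  qed
  also have "\<dots> = ennreal (\<integral>\<omega>. exp (- s) * (exp (t * X \<omega>) + exp ((- t) * X \<omega>)) \<partial>M)"
    using m(4)[of t] m(4)[of "- t"] by (intro nn_integral_eq_integral) auto
  also have "(\<integral>\<omega>. exp (- s) * (exp (t * X \<omega>) + exp ((- t) * X \<omega>)) \<partial>M) = exp (- s) * (2 * exp (t\<^sup>2 * (\<integral>\<omega>. (X \<omega>)\<^sup>2 \<partial>M) / 2))"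
    using m(4,5)[of t] m(4,5)[of "- t"] by simp
  also have "\<dots> \<le> exp (- s) * (2 * exp (t\<^sup>2 * v / 2))"
    using v by (simp add: mult_left_mono)
  also have "\<dots> = 2 * exp (t\<^sup>2 * v / 2 - s)"
  proof -
    have "exp (- s) * (2 * exp A) = 2 * exp (A - s)" for A by (simp add: exp_diff exp_minus field_simps)
    then show ?thesis .
  qed
  finally show ?thesis by (simp add: ennreal_leI)
qed

text \<open>The majorant \<open>G\<close> is a sum of exponential moments of dyadic increments, one
  for each level and position. It does not depend on \<open>t\<close>, and \<open>K\<close> does not
  depend on \<open>a\<close>, because \<open>V\<close> bounds increments by their length
  alone.\<close>

lemma chaining_bound:
  assumes X: "centered_gaussian_process M X" and \<kappa>: "\<kappa> > 0" and l: "l \<ge> 0" and C: "C \<ge> 0"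
    and V: "\<And>s t. 0 \<le> s \<Longrightarrow> s \<le> t \<Longrightarrow> (\<integral>\<omega>. (X t \<omega> - X s \<omega>)\<^sup>2 \<partial>M) \<le> C * (t - s) powr \<kappa>"
  shows "\<exists>K. \<forall>a\<ge>0. \<exists>G \<in> borel_measurable M. (\<integral>\<^sup>+\<omega>. G \<omega> \<partial>M) \<le> ennreal K \<and>
    (\<forall>\<omega>. continuous_on {a..a + 1} (\<lambda>t. X t \<omega>) \<longrightarrow>
      (\<forall>t\<in>{a..a + 1}. ennreal (exp (l * \<bar>X t \<omega> - X a \<omega>\<bar>)) \<le> G \<omega>))"
proof -
  interpret prob_space M by (rule centered_gaussian_processD[OF X])
  \<comment> \<open>Increments at level \<open>m\<close> have variance at most
    \<open>C * r ^ (4 * m)\<close>, hence standard deviation of order \<open>r ^ (2 * m)\<close>.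
    Dividing by the weight \<open>(1 - r) * r ^ m\<close> leaves a spare factor
    \<open>r ^ m\<close>, enough to absorb the multiplier \<open>m + 2\<close>.\<close>
  define r where "r = 2 powr (- \<kappa> / 4)"
  have r: "0 < r" "r < 1" using \<kappa> powr_less_mono[of "- \<kappa> / 4" 0 2] by (auto simp: r_def)
  have "(\<lambda>m. real (m + 2) * r ^ m) \<longlonglongrightarrow> 0" using r by real_asymp
  then have "Bseq (\<lambda>m. real (m + 2) * r ^ m)" by (intro convergent_imp_Bseq convergentI)
  then obtain L where "\<forall>m. norm (real (m + 2) * r ^ m) \<le> L" by (rule BseqE)
  then have L: "\<bar>real (m + 2) * r ^ m\<bar> \<le> L" for m by (simp only: real_norm_def)
  define Q where "Q = (l / (1 - r))\<^sup>2 * L\<^sup>2 * C / 2"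
  have rpow: "(1 / 2 ^ m) powr \<kappa> = r ^ m * r ^ m * (r ^ m * r ^ m)" for m
  proof -
    have "(1 / 2 ^ m :: real) = 2 powr (- real m)" by (simp add: powr_minus powr_realpow divide_inverse)
    then have "(1 / 2 ^ m) powr \<kappa> = 2 powr (- real m * \<kappa>)" by (simp add: powr_powr)
    also have "\<dots> = 2 powr (4 * (real m * (- \<kappa> / 4)))" by simp
    also have "\<dots> = (2 powr (- \<kappa> / 4 * real m)) powr 4" by (simp add: powr_powr mult_ac)
    also have "2 powr (- \<kappa> / 4 * real m) = r ^ m" by (simp add: r_def powr_powr flip: powr_realpow)
    also have "(r ^ m) powr 4 = r ^ m * r ^ m * (r ^ m * r ^ m)"
      using r by (simp add: powr_numeral power4_eq_xxxx)
    finally show ?thesis .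
  qed
  show ?thesis
  proof (intro exI[of _ "4 + exp Q"] allI impI)
    fix a :: real assume a: "a \<ge> 0"
    define x where "x n j = a + real j / 2 ^ n" for n j :: nat
    define d where "d m i \<omega> = \<bar>X (x m (Suc i)) \<omega> - X (x m i) \<omega>\<bar>" for m i \<omega>
    define E where "E m i \<omega> = exp ((real (m + 2) * (l / ((1 - r) * r ^ m))) * d m i \<omega> - real (m + 1) * ln 4)" for m i \<omega>
    define G where "G \<omega> = 4 + (\<Sum>m. \<Sum>i<2 ^ m. ennreal (E m i \<omega>))" for \<omega>
    have E0: "E m i \<omega> \<ge> 0" for m i \<omega> by (simp add: E_def)
    have x0: "x m i \<ge> 0" for m i using a by (simp add: x_def)
    have [measurable]: "X (x m i) \<in> borel_measurable M" for m i
      by (rule centered_gaussian_processD(2)[OF X x0])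
    have [measurable]: "E m i \<in> borel_measurable M" for m i unfolding E_def d_def by measurable
    have [measurable]: "G \<in> borel_measurable M" unfolding G_def by measurable
    have Ebound: "(\<integral>\<^sup>+\<omega>. ennreal (E m i \<omega>) \<partial>M) \<le> ennreal (2 * exp Q * (1 / 4) ^ (m + 1))" for m i
    proof -
      have fam: "gaussian_family M {x m (Suc i), x m i} (\<lambda>t \<omega>. 1 * X t \<omega>)"
        using x0 by (intro gaussian_process_family X) auto
      have cn: "centered_normal_rv M (\<lambda>\<omega>. X (x m (Suc i)) \<omega> - X (x m i) \<omega>)"
        using gaussian_family_diff[OF fam, of "x m (Suc i)" "x m i"] by simp
      have dx: "x m (Suc i) - x m i = 1 / 2 ^ m" by (simp add: x_def diff_divide_distrib[symmetric])
      then have "x m i \<le> x m (Suc i)" by (smt (verit) divide_nonneg_pos zero_less_power)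
      from V[OF x0 this] have v: "(\<integral>\<omega>. (X (x m (Suc i)) \<omega> - X (x m i) \<omega>)\<^sup>2 \<partial>M) \<le> C * (r ^ m * r ^ m * (r ^ m * r ^ m))"
        unfolding dx rpow .
      have "(\<integral>\<^sup>+\<omega>. ennreal (E m i \<omega>) \<partial>M) \<le> ennreal (2 * exp ((real (m + 2) * (l / ((1 - r) * r ^ m)))\<^sup>2 * (C * (r ^ m * r ^ m * (r ^ m * r ^ m))) / 2 - real (m + 1) * ln 4))"
        unfolding E_def d_def by (rule nn_integral_exp_abs_le[OF prob_space_axioms cn v])
      also have "\<dots> \<le> ennreal (2 * exp (Q - real (m + 1) * ln 4))"
      proof (intro ennreal_leI mult_left_mono)
        have "(real (m + 2) * (l / ((1 - r) * r ^ m)))\<^sup>2 * (C * (r ^ m * r ^ m * (r ^ m * r ^ m))) / 2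
          = (l / (1 - r))\<^sup>2 * (real (m + 2) * r ^ m)\<^sup>2 * C / 2"
        proof -
          have "(k * (l / (e * z)))\<^sup>2 * (C * (z * z * (z * z))) / 2 = (l / e)\<^sup>2 * (k * z)\<^sup>2 * C / 2"
            if "e > 0" "z > 0" for e z k
            using that by (simp add: power2_eq_square field_simps)
          then show ?thesis using r by simp
        qed
        also have "\<dots> \<le> Q"
          unfolding Q_def using C L[of m] by (intro divide_right_mono mult_right_mono mult_left_mono) (auto simp: abs_le_square_iff[symmetric])
        finally show "exp ((real (m + 2) * (l / ((1 - r) * r ^ m)))\<^sup>2 * (C * (r ^ m * r ^ m * (r ^ m * r ^ m))) / 2 - real (m + 1) * ln 4) \<le> exp (Q - real (m + 1) * ln 4)"
          by simp
      qed simp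
      also have "2 * exp (Q - real (m + 1) * ln 4) = 2 * exp Q * (1 / 4) ^ (m + 1)"
      proof -
        have "exp (real (m + 1) * ln 4) = (4::real) ^ (m + 1)" by (subst exp_of_nat_mult) simp
        then show ?thesis by (simp only: exp_diff power_one_over) simp
      qed
      finally show ?thesis .
    qed
    have "(\<integral>\<^sup>+\<omega>. G \<omega> \<partial>M) = 4 + (\<Sum>m. \<Sum>i<2 ^ m. \<integral>\<^sup>+\<omega>. ennreal (E m i \<omega>) \<partial>M)"
      unfolding G_def by (simp add: nn_integral_add nn_integral_suminf nn_integral_sum emeasure_space_1)
    also have "\<dots> \<le> 4 + (\<Sum>m. ennreal (exp Q * (1 / 2) ^ Suc m))"
    proof (intro add_left_mono suminf_le)
      fix m
      have "(\<Sum>i<2 ^ m. \<integral>\<^sup>+\<omega>. ennreal (E m i \<omega>) \<partial>M) \<le> (\<Sum>i<(2::nat) ^ m. ennreal (2 * exp Q * (1 / 4) ^ (m + 1)))"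
        by (intro sum_mono Ebound)
      also have "\<dots> = ennreal (2 ^ m * (2 * exp Q * (1 / 4) ^ (m + 1)))"
        by (subst sum_ennreal) auto
      \<comment> \<open>The \<open>2 ^ m\<close> positions and the factor 2 from the absolute value
        turn \<open>(1 / 4) ^ (m + 1)\<close> into \<open>(1 / 2) ^ (m + 1)\<close>, which sums to 1
        over the levels.\<close>
      also have "2 ^ m * (2 * exp Q * (1 / 4) ^ (m + 1)) = exp Q * (1 / 2) ^ Suc m"
      proof -
        have "(4::real) ^ m = 2 ^ m * 2 ^ m" by (simp flip: power_mult_distrib)
        then show ?thesis by (simp add: field_simps power_one_over)
      qed
      finally show "(\<Sum>i<2 ^ m. \<integral>\<^sup>+\<omega>. ennreal (E m i \<omega>) \<partial>M) \<le> ennreal (exp Q * (1 / 2) ^ Suc m)" .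
    qed auto
    also have "(\<Sum>m. ennreal (exp Q * (1 / 2) ^ Suc m)) = ennreal (exp Q)"
      using sums_mult[OF power_half_series, of "exp Q"] by (intro suminf_ennreal_eq) auto
    also have "4 + ennreal (exp Q) = ennreal (4 + exp Q)" by (subst ennreal_plus) auto
    finally have int: "(\<integral>\<^sup>+\<omega>. G \<omega> \<partial>M) \<le> ennreal (4 + exp Q)" .
    have "ennreal (exp (l * \<bar>X t \<omega> - X a \<omega>\<bar>)) \<le> G \<omega>"
      if cont: "continuous_on {a..a + 1} (\<lambda>t. X t \<omega>)" and t: "t \<in> {a..a + 1}" for t \<omega>
    proof (cases "G \<omega> = \<top>")
      case False
      then have Gr: "ennreal (enn2real (G \<omega>)) = G \<omega>" by (simp add: less_top)
      have "exp (l * \<bar>X t \<omega> - X a \<omega>\<bar>) \<le> enn2real (G \<omega>)"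
      proof (rule continuous_le_dyadic[of a "a + 1" "\<lambda>t. exp (l * \<bar>X t \<omega> - X a \<omega>\<bar>)"])
        fix n j :: nat assume j: "j \<le> 2 ^ n"
        have xa: "x 0 0 = a" by (simp add: x_def)
        have "\<bar>X (x n j) \<omega> - X (x 0 0) \<omega>\<bar> \<le> (\<Sum>m\<le>n. MAX i\<in>{..<2 ^ m}. d m i \<omega>)"
          unfolding d_def by (rule dyadic_increments[OF _ j]) (simp add: x_def)
        then have "l * \<bar>X (x n j) \<omega> - X a \<omega>\<bar> \<le> l * (\<Sum>m\<le>n. MAX i\<in>{..<2 ^ m}. d m i \<omega>)"
          unfolding xa using l by (rule mult_left_mono)
        then have "exp (l * \<bar>X (x n j) \<omega> - X a \<omega>\<bar>) \<le> exp (l * (\<Sum>m\<le>n. MAX i\<in>{..<2 ^ m}. d m i \<omega>))"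
          by simp
        also have "\<dots> \<le> 4 + (\<Sum>m\<le>n. \<Sum>i<2 ^ m. E m i \<omega>)"
          using exp_chain_le[OF r l, where n = n and d = "\<lambda>m i. d m i \<omega>"] by (simp add: E_def mult.assoc)
        finally have "exp (l * \<bar>X (x n j) \<omega> - X a \<omega>\<bar>) \<le> 4 + (\<Sum>m\<le>n. \<Sum>i<2 ^ m. E m i \<omega>)" .
        then have "ennreal (exp (l * \<bar>X (x n j) \<omega> - X a \<omega>\<bar>)) \<le> ennreal (4 + (\<Sum>m\<le>n. \<Sum>i<2 ^ m. E m i \<omega>))"
          by (rule ennreal_leI)
        also have "\<dots> = 4 + (\<Sum>m\<le>n. \<Sum>i<2 ^ m. ennreal (E m i \<omega>))"
          by (simp add: sum_ennreal sum_nonneg E0 ennreal_plus)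
        also have "\<dots> \<le> G \<omega>"
          unfolding G_def by (intro add_left_mono sum_le_suminf) auto
        finally show "exp (l * \<bar>X (a + (a + 1 - a) * (real j / 2 ^ n)) \<omega> - X a \<omega>\<bar>) \<le> enn2real (G \<omega>)"
          by (subst (asm) Gr[symmetric]) (simp add: ennreal_le_iff x_def)
      qed (use t in \<open>auto intro!: continuous_intros cont\<close>)
      then show ?thesis by (subst Gr[symmetric]) (rule ennreal_leI)
    qed simp
    with int show "\<exists>G \<in> borel_measurable M. (\<integral>\<^sup>+\<omega>. G \<omega> \<partial>M) \<le> ennreal (4 + exp Q) \<and>
      (\<forall>\<omega>. continuous_on {a..a + 1} (\<lambda>t. X t \<omega>) \<longrightarrow>
        (\<forall>t\<in>{a..a + 1}. ennreal (exp (l * \<bar>X t \<omega> - X a \<omega>\<bar>)) \<le> G \<omega>))"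
      by (intro bexI[of _ G]) auto
  qed
qed

section \<open>A bound uniform in the horizon\<close>

lemma summable_exp_neg_powr:
  fixes c \<kappa> :: real
  assumes "c > 0" "\<kappa> > 0"
  shows "summable (\<lambda>k. exp (- c * real k powr \<kappa>))"
proof (rule summable_comparison_test_bigo)
  show "summable (\<lambda>k. norm (1 / real k ^ 2))"
    using inverse_power_summable[of 2, where 'a=real] by (simp add: inverse_eq_divide)
  show "(\<lambda>k. exp (- c * real k powr \<kappa>)) \<in> O(\<lambda>k. 1 / real k ^ 2)"
    using assms by real_asymp
qed

text \<open>Separates two dependent exponents without Hoelder's inequality: unless
  \<open>B \<le> (p - 1) * A\<close>, the term \<open>A\<close> is smaller than
  \<open>B / (p - 1)\<close>.\<close>

lemma exp_add_le_Young:
  fixes A B p :: real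
  assumes "p > 1"
  shows "exp (A + B) \<le> exp (p * A) + exp (p / (p - 1) * B)"
proof (cases "A + B \<le> p * A")
  case True
  then have "exp (A + B) \<le> exp (p * A)" by simp
  then show ?thesis using exp_ge_zero[of "p / (p - 1) * B"] by linarith
next
  case False
  then have "(p - 1) * A < B" by (simp add: algebra_simps)
  then have "A < B / (p - 1)" using assms by (simp add: pos_less_divide_eq mult.commute)
  moreover have "p / (p - 1) * B = B / (p - 1) + B" using assms by (simp add: field_simps)
  ultimately have "exp (A + B) \<le> exp (p / (p - 1) * B)" by (subst exp_le_cancel_iff) linarith
  then show ?thesis using exp_ge_zero[of "p * A"] by linarith
qed

text \<open>The maximum is attained at some \<open>t\<close> in \<open>[k, k + 1]\<close>, with
  \<open>k\<close> depending on the path. Its exponential is split into the value at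
  \<open>k\<close> and the oscillation after \<open>k\<close>, and the unknown \<open>k\<close> is
  removed by summing over all of them.\<close>

lemma exp_SUP_bounded:
  assumes X: "centered_gaussian_process M X" and cont: "as_continuous_paths M X"
    and \<kappa>: "\<kappa> > 0" and R: "R > 0" and C: "C \<ge> 0"
    and var: "\<And>t. t \<ge> 0 \<Longrightarrow> (\<integral>\<omega>. (X t \<omega>)\<^sup>2 \<partial>M) = t powr \<kappa>"
    and V: "\<And>s t. 0 \<le> s \<Longrightarrow> s \<le> t \<Longrightarrow> (\<integral>\<omega>. (X t \<omega> - X s \<omega>)\<^sup>2 \<partial>M) \<le> C * (t - s) powr \<kappa>"
  shows "\<exists>K::real. \<forall>T\<ge>0. (\<integral>\<^sup>+\<omega>. ennreal (exp (SUP t\<in>{0..T}. sqrt 2 * X t \<omega> - t powr \<kappa> - R * t powr \<kappa>)) \<partial>M) \<le> ennreal K"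
proof -
  interpret prob_space M by (rule centered_gaussian_processD[OF X])
  \<comment> \<open>\<open>e\<close> is the share of the penalty reserved for the oscillation, and
    \<open>p\<close> is close enough to 1 for \<open>p - (1 + R - e) = - R / 2\<close>. The
    expectation of \<open>exp (p * A k)\<close> therefore still decays.\<close>
  define p where "p = 1 + R / 4"
  define q where "q = p / (p - 1)"
  define e where "e = R / 4"
  have p: "p > 1" "p > 0" and q: "q > 0" and e: "e > 0" using R by (auto simp: p_def q_def e_def)
  obtain K where K: "\<And>a. a \<ge> 0 \<Longrightarrow> \<exists>G \<in> borel_measurable M. (\<integral>\<^sup>+\<omega>. G \<omega> \<partial>M) \<le> ennreal K \<and>
    (\<forall>\<omega>. continuous_on {a..a + 1} (\<lambda>t. X t \<omega>) \<longrightarrow>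
      (\<forall>t\<in>{a..a + 1}. ennreal (exp (q * sqrt 2 * \<bar>X t \<omega> - X a \<omega>\<bar>)) \<le> G \<omega>))"
    using chaining_bound[OF X \<kappa> _ C V, of "q * sqrt 2"] q by auto
  define P where "P k G \<longleftrightarrow> G \<in> borel_measurable M \<and> (\<integral>\<^sup>+\<omega>. G \<omega> \<partial>M) \<le> ennreal K \<and>
    (\<forall>\<omega>. continuous_on {real k..real k + 1} (\<lambda>t. X t \<omega>) \<longrightarrow>
      (\<forall>t\<in>{real k..real k + 1}. ennreal (exp (q * sqrt 2 * \<bar>X t \<omega> - X (real k) \<omega>\<bar>)) \<le> G \<omega>))" for k and G :: "_ \<Rightarrow> ennreal"
  have "\<exists>G. P k G" for k
    using K[of "real k"] unfolding P_def Bex_def by simp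
  then obtain G where "\<forall>k. P k (G k)" by metis
  then have G [measurable]: "G k \<in> borel_measurable M" and GK: "(\<integral>\<^sup>+\<omega>. G k \<omega> \<partial>M) \<le> ennreal K"
    and Gb: "continuous_on {real k..real k + 1} (\<lambda>t. X t \<omega>) \<Longrightarrow> t \<in> {real k..real k + 1} \<Longrightarrow>
      ennreal (exp (q * sqrt 2 * \<bar>X t \<omega> - X (real k) \<omega>\<bar>)) \<le> G k \<omega>" for k \<omega> t
    unfolding P_def by auto
  define A where "A k \<omega> = sqrt 2 * X (real k) \<omega> - (1 + R - e) * real k powr \<kappa>" for k :: nat and \<omega>
  define S where "S \<omega> = (\<Sum>k. ennreal (exp (p * A k \<omega>)) + ennreal (exp (- (q * e) * real k powr \<kappa>)) * G k \<omega>)" for \<omega>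
  have [measurable]: "X (real k) \<in> borel_measurable M" for k :: nat by (rule centered_gaussian_processD(2)[OF X]) simp
  have [measurable]: "A k \<in> borel_measurable M" for k unfolding A_def by measurable
  have A_int: "(\<integral>\<^sup>+\<omega>. ennreal (exp (p * A k \<omega>)) \<partial>M) = ennreal (exp (- (p * R / 2) * real k powr \<kappa>))" for k
  proof -
    have fam: "gaussian_family M {real k} (\<lambda>t \<omega>. 1 * X t \<omega>)"
      by (intro gaussian_process_family X) auto
    have "(\<integral>\<^sup>+\<omega>. ennreal (exp (p * A k \<omega>)) \<partial>M) = (\<integral>\<^sup>+\<omega>. ennreal (exp (- (p * (1 + R - e) * real k powr \<kappa>))) * ennreal (exp (p * sqrt 2 * (1 * X (real k) \<omega>))) \<partial>M)"
      by (intro nn_integral_cong) (simp add: A_def algebra_simps mult_exp_exp flip: ennreal_mult')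
    also have "\<dots> = ennreal (exp (- (p * (1 + R - e) * real k powr \<kappa>))) * ennreal (exp ((p * sqrt 2)\<^sup>2 * real k powr \<kappa> / 2))"
      using gaussian_family_exp_moment[OF fam, of "real k" "p * sqrt 2"] by (simp add: nn_integral_cmult var)
    also have "\<dots> = ennreal (exp (- (p * (1 + R - e) * real k powr \<kappa>) + (p * sqrt 2)\<^sup>2 * real k powr \<kappa> / 2))"
      by (simp only: exp_add ennreal_mult''[OF exp_ge_zero])
    also have "- (p * (1 + R - e) * real k powr \<kappa>) + (p * sqrt 2)\<^sup>2 * real k powr \<kappa> / 2 = p * (p - (1 + R - e)) * real k powr \<kappa>"
      by (simp add: power_mult_distrib power2_eq_square algebra_simps)
    also have "p - (1 + R - e) = - R / 2" by (simp add: p_def e_def)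
    finally show ?thesis by simp
  qed
  \<comment> \<open>The real \<open>K\<close> has no known sign; its positive part represents the
    same extended value.\<close>
  have K0: "ennreal K = ennreal (max K 0)" by (simp add: max_def ennreal_neg)
  define Z where "Z = (\<Sum>k. exp (- (p * R / 2) * real k powr \<kappa>) + exp (- (q * e) * real k powr \<kappa>) * max K 0)"
  have "(\<integral>\<^sup>+\<omega>. S \<omega> \<partial>M) = (\<Sum>k. (\<integral>\<^sup>+\<omega>. ennreal (exp (p * A k \<omega>)) \<partial>M) + ennreal (exp (- (q * e) * real k powr \<kappa>)) * (\<integral>\<^sup>+\<omega>. G k \<omega> \<partial>M))"
    unfolding S_def by (subst nn_integral_suminf) (simp_all add: nn_integral_add nn_integral_cmult)
  also have "\<dots> \<le> (\<Sum>k. ennreal (exp (- (p * R / 2) * real k powr \<kappa>) + exp (- (q * e) * real k powr \<kappa>) * max K 0))"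
  proof (intro suminf_le allI)
    fix k
    have "ennreal (exp (- (q * e) * real k powr \<kappa>)) * (\<integral>\<^sup>+\<omega>. G k \<omega> \<partial>M) \<le> ennreal (exp (- (q * e) * real k powr \<kappa>)) * ennreal (max K 0)"
      unfolding K0[symmetric] by (intro mult_left_mono GK) simp
    then show "(\<integral>\<^sup>+\<omega>. ennreal (exp (p * A k \<omega>)) \<partial>M) + ennreal (exp (- (q * e) * real k powr \<kappa>)) * (\<integral>\<^sup>+\<omega>. G k \<omega> \<partial>M)
      \<le> ennreal (exp (- (p * R / 2) * real k powr \<kappa>) + exp (- (q * e) * real k powr \<kappa>) * max K 0)"
      unfolding A_int by (simp add: ennreal_plus ennreal_mult' add_left_mono)
  qed auto
  also have "\<dots> = ennreal Z"
    unfolding Z_def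
  proof (rule suminf_ennreal2)
    have "p * R / 2 > 0" "q * e > 0" using p q e R by auto
    then show "summable (\<lambda>k. exp (- (p * R / 2) * real k powr \<kappa>) + exp (- (q * e) * real k powr \<kappa>) * max K 0)"
      by (intro summable_add summable_mult2 summable_exp_neg_powr \<kappa>)
  qed auto
  finally have SZ: "(\<integral>\<^sup>+\<omega>. S \<omega> \<partial>M) \<le> ennreal Z" .
  show ?thesis
  proof (intro exI[of _ Z] allI impI)
    fix T :: real assume T: "T \<ge> 0"
    have "(\<integral>\<^sup>+\<omega>. ennreal (exp (SUP t\<in>{0..T}. sqrt 2 * X t \<omega> - t powr \<kappa> - R * t powr \<kappa>)) \<partial>M) \<le> (\<integral>\<^sup>+\<omega>. S \<omega> \<partial>M)"
    proof (rule nn_integral_mono_AE)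
      from cont show "AE \<omega> in M. ennreal (exp (SUP t\<in>{0..T}. sqrt 2 * X t \<omega> - t powr \<kappa> - R * t powr \<kappa>)) \<le> S \<omega>"
        unfolding as_continuous_paths_def
      proof eventually_elim
        case (elim \<omega>)
        have "continuous_on {0..T} (\<lambda>t. sqrt 2 * X t \<omega> - t powr \<kappa> - R * t powr \<kappa>)"
          by (intro continuous_intros continuous_on_powr' continuous_on_subset[OF elim]) (use \<kappa> in auto)
        then obtain t where t: "t \<in> {0..T}" "\<And>s. s \<in> {0..T} \<Longrightarrow> sqrt 2 * X s \<omega> - s powr \<kappa> - R * s powr \<kappa> \<le> sqrt 2 * X t \<omega> - t powr \<kappa> - R * t powr \<kappa>"
          using continuous_attains_sup[OF compact_Icc, of 0 T "\<lambda>t. sqrt 2 * X t \<omega> - t powr \<kappa> - R * t powr \<kappa>"] T by auto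
        have sup: "(SUP t\<in>{0..T}. sqrt 2 * X t \<omega> - t powr \<kappa> - R * t powr \<kappa>) = sqrt 2 * X t \<omega> - t powr \<kappa> - R * t powr \<kappa>"
          using t by (intro cSup_eq_maximum) auto
        define k where "k = nat \<lfloor>t\<rfloor>"
        have k: "real k \<le> t" "t \<le> real k + 1" using t(1) by (auto simp: k_def)
        define D where "D = \<bar>X t \<omega> - X (real k) \<omega>\<bar>"
        have kt: "real k powr \<kappa> \<le> t powr \<kappa>" using k \<kappa> by (intro powr_mono2) auto
        have "sqrt 2 * X t \<omega> \<le> sqrt 2 * X (real k) \<omega> + sqrt 2 * D"
          unfolding distrib_left[symmetric] D_def by (intro mult_left_mono) auto
        \<comment> \<open>The penalty at \<open>t\<close> is at least the one at \<open>k\<close>,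
          so it can be evaluated at the deterministic time \<open>k\<close>.\<close>
        moreover have "(1 + R) * real k powr \<kappa> \<le> (1 + R) * t powr \<kappa>"
          using kt R by (intro mult_left_mono) auto
        ultimately have "sqrt 2 * X t \<omega> - t powr \<kappa> - R * t powr \<kappa> \<le> A k \<omega> + (sqrt 2 * D - e * real k powr \<kappa>)"
          by (simp add: A_def algebra_simps)
        then have "exp (sqrt 2 * X t \<omega> - t powr \<kappa> - R * t powr \<kappa>) \<le> exp (A k \<omega> + (sqrt 2 * D - e * real k powr \<kappa>))" by simp
        also have "\<dots> \<le> exp (p * A k \<omega>) + exp (q * (sqrt 2 * D - e * real k powr \<kappa>))"
          unfolding q_def by (rule exp_add_le_Young[OF p(1)])
        also have "exp (q * (sqrt 2 * D - e * real k powr \<kappa>)) = exp (- (q * e) * real k powr \<kappa>) * exp (q * sqrt 2 * D)"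
          by (simp add: mult_exp_exp algebra_simps)
        finally have "ennreal (exp (sqrt 2 * X t \<omega> - t powr \<kappa> - R * t powr \<kappa>)) \<le>
            ennreal (exp (p * A k \<omega>) + exp (- (q * e) * real k powr \<kappa>) * exp (q * sqrt 2 * D))"
          by (rule ennreal_leI)
        also have "\<dots> = ennreal (exp (p * A k \<omega>)) + ennreal (exp (- (q * e) * real k powr \<kappa>)) * ennreal (exp (q * sqrt 2 * D))"
          by (simp add: ennreal_plus ennreal_mult')
        also have "\<dots> \<le> ennreal (exp (p * A k \<omega>)) + ennreal (exp (- (q * e) * real k powr \<kappa>)) * G k \<omega>"
          unfolding D_def using k
          by (intro add_left_mono mult_left_mono Gb continuous_on_subset[OF elim]) auto
        also have "\<dots> \<le> S \<omega>"
          unfolding S_def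
          using sum_le_suminf[of "\<lambda>k. ennreal (exp (p * A k \<omega>)) + ennreal (exp (- (q * e) * real k powr \<kappa>)) * G k \<omega>" "{k}"] by simp
        finally show ?case unfolding sup .
      qed
    qed
    then show "(\<integral>\<^sup>+\<omega>. ennreal (exp (SUP t\<in>{0..T}. sqrt 2 * X t \<omega> - t powr \<kappa> - R * t powr \<kappa>)) \<partial>M) \<le> ennreal Z"
      using SZ by (rule order_trans)
  qed
qed

section \<open>The class S and fractional Brownian motion\<close>

lemma gaussian_process_diff:
  assumes Y: "centered_gaussian_process M Y" and st: "s \<ge> 0" "t \<ge> 0"
  shows "centered_normal_rv M (\<lambda>\<omega>. Y s \<omega> - Y t \<omega>)" and "centered_normal_rv M (Y t)"
proof -
  have fam: "gaussian_family M {s, t} (\<lambda>t \<omega>. 1 * Y t \<omega>)"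
    using st by (intro gaussian_process_family Y) auto
  show "centered_normal_rv M (\<lambda>\<omega>. Y s \<omega> - Y t \<omega>)" "centered_normal_rv M (Y t)"
    using gaussian_family_diff[OF fam, of s t] gaussian_family_single[OF fam, of t] by simp_all
qed

lemma V_Y_eq_second_moment:
  assumes Y: "centered_gaussian_process M Y" and st: "s \<ge> 0" "t \<ge> 0"
  shows "V_Y M Y s t = (\<integral>\<omega>. (Y s \<omega> - Y t \<omega>)\<^sup>2 \<partial>M)"
    and "prob_space.variance M (Y t) = (\<integral>\<omega>. (Y t \<omega>)\<^sup>2 \<partial>M)"
  using centered_normal_rv_moments(2)[OF centered_gaussian_processD(1)[OF Y] gaussian_process_diff(1)[OF Y st]]
    centered_normal_rv_moments(2)[OF centered_gaussian_processD(1)[OF Y] gaussian_process_diff(2)[OF Y st]]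
  by (simp_all add: V_Y_def)

text \<open>Second moments are all that the proof takes from self-similarity and from stationarity
  of increments. They are integrals of functions of one or two coordinates under
  \<open>process_law\<close>.\<close>

lemma process_law_second_moments:
  assumes law: "process_law M Y = process_law N Z"
    and Y: "\<And>t. t \<ge> 0 \<Longrightarrow> Y t \<in> borel_measurable M" and Z: "\<And>t. t \<ge> 0 \<Longrightarrow> Z t \<in> borel_measurable N"
    and st: "s \<ge> 0" "t \<ge> 0"
  shows "(\<integral>\<omega>. (Y s \<omega> - Y t \<omega>)\<^sup>2 \<partial>M) = (\<integral>\<omega>. (Z s \<omega> - Z t \<omega>)\<^sup>2 \<partial>N)"
    and "(\<integral>\<omega>. (Y t \<omega>)\<^sup>2 \<partial>M) = (\<integral>\<omega>. (Z t \<omega>)\<^sup>2 \<partial>N)"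
proof -
  let ?P = "\<Pi>\<^sub>M t\<in>{0..}. (borel :: real measure)"
  have mY: "(\<lambda>\<omega>. \<lambda>t\<in>{0..}. Y t \<omega>) \<in> measurable M ?P" by (intro measurable_restrict Y) simp
  have mZ: "(\<lambda>\<omega>. \<lambda>t\<in>{0..}. Z t \<omega>) \<in> measurable N ?P" by (intro measurable_restrict Z) simp
  have [measurable]: "(\<lambda>x. x r) \<in> borel_measurable ?P" if "r \<ge> 0" for r
    by (rule measurable_component_singleton) (use that in simp)
  note [measurable] = this[OF st(1)] this[OF st(2)]
  have *: "(\<integral>\<omega>. f (\<lambda>t\<in>{0..}. Y t \<omega>) \<partial>M) = (\<integral>\<omega>. f (\<lambda>t\<in>{0..}. Z t \<omega>) \<partial>N)"
    if "f \<in> borel_measurable ?P" for f :: "(real \<Rightarrow> real) \<Rightarrow> real"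
    using integral_distr[OF mY that] integral_distr[OF mZ that] law by (simp add: process_law_def)
  show "(\<integral>\<omega>. (Y s \<omega> - Y t \<omega>)\<^sup>2 \<partial>M) = (\<integral>\<omega>. (Z s \<omega> - Z t \<omega>)\<^sup>2 \<partial>N)"
    using *[of "\<lambda>x. (x s - x t)\<^sup>2"] st by simp
  show "(\<integral>\<omega>. (Y t \<omega>)\<^sup>2 \<partial>M) = (\<integral>\<omega>. (Z t \<omega>)\<^sup>2 \<partial>N)"
    using *[of "\<lambda>x. (x t)\<^sup>2"] st by simp
qed

lemma class_S_moments:
  assumes S: "class_S M \<alpha> \<kappa> c Y" and \<alpha>: "\<alpha> > 0"
  shows "t \<ge> 0 \<Longrightarrow> (\<integral>\<omega>. (Y t \<omega>)\<^sup>2 \<partial>M) = t powr \<alpha>"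
    and "a > 0 \<Longrightarrow> s \<ge> 0 \<Longrightarrow> t \<ge> 0 \<Longrightarrow>
      (\<integral>\<omega>. (Y (a * s) \<omega> - Y (a * t) \<omega>)\<^sup>2 \<partial>M) = a powr \<alpha> * (\<integral>\<omega>. (Y s \<omega> - Y t \<omega>)\<^sup>2 \<partial>M)"
proof -
  have Y: "centered_gaussian_process M Y" and ss: "self_similar M (\<alpha> / 2) Y" and v1: "prob_space.variance M (Y 1) = 1"
    using S by (auto simp: class_S_def)
  note mY = centered_gaussian_processD(2)[OF Y]
  have law: "process_law M (\<lambda>t. Y (a * t)) = process_law M (\<lambda>t \<omega>. a powr (\<alpha> / 2) * Y t \<omega>)" if "a > 0" for a
    using ss that by (simp add: self_similar_def)
  have ap: "(a powr (\<alpha> / 2))\<^sup>2 = a powr \<alpha>" for a :: real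
    by (simp add: power2_eq_square flip: powr_add)
  have sc1: "(\<integral>\<omega>. (Y (a * s) \<omega> - Y (a * t) \<omega>)\<^sup>2 \<partial>M) = a powr \<alpha> * (\<integral>\<omega>. (Y s \<omega> - Y t \<omega>)\<^sup>2 \<partial>M)"
    if "a > 0" "s \<ge> 0" "t \<ge> 0" for a s t
    using process_law_second_moments(1)[OF law[OF that(1)], of s t] mY that
    by (simp add: power_mult_distrib ap flip: right_diff_distrib)
  have sc2: "(\<integral>\<omega>. (Y (a * t) \<omega>)\<^sup>2 \<partial>M) = a powr \<alpha> * (\<integral>\<omega>. (Y t \<omega>)\<^sup>2 \<partial>M)"
    if "a > 0" "t \<ge> 0" for a t
    using process_law_second_moments(2)[OF law[OF that(1)], of t t] mY that
    by (simp add: power_mult_distrib ap)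
  show "a > 0 \<Longrightarrow> s \<ge> 0 \<Longrightarrow> t \<ge> 0 \<Longrightarrow>
      (\<integral>\<omega>. (Y (a * s) \<omega> - Y (a * t) \<omega>)\<^sup>2 \<partial>M) = a powr \<alpha> * (\<integral>\<omega>. (Y s \<omega> - Y t \<omega>)\<^sup>2 \<partial>M)"
    by (rule sc1)
  have e1: "(\<integral>\<omega>. (Y 1 \<omega>)\<^sup>2 \<partial>M) = 1"
    using v1 V_Y_eq_second_moment(2)[OF Y, of 1 1] by simp
  show "(\<integral>\<omega>. (Y t \<omega>)\<^sup>2 \<partial>M) = t powr \<alpha>" if "t \<ge> 0"
  proof (cases "t = 0")
    case True
    \<comment> \<open>Scaling by 2 fixes time 0, so the second moment there equals
      \<open>2 powr \<alpha>\<close> times itself and must vanish.\<close>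
    have "(2::real) powr \<alpha> > 1" using \<alpha> powr_less_mono[of 0 \<alpha> 2] by simp
    then show ?thesis using sc2[of 2 0] True \<alpha> by simp
  next
    case False
    then show ?thesis using sc2[of t 1] that e1 by simp
  qed
qed

text \<open>The parameter \<open>e\<close> stands for \<open>y powr (\<alpha> / 2)\<close>, where the bound is \<open>(1 - e)\<^sup>2\<close>; leaving it free
  covers \<open>y = 0\<close>.\<close>

lemma class_S_increment_bounds:
  assumes S: "class_S M \<alpha> \<kappa> c Y" and \<alpha>: "\<alpha> > 0" and y: "0 \<le> y" "y \<le> 1"
  shows "e > 0 \<Longrightarrow> (1 - e) + y powr \<alpha> * (1 - 1 / e) \<le> V_Y M Y 1 y"
    and "V_Y M Y 1 y \<le> 4"
proof -
  have Y: "centered_gaussian_process M Y" using S by (auto simp: class_S_def)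
  note p = centered_gaussian_processD(1)[OF Y]
  have V: "V_Y M Y 1 y = (\<integral>\<omega>. (Y 1 \<omega> - Y y \<omega>)\<^sup>2 \<partial>M)" using y by (intro V_Y_eq_second_moment Y) auto
  have e: "(\<integral>\<omega>. (Y 1 \<omega>)\<^sup>2 \<partial>M) = 1" "(\<integral>\<omega>. (Y y \<omega>)\<^sup>2 \<partial>M) = y powr \<alpha>"
    using class_S_moments(1)[OF S \<alpha>, of 1] class_S_moments(1)[OF S \<alpha>, of y] y by auto
  have i: "integrable M (\<lambda>\<omega>. (Y 1 \<omega>)\<^sup>2)" "integrable M (\<lambda>\<omega>. (Y y \<omega>)\<^sup>2)" "integrable M (\<lambda>\<omega>. (Y 1 \<omega> - Y y \<omega>)\<^sup>2)"
    using y centered_normal_rv_moments(3)[OF p gaussian_process_diff(2)[OF Y, of 1 1]]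
      centered_normal_rv_moments(3)[OF p gaussian_process_diff(2)[OF Y, of y y]]
      centered_normal_rv_moments(3)[OF p gaussian_process_diff(1)[OF Y, of 1 y]] by auto
  show "(1 - e) + y powr \<alpha> * (1 - 1 / e) \<le> V_Y M Y 1 y" if e0: "e > 0"
  proof -
    have "(\<integral>\<omega>. (1 - e) * (Y 1 \<omega>)\<^sup>2 + (1 - 1 / e) * (Y y \<omega>)\<^sup>2 \<partial>M) \<le> (\<integral>\<omega>. (Y 1 \<omega> - Y y \<omega>)\<^sup>2 \<partial>M)"
    proof (intro integral_mono i Bochner_Integration.integrable_add integrable_mult_right)
      fix \<omega>
      \<comment> \<open>A weighted arithmetic-geometric bound on the cross term
        \<open>2 * Y 1 * Y y\<close> stands in for the Cauchy-Schwarz inequality.\<close>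
      have "0 \<le> e * (Y 1 \<omega> - Y y \<omega> / e)\<^sup>2" using e0 by simp
      also have "\<dots> = e * (Y 1 \<omega>)\<^sup>2 - 2 * Y 1 \<omega> * Y y \<omega> + (1 / e) * (Y y \<omega>)\<^sup>2"
        using e0 by (simp add: power2_eq_square field_simps)
      finally show "(1 - e) * (Y 1 \<omega>)\<^sup>2 + (1 - 1 / e) * (Y y \<omega>)\<^sup>2 \<le> (Y 1 \<omega> - Y y \<omega>)\<^sup>2"
        by (simp add: power2_eq_square algebra_simps)
    qed
    then show ?thesis using i e by (simp add: V mult.commute)
  qed
  have "(\<integral>\<omega>. (Y 1 \<omega> - Y y \<omega>)\<^sup>2 \<partial>M) \<le> (\<integral>\<omega>. 2 * (Y 1 \<omega>)\<^sup>2 + 2 * (Y y \<omega>)\<^sup>2 \<partial>M)"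
  proof (intro integral_mono i Bochner_Integration.integrable_add integrable_mult_right)
    fix \<omega>
    have "0 \<le> (Y 1 \<omega> + Y y \<omega>)\<^sup>2" by simp
    then show "(Y 1 \<omega> - Y y \<omega>)\<^sup>2 \<le> 2 * (Y 1 \<omega>)\<^sup>2 + 2 * (Y y \<omega>)\<^sup>2"
      by (simp add: power2_eq_square algebra_simps)
  qed
  also have "\<dots> = 2 + 2 * y powr \<alpha>" using i e by simp
  also have "y powr \<alpha> \<le> 1" using y \<alpha> powr_mono2[of \<alpha> y 1] by simp
  finally show "V_Y M Y 1 y \<le> 4" by (simp add: V)
qed

section \<open>The variogram ratio and its bounds\<close>

text \<open>Compares the time-changed process with fractional Brownian motion on the increment
  between \<open>x\<close> and 1; \<open>c1\<close> and \<open>c2\<close> are its infimum and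
  supremum on \<open>[0, 1)\<close>.\<close>

definition variogram_ratio :: "'a measure \<Rightarrow> (real \<Rightarrow> 'a \<Rightarrow> real) \<Rightarrow> real \<Rightarrow> real \<Rightarrow> real \<Rightarrow> real" where
  "variogram_ratio M Y \<alpha> \<kappa> x = V_Y M Y 1 (x powr (\<kappa> / \<alpha>)) / \<bar>1 - x\<bar> powr \<kappa>"

text \<open>The local condition (S2) is applied with \<open>h = 1 - x powr q\<close>, where
  \<open>q = \<kappa> / \<alpha>\<close>; the quotient \<open>(1 - x powr q) / (1 - x)\<close> tends
  to the derivative \<open>q\<close>, which explains the factor
  \<open>(\<kappa> / \<alpha>) powr \<kappa>\<close>.\<close>

lemma variogram_ratio_tendsto:
  assumes S: "class_S M \<alpha> \<kappa> c Y" and \<alpha>: "\<alpha> > 0" and \<kappa>: "\<kappa> > 0"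
  shows "(variogram_ratio M Y \<alpha> \<kappa> \<longlongrightarrow> c * (\<kappa> / \<alpha>) powr \<kappa>) (at_left 1)"
proof -
  define q where "q = \<kappa> / \<alpha>"
  have q: "q > 0" using \<alpha> \<kappa> by (simp add: q_def)
  have "((\<lambda>h. (V_Y M Y 1 (1 - h) - c * \<bar>h\<bar> powr \<kappa>) / \<bar>h\<bar> powr \<kappa>) \<longlongrightarrow> 0) (at 0)"
    using S by (intro smalloD_tendsto) (simp add: class_S_def)
  then have "((\<lambda>h. (V_Y M Y 1 (1 - h) - c * \<bar>h\<bar> powr \<kappa>) / \<bar>h\<bar> powr \<kappa> + c) \<longlongrightarrow> 0 + c) (at 0)"
    by (intro tendsto_intros)
  then have lim0: "((\<lambda>h. V_Y M Y 1 (1 - h) / \<bar>h\<bar> powr \<kappa>) \<longlongrightarrow> c) (at 0)"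
    unfolding add_0
  proof (rule Lim_transform_eventually)
    show "\<forall>\<^sub>F h in at 0. (V_Y M Y 1 (1 - h) - c * \<bar>h\<bar> powr \<kappa>) / \<bar>h\<bar> powr \<kappa> + c = V_Y M Y 1 (1 - h) / \<bar>h\<bar> powr \<kappa>"
      by (auto simp: eventually_at_filter diff_divide_distrib)
  qed
  have near: "eventually (\<lambda>x::real. 0 < x \<and> x < 1) (at_left 1)"
    using eventually_at_left_real[of 0 1] by simp
  have "filterlim (\<lambda>x::real. 1 - x powr q) (at 0) (at_left 1)"
    unfolding filterlim_at
  proof
    show "((\<lambda>x::real. 1 - x powr q) \<longlongrightarrow> 0) (at_left 1)" by real_asymp
    show "\<forall>\<^sub>F x::real in at_left 1. 1 - x powr q \<in> UNIV \<and> 1 - x powr q \<noteq> 0"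
      using near
    proof eventually_elim
      case (elim x)
      then have "x powr q < 1 powr q" using q by (intro powr_less_mono2) auto
      then show ?case by simp
    qed
  qed
  from filterlim_compose[OF lim0 this]
  have lim1: "((\<lambda>x. V_Y M Y 1 (x powr q) / \<bar>1 - x powr q\<bar> powr \<kappa>) \<longlongrightarrow> c) (at_left 1)" by simp
  have "((\<lambda>x::real. (1 - x powr q) / (1 - x)) \<longlongrightarrow> q) (at_left 1)" using q by real_asymp
  then have "((\<lambda>x::real. ((1 - x powr q) / (1 - x)) powr \<kappa>) \<longlongrightarrow> q powr \<kappa>) (at_left 1)"
    using q by (intro tendsto_intros) auto
  from tendsto_mult[OF lim1 this] show ?thesis
    unfolding q_def[symmetric]
  proof (rule Lim_transform_eventually)
    show "\<forall>\<^sub>F x in at_left 1. V_Y M Y 1 (x powr q) / \<bar>1 - x powr q\<bar> powr \<kappa> * ((1 - x powr q) / (1 - x)) powr \<kappa> = variogram_ratio M Y \<alpha> \<kappa> x"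
      using near
    proof eventually_elim
      case (elim x)
      then have "x powr q < 1 powr q" using q by (intro powr_less_mono2) auto
      then show ?case using elim \<alpha> \<kappa> by (simp add: variogram_ratio_def q_def powr_divide)
    qed
  qed
qed

text \<open>Near 1 the positive finite limit controls the ratio; on the remaining
  \<open>[0, b]\<close> the denominator stays away from 0, and \<open>Y 1\<close> differs from the
  earlier value because their standard deviations differ. The two bounds yield \<open>c1 > 0\<close>
  and \<open>c2\<close> finite.\<close>

lemma variogram_ratio_bounds:
  assumes S: "class_S M \<alpha> \<kappa> c Y" and \<alpha>: "\<alpha> > 0" and \<kappa>: "\<kappa> > 0" and c: "c > 0"
  shows "\<exists>\<delta>>0. \<forall>x\<in>{0..<1}. \<delta> \<le> variogram_ratio M Y \<alpha> \<kappa> x"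
    and "\<exists>K. \<forall>x\<in>{0..<1}. variogram_ratio M Y \<alpha> \<kappa> x \<le> K"
proof -
  define q where "q = \<kappa> / \<alpha>"
  have q: "q > 0" "q * \<alpha> = \<kappa>" using \<alpha> \<kappa> by (auto simp: q_def)
  define L where "L = c * (\<kappa> / \<alpha>) powr \<kappa>"
  have L: "L > 0" using c \<alpha> \<kappa> by (simp add: L_def)
  note lim = variogram_ratio_tendsto[OF S \<alpha> \<kappa>, folded L_def]
  have "eventually (\<lambda>x. L / 2 < variogram_ratio M Y \<alpha> \<kappa> x \<and> variogram_ratio M Y \<alpha> \<kappa> x < 2 * L) (at_left 1)"
    using L by (intro eventually_conj order_tendstoD[OF lim]) auto
  then obtain b0 where b0: "b0 < 1" "\<And>x. b0 < x \<Longrightarrow> x < 1 \<Longrightarrow> L / 2 < variogram_ratio M Y \<alpha> \<kappa> x \<and> variogram_ratio M Y \<alpha> \<kappa> x < 2 * L"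
    by (auto simp: eventually_at_left[of 0 1])
  define b where "b = max b0 (1 / 2)"
  have b: "0 < b" "b < 1" using b0 by (auto simp: b_def)
  have nb: "L / 2 < variogram_ratio M Y \<alpha> \<kappa> x \<and> variogram_ratio M Y \<alpha> \<kappa> x < 2 * L" if "b < x" "x < 1" for x
    using b0(2)[of x] that by (auto simp: b_def)
  \<comment> \<open>The standard deviation of the time-changed process at \<open>b\<close>, the
    largest one on \<open>[0, b]\<close>, so that one \<open>e\<close> serves every \<open>x\<close>
    there.\<close>
  define e where "e = b powr (\<kappa> / 2)"
  have e: "0 < e" "e < 1" using b \<kappa> powr_less_mono2[of "\<kappa> / 2" b 1] by (auto simp: e_def)
  have e2: "e\<^sup>2 = b powr \<kappa>" by (simp add: e_def power2_eq_square flip: powr_add)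
  have low: "(1 - e)\<^sup>2 \<le> variogram_ratio M Y \<alpha> \<kappa> x \<and> variogram_ratio M Y \<alpha> \<kappa> x \<le> 4 / (1 - b) powr \<kappa>" if x: "0 \<le> x" "x \<le> b" for x
  proof -
    have y: "0 \<le> x powr q" "x powr q \<le> 1" using x b q powr_mono2[of q x 1] by auto
    have d: "\<bar>1 - x\<bar> powr \<kappa> \<le> 1" "\<bar>1 - x\<bar> powr \<kappa> > 0" "(1 - b) powr \<kappa> \<le> \<bar>1 - x\<bar> powr \<kappa>" "(1 - b) powr \<kappa> > 0"
      using x b \<kappa> powr_mono2[of \<kappa> "\<bar>1 - x\<bar>" 1] powr_mono2[of \<kappa> "1 - b" "\<bar>1 - x\<bar>"] by auto
    have "x powr \<kappa> \<le> e\<^sup>2" unfolding e2 using x \<kappa> by (intro powr_mono2) auto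
    \<comment> \<open>Because of this sign, the upper bound on \<open>x powr \<kappa>\<close> gives
      a lower bound on the variogram.\<close>
    moreover have "1 - 1 / e \<le> 0" using e by simp
    ultimately have "e\<^sup>2 * (1 - 1 / e) \<le> x powr \<kappa> * (1 - 1 / e)" by (rule mult_right_mono_neg)
    moreover have "(1 - e)\<^sup>2 = (1 - e) + e\<^sup>2 * (1 - 1 / e)" using e by (simp add: power2_eq_square field_simps)
    moreover have "(1 - e) + x powr \<kappa> * (1 - 1 / e) \<le> V_Y M Y 1 (x powr q)"
      using class_S_increment_bounds(1)[OF S \<alpha> y e(1)] q by (simp add: powr_powr)
    ultimately have 1: "(1 - e)\<^sup>2 \<le> V_Y M Y 1 (x powr q)" by linarith
    then have 3: "0 \<le> V_Y M Y 1 (x powr q)" by (rule order_trans[rotated]) simp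
    have "V_Y M Y 1 (x powr q) / 1 \<le> V_Y M Y 1 (x powr q) / \<bar>1 - x\<bar> powr \<kappa>"
      using d 3 by (intro divide_left_mono) auto
    then have 2: "(1 - e)\<^sup>2 \<le> variogram_ratio M Y \<alpha> \<kappa> x"
      using 1 by (simp add: variogram_ratio_def q_def)
    have "V_Y M Y 1 (x powr q) / \<bar>1 - x\<bar> powr \<kappa> \<le> 4 / (1 - b) powr \<kappa>"
      using d 3 class_S_increment_bounds(2)[OF S \<alpha> y] by (intro frac_le) auto
    then show ?thesis using 2 by (simp add: variogram_ratio_def q_def)
  qed
  show "\<exists>\<delta>>0. \<forall>x\<in>{0..<1}. \<delta> \<le> variogram_ratio M Y \<alpha> \<kappa> x"
  proof (intro exI[of _ "min (L / 2) ((1 - e)\<^sup>2)"] conjI ballI)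
    show "min (L / 2) ((1 - e)\<^sup>2) > 0" using L e by simp
    fix x :: real assume "x \<in> {0..<1}"
    then show "min (L / 2) ((1 - e)\<^sup>2) \<le> variogram_ratio M Y \<alpha> \<kappa> x"
      using low[of x] nb[of x] by (cases "x \<le> b") (auto simp: min_le_iff_disj)
  qed
  show "\<exists>K. \<forall>x\<in>{0..<1}. variogram_ratio M Y \<alpha> \<kappa> x \<le> K"
  proof (intro exI[of _ "max (2 * L) (4 / (1 - b) powr \<kappa>)"] ballI)
    fix x :: real assume "x \<in> {0..<1}"
    then show "variogram_ratio M Y \<alpha> \<kappa> x \<le> max (2 * L) (4 / (1 - b) powr \<kappa>)"
      using low[of x] nb[of x] by (cases "x \<le> b") (auto simp: le_max_iff_disj)
  qed
qed

text \<open>Self-similarity with factor \<open>t powr (\<kappa> / \<alpha>)\<close> reduces every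
  pair of times to the pair \<open>(s / t, 1)\<close>, so bounds of the ratio on
  \<open>[0, 1)\<close> control all increments.\<close>

lemma class_S_time_changed_increments:
  assumes S: "class_S M \<alpha> \<kappa> c Y" and \<alpha>: "\<alpha> > 0" and \<kappa>: "\<kappa> > 0"
    and st: "0 \<le> s" "s < t"
  shows "(\<integral>\<omega>. (Y (t powr (\<kappa> / \<alpha>)) \<omega> - Y (s powr (\<kappa> / \<alpha>)) \<omega>)\<^sup>2 \<partial>M) = variogram_ratio M Y \<alpha> \<kappa> (s / t) * (t - s) powr \<kappa>"
proof -
  have Y: "centered_gaussian_process M Y" using S by (auto simp: class_S_def)
  define q where "q = \<kappa> / \<alpha>"
  have t: "t > 0" using st by simp
  have qa: "q * \<alpha> = \<kappa>" using \<alpha> by (simp add: q_def)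
  have s: "s powr q = t powr q * (s / t) powr q" using st by (simp flip: powr_mult)
  have "(\<integral>\<omega>. (Y (t powr q) \<omega> - Y (s powr q) \<omega>)\<^sup>2 \<partial>M) = (t powr q) powr \<alpha> * (\<integral>\<omega>. (Y 1 \<omega> - Y ((s / t) powr q) \<omega>)\<^sup>2 \<partial>M)"
    unfolding s using class_S_moments(2)[OF S \<alpha>, of "t powr q" 1 "(s / t) powr q"] t by simp
  also have "\<dots> = t powr \<kappa> * V_Y M Y 1 ((s / t) powr q)"
    using V_Y_eq_second_moment(1)[OF Y, of 1 "(s / t) powr q"] qa by (simp add: powr_powr)
  also have "t powr \<kappa> = (t - s) powr \<kappa> / \<bar>1 - s / t\<bar> powr \<kappa>"
  proof -
    have 1: "1 - s / t = (t - s) / t" using t by (simp add: field_simps)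
    have "\<bar>1 - s / t\<bar> powr \<kappa> = (t - s) powr \<kappa> / t powr \<kappa>"
      unfolding 1 using st by (simp add: powr_divide)
    then show ?thesis using st by simp
  qed
  finally show ?thesis by (simp add: variogram_ratio_def q_def)
qed

section \<open>Matching time scales and comparing the expectations\<close>

lemma powr_image_Icc:
  fixes q S :: real
  assumes "q > 0" "S \<ge> 0"
  shows "(\<lambda>s. s powr q) ` {0..S} = {0..S powr q}"
proof (intro equalityI subsetI)
  fix t assume "t \<in> {0..S powr q}"
  then have t: "0 \<le> t" "t \<le> S powr q" by auto
  have "t powr (1 / q) \<le> (S powr q) powr (1 / q)" using t assms by (intro powr_mono2) auto
  then have "t powr (1 / q) \<in> {0..S}" using assms by (simp add: powr_powr)
  moreover have "t = (t powr (1 / q)) powr q" using t assms by (simp add: powr_powr)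
  ultimately show "t \<in> (\<lambda>s. s powr q) ` {0..S}" by blast
qed (use assms in \<open>auto intro!: powr_mono2\<close>)

text \<open>Reparametrizing time does not change a supremum. The drift appears as half the variance
  of the \<open>sqrt 2\<close> multiple plus the penalty, the shape required by the
  comparison.\<close>

lemma piterbarg_expectation_powr_time:
  assumes "\<alpha> > 0" "\<kappa> > 0" "S \<ge> 0"
  shows "piterbarg_expectation M Y \<alpha> R (S powr (\<kappa> / \<alpha>)) =
    (\<integral>\<^sup>+\<omega>. ennreal (exp (SUP s\<in>{0..S}. sqrt 2 * Y (s powr (\<kappa> / \<alpha>)) \<omega> - s powr \<kappa> - R * s powr \<kappa>)) \<partial>M)"
proof -
  have "{0..S powr (\<kappa> / \<alpha>)} = (\<lambda>s. s powr (\<kappa> / \<alpha>)) ` {0..S}"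
    using assms by (intro powr_image_Icc[symmetric]) auto
  then show ?thesis
    using assms by (simp add: piterbarg_expectation_def image_image powr_powr algebra_simps)
qed

text \<open>At speed \<open>c powr (1 / \<kappa>)\<close> the drift \<open>1 + R / c\<close> splits
  into the half variance \<open>c * s powr \<kappa>\<close> and the penalty
  \<open>R * s powr \<kappa>\<close>, the same penalty as for \<open>Y\<close>.\<close>

lemma piterbarg_expectation_linear_time:
  assumes "c > 0" "\<kappa> > 0" "S \<ge> 0"
  shows "piterbarg_expectation N B \<kappa> (R / c) (c powr (1 / \<kappa>) * S) =
    (\<integral>\<^sup>+\<omega>. ennreal (exp (SUP s\<in>{0..S}. sqrt 2 * B (c powr (1 / \<kappa>) * s) \<omega> - c * s powr \<kappa> - R * s powr \<kappa>)) \<partial>N)"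
proof -
  have a: "c powr (1 / \<kappa>) > 0" using assms by simp
  have im: "{0..c powr (1 / \<kappa>) * S} = (\<lambda>s. c powr (1 / \<kappa>) * s) ` {0..S}"
    using a assms by (simp add: image_mult_atLeastAtMost)
  have "sqrt 2 * B (c powr (1 / \<kappa>) * s) \<omega> - (1 + R / c) * (c powr (1 / \<kappa>) * s) powr \<kappa> =
      sqrt 2 * B (c powr (1 / \<kappa>) * s) \<omega> - c * s powr \<kappa> - R * s powr \<kappa>" if "s \<in> {0..S}" for s \<omega>
    using that assms by (simp add: powr_mult powr_powr field_simps)
  then show ?thesis
    unfolding piterbarg_expectation_def im image_image
    by (intro nn_integral_cong arg_cong[where f=ennreal] arg_cong[where f=exp] SUP_cong) auto
qed

lemma fractional_bm_moments:
  assumes B: "fractional_bm N \<kappa> B"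
  shows "t \<ge> 0 \<Longrightarrow> (\<integral>\<omega>. (B t \<omega>)\<^sup>2 \<partial>N) = t powr \<kappa>"
    and "0 \<le> s \<Longrightarrow> s \<le> t \<Longrightarrow> (\<integral>\<omega>. (B t \<omega> - B s \<omega>)\<^sup>2 \<partial>N) = (t - s) powr \<kappa>"
proof -
  have G: "centered_gaussian_process N B" and B0: "AE \<omega> in N. B 0 \<omega> = 0"
    and var: "\<And>t. t \<ge> 0 \<Longrightarrow> prob_space.variance N (B t) = t powr \<kappa>"
    and inc: "\<And>s. s \<ge> 0 \<Longrightarrow> process_law N (\<lambda>t \<omega>. B (s + t) \<omega> - B s \<omega>) = process_law N (\<lambda>t \<omega>. B t \<omega> - B 0 \<omega>)"
    using B by (auto simp: fractional_bm_def)
  note mB = centered_gaussian_processD(2)[OF G]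
  show v: "(\<integral>\<omega>. (B t \<omega>)\<^sup>2 \<partial>N) = t powr \<kappa>" if "t \<ge> 0" for t
    using var[OF that] V_Y_eq_second_moment(2)[OF G that that] by simp
  show "(\<integral>\<omega>. (B t \<omega> - B s \<omega>)\<^sup>2 \<partial>N) = (t - s) powr \<kappa>" if "0 \<le> s" "s \<le> t"
  proof -
    have "(\<integral>\<omega>. (B (s + (t - s)) \<omega> - B s \<omega>)\<^sup>2 \<partial>N) = (\<integral>\<omega>. (B (t - s) \<omega> - B 0 \<omega>)\<^sup>2 \<partial>N)"
      using that by (intro process_law_second_moments(2)[OF inc, of s "t - s" "t - s"] borel_measurable_diff mB) auto
    also have "\<dots> = (\<integral>\<omega>. (B (t - s) \<omega>)\<^sup>2 \<partial>N)"
    proof (rule integral_cong_AE)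
      have [measurable]: "B (t - s) \<in> borel_measurable N" "B 0 \<in> borel_measurable N" using that by (auto intro!: mB)
      show "(\<lambda>\<omega>. (B (t - s) \<omega> - B 0 \<omega>)\<^sup>2) \<in> borel_measurable N" "(\<lambda>\<omega>. (B (t - s) \<omega>)\<^sup>2) \<in> borel_measurable N" by measurable
      show "AE \<omega> in N. (B (t - s) \<omega> - B 0 \<omega>)\<^sup>2 = (B (t - s) \<omega>)\<^sup>2" using B0 by auto
    qed
    finally show ?thesis using v that by simp
  qed
qed

lemma powr_time_change:
  assumes S: "class_S M \<alpha> \<kappa> c Y" and q: "q > 0"
  shows "centered_gaussian_process M (\<lambda>t. Y (t powr q))" "as_continuous_paths M (\<lambda>t. Y (t powr q))"
proof -
  have Y: "centered_gaussian_process M Y" "as_continuous_paths M Y" using S by (auto simp: class_S_def)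
  show "centered_gaussian_process M (\<lambda>t. Y (t powr q))"
  proof (rule gaussian_process_time_change[OF Y(1)])
    show "inj_on (\<lambda>t. t powr q) {0..}"
      using q by (intro strict_mono_on_imp_inj_on strict_mono_onI powr_less_mono2) auto
  qed simp
  from Y(2) show "as_continuous_paths M (\<lambda>t. Y (t powr q))"
    unfolding as_continuous_paths_def
  proof eventually_elim
    case (elim \<omega>)
    show ?case by (rule continuous_on_compose2[OF elim]) (use q in \<open>auto intro!: continuous_intros continuous_on_powr'\<close>)
  qed
qed

lemma linear_time_change:
  assumes B: "fractional_bm N \<kappa> B" and a: "a > 0"
  shows "centered_gaussian_process N (\<lambda>t. B (a * t))" "as_continuous_paths N (\<lambda>t. B (a * t))"
proof -
  have G: "centered_gaussian_process N B" "as_continuous_paths N B" using B by (auto simp: fractional_bm_def)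
  show "centered_gaussian_process N (\<lambda>t. B (a * t))"
    using a by (intro gaussian_process_time_change[OF G(1)]) (auto simp: inj_on_def)
  from G(2) show "as_continuous_paths N (\<lambda>t. B (a * t))"
    unfolding as_continuous_paths_def
  proof eventually_elim
    case (elim \<omega>)
    show ?case by (rule continuous_on_compose2[OF elim]) (use a in \<open>auto intro!: continuous_intros\<close>)
  qed
qed

text \<open>The horizons \<open>k powr (1 / \<kappa>) * T\<close> and
  \<open>T powr (\<kappa> / \<alpha>)\<close> are images of one interval \<open>{0..T}\<close>, on
  which a bound of the ratio by \<open>k\<close> orders the two variograms. The variances
  \<open>k * t powr \<kappa>\<close> and \<open>t powr \<kappa>\<close> need not agree.\<close>

lemma piterbarg_expectation_compare_fbm:
  assumes S: "class_S M \<alpha> \<kappa> c Y" and \<alpha>: "\<alpha> > 0" and \<kappa>: "\<kappa> > 0"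
    and B: "fractional_bm N \<kappa> B" and k: "k > 0" and T: "T \<ge> 0"
  shows "(\<And>x. x \<in> {0..<1} \<Longrightarrow> k \<le> variogram_ratio M Y \<alpha> \<kappa> x) \<Longrightarrow>
      piterbarg_expectation N B \<kappa> (R / k) (k powr (1 / \<kappa>) * T) \<le> piterbarg_expectation M Y \<alpha> R (T powr (\<kappa> / \<alpha>))"
    and "(\<And>x. x \<in> {0..<1} \<Longrightarrow> variogram_ratio M Y \<alpha> \<kappa> x \<le> k) \<Longrightarrow>
      piterbarg_expectation M Y \<alpha> R (T powr (\<kappa> / \<alpha>)) \<le> piterbarg_expectation N B \<kappa> (R / k) (k powr (1 / \<kappa>) * T)"
proof -
  define q where "q = \<kappa> / \<alpha>"
  define a where "a = k powr (1 / \<kappa>)"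
  have q: "q > 0" "q * \<alpha> = \<kappa>" and a: "a > 0" using \<alpha> \<kappa> k by (auto simp: q_def a_def)
  have ak: "(a * t) powr \<kappa> = k * t powr \<kappa>" if "t \<ge> 0" for t
    using a k \<kappa> that by (simp add: powr_mult a_def powr_powr)
  define X where "X t = Y (t powr q)" for t
  define Z where "Z t = B (a * t)" for t
  have X: "centered_gaussian_process M X" "as_continuous_paths M X"
    unfolding X_def[abs_def] by (rule powr_time_change[OF S q(1)])+
  have Z: "centered_gaussian_process N Z" "as_continuous_paths N Z"
    unfolding Z_def[abs_def] by (rule linear_time_change[OF B a])+
  have contX: "AE \<omega> in M. continuous_on {0..T} (\<lambda>t. X t \<omega>)"
    using X(2) unfolding as_continuous_paths_def by eventually_elim (rule continuous_on_subset, auto)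
  have contZ: "AE \<omega> in N. continuous_on {0..T} (\<lambda>t. Z t \<omega>)"
    using Z(2) unfolding as_continuous_paths_def by eventually_elim (rule continuous_on_subset, auto)
  have vX: "(\<integral>\<omega>. (X t \<omega>)\<^sup>2 \<partial>M) = t powr \<kappa>" if "t \<in> {0..T}" for t
    using class_S_moments(1)[OF S \<alpha>, of "t powr q"] q by (simp add: X_def powr_powr)
  have vZ: "(\<integral>\<omega>. (Z t \<omega>)\<^sup>2 \<partial>N) = k * t powr \<kappa>" if "t \<in> {0..T}" for t
    using fractional_bm_moments(1)[OF B, of "a * t"] a that ak[of t] by (simp add: Z_def)
  have cont: "continuous_on {0..T} (\<lambda>t. t powr \<kappa>)"
    using \<kappa> by (intro continuous_on_powr' continuous_intros) auto
  then have cont': "continuous_on {0..T} (\<lambda>t. r * t powr \<kappa>)" for r by (rule continuous_on_mult_left)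
  have VX: "(\<integral>\<omega>. (X t \<omega> - X s \<omega>)\<^sup>2 \<partial>M) = variogram_ratio M Y \<alpha> \<kappa> (s / t) * (t - s) powr \<kappa>"
    if "0 \<le> s" "s < t" for s t
    unfolding X_def q_def by (rule class_S_time_changed_increments[OF S \<alpha> \<kappa> that])
  have VZ: "(\<integral>\<omega>. (Z t \<omega> - Z s \<omega>)\<^sup>2 \<partial>N) = k * (t - s) powr \<kappa>" if "0 \<le> s" "s < t" for s t
    using fractional_bm_moments(2)[OF B, of "a * s" "a * t"] a that ak[of "t - s"]
    by (simp add: Z_def right_diff_distrib)
  have PX: "piterbarg_expectation M Y \<alpha> R (T powr (\<kappa> / \<alpha>)) = (\<integral>\<^sup>+\<omega>. ennreal (exp (SUP t\<in>{0..T}. sqrt 2 * X t \<omega> - t powr \<kappa> - R * t powr \<kappa>)) \<partial>M)"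
    using piterbarg_expectation_powr_time[OF \<alpha> \<kappa> T] by (simp add: X_def q_def)
  have PZ: "piterbarg_expectation N B \<kappa> (R / k) (k powr (1 / \<kappa>) * T) = (\<integral>\<^sup>+\<omega>. ennreal (exp (SUP t\<in>{0..T}. sqrt 2 * Z t \<omega> - k * t powr \<kappa> - R * t powr \<kappa>)) \<partial>N)"
    using piterbarg_expectation_linear_time[OF k \<kappa> T] by (simp add: Z_def a_def)
  show "piterbarg_expectation N B \<kappa> (R / k) (k powr (1 / \<kappa>) * T) \<le> piterbarg_expectation M Y \<alpha> R (T powr (\<kappa> / \<alpha>))"
    if le: "\<And>x. x \<in> {0..<1} \<Longrightarrow> k \<le> variogram_ratio M Y \<alpha> \<kappa> x"
    unfolding PX PZ
  proof (rule exp_SUP_gaussian_compare[OF Z(1) X(1) contZ contX vZ vX cont' cont cont' _ T])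
    have lt: "(\<integral>\<omega>. (Z t \<omega> - Z s \<omega>)\<^sup>2 \<partial>N) \<le> (\<integral>\<omega>. (X t \<omega> - X s \<omega>)\<^sup>2 \<partial>M)" if "0 \<le> s" "s < t" for s t
      unfolding VX[OF that] VZ[OF that] using that by (intro mult_right_mono le) auto
    fix s t assume "s \<in> {0..T}" "t \<in> {0..T}"
    then show "(\<integral>\<omega>. (Z s \<omega> - Z t \<omega>)\<^sup>2 \<partial>N) \<le> (\<integral>\<omega>. (X s \<omega> - X t \<omega>)\<^sup>2 \<partial>M)"
      using lt[of s t] lt[of t s] by (cases s t rule: linorder_cases) (auto simp: power2_commute)
  qed
  show "piterbarg_expectation M Y \<alpha> R (T powr (\<kappa> / \<alpha>)) \<le> piterbarg_expectation N B \<kappa> (R / k) (k powr (1 / \<kappa>) * T)"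
    if le: "\<And>x. x \<in> {0..<1} \<Longrightarrow> variogram_ratio M Y \<alpha> \<kappa> x \<le> k"
    unfolding PX PZ
  proof (rule exp_SUP_gaussian_compare[OF X(1) Z(1) contX contZ vX vZ cont cont' cont' _ T])
    have lt: "(\<integral>\<omega>. (X t \<omega> - X s \<omega>)\<^sup>2 \<partial>M) \<le> (\<integral>\<omega>. (Z t \<omega> - Z s \<omega>)\<^sup>2 \<partial>N)" if "0 \<le> s" "s < t" for s t
      unfolding VX[OF that] VZ[OF that] using that by (intro mult_right_mono le) auto
    fix s t assume "s \<in> {0..T}" "t \<in> {0..T}"
    then show "(\<integral>\<omega>. (X s \<omega> - X t \<omega>)\<^sup>2 \<partial>M) \<le> (\<integral>\<omega>. (Z s \<omega> - Z t \<omega>)\<^sup>2 \<partial>N)"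
      using lt[of s t] lt[of t s] by (cases s t rule: linorder_cases) (auto simp: power2_commute)
  qed
qed

lemma piterbarg_constant_pos_finite:
  assumes S: "class_S M \<alpha> \<kappa> c Y" and \<alpha>: "\<alpha> > 0" and \<kappa>: "\<kappa> > 0" and c: "c > 0" and R: "R > 0"
  shows "0 < piterbarg_constant M Y \<alpha> R" "piterbarg_constant M Y \<alpha> R < \<infinity>"
proof -
  define q where "q = \<kappa> / \<alpha>"
  have q: "q > 0" "q * \<alpha> = \<kappa>" using \<alpha> \<kappa> by (auto simp: q_def)
  have Y: "centered_gaussian_process M Y" "as_continuous_paths M Y" using S by (auto simp: class_S_def)
  interpret prob_space M by (rule centered_gaussian_processD[OF Y(1)])
  have PC: "piterbarg_constant M Y \<alpha> R = (SUP T\<in>{0..}. piterbarg_expectation M Y \<alpha> R T)"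
    by (rule piterbarg_constant_limit[OF Y(2) \<alpha>])
  have [measurable]: "Y 0 \<in> borel_measurable M" by (rule centered_gaussian_processD(2)[OF Y(1)]) simp
  \<comment> \<open>Horizon 0 is enough for positivity, because the expectations increase with the
    horizon.\<close>
  have "piterbarg_expectation M Y \<alpha> R 0 = (\<integral>\<^sup>+\<omega>. ennreal (exp (sqrt 2 * Y 0 \<omega>)) \<partial>M)"
    by (simp add: piterbarg_expectation_def)
  also have "\<dots> \<noteq> 0"
  proof
    assume "(\<integral>\<^sup>+\<omega>. ennreal (exp (sqrt 2 * Y 0 \<omega>)) \<partial>M) = 0"
    then have "AE \<omega> in M. ennreal (exp (sqrt 2 * Y 0 \<omega>)) = 0" by (subst (asm) nn_integral_0_iff_AE) auto
    then show False by simp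
  qed
  finally have "0 < piterbarg_expectation M Y \<alpha> R 0" by (simp add: zero_less_iff_neq_zero)
  also have "\<dots> \<le> piterbarg_constant M Y \<alpha> R" unfolding PC by (rule SUP_upper) simp
  finally show "0 < piterbarg_constant M Y \<alpha> R" .
  define X where "X t = Y (t powr q)" for t
  have X: "centered_gaussian_process M X" "as_continuous_paths M X"
    unfolding X_def[abs_def] by (rule powr_time_change[OF S q(1)])+
  obtain C where C: "\<And>x. x \<in> {0..<1} \<Longrightarrow> variogram_ratio M Y \<alpha> \<kappa> x \<le> C"
    using variogram_ratio_bounds(2)[OF S \<alpha> \<kappa> c] by blast
  have "\<exists>K::real. \<forall>T\<ge>0. (\<integral>\<^sup>+\<omega>. ennreal (exp (SUP t\<in>{0..T}. sqrt 2 * X t \<omega> - t powr \<kappa> - R * t powr \<kappa>)) \<partial>M) \<le> ennreal K"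
  \<comment> \<open>\<open>C\<close> is only known as an upper bound of the ratio; its positive part
    meets the sign condition.\<close>
  proof (rule exp_SUP_bounded[OF X \<kappa> R, of "max C 0"])
    show "(\<integral>\<omega>. (X t \<omega>)\<^sup>2 \<partial>M) = t powr \<kappa>" if "t \<ge> 0" for t
      using class_S_moments(1)[OF S \<alpha>, of "t powr q"] q by (simp add: X_def powr_powr)
    fix s t :: real assume st: "0 \<le> s" "s \<le> t"
    show "(\<integral>\<omega>. (X t \<omega> - X s \<omega>)\<^sup>2 \<partial>M) \<le> max C 0 * (t - s) powr \<kappa>"
    proof (cases "s = t")
      case False
      then have "s < t" using st by simp
      have "variogram_ratio M Y \<alpha> \<kappa> (s / t) \<le> max C 0"
        using C[of "s / t"] st \<open>s < t\<close> by auto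
      then show ?thesis
        unfolding X_def q_def class_S_time_changed_increments[OF S \<alpha> \<kappa> st(1) \<open>s < t\<close>]
        by (rule mult_right_mono) simp
    qed simp
  qed simp
  then obtain K where K: "\<And>T. T \<ge> 0 \<Longrightarrow> (\<integral>\<^sup>+\<omega>. ennreal (exp (SUP t\<in>{0..T}. sqrt 2 * X t \<omega> - t powr \<kappa> - R * t powr \<kappa>)) \<partial>M) \<le> ennreal K"
    by blast
  have "piterbarg_expectation M Y \<alpha> R T \<le> ennreal K" if "T \<ge> 0" for T
  proof -
    have "(T powr (1 / q)) powr q = T" using that q by (simp add: powr_powr)
    then show ?thesis
      using K[of "T powr (1 / q)"] piterbarg_expectation_powr_time[OF \<alpha> \<kappa>, of "T powr (1 / q)" M Y R]
      by (simp add: X_def q_def)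
  qed
  then have "piterbarg_constant M Y \<alpha> R \<le> ennreal K" unfolding PC by (intro SUP_least) auto
  then show "piterbarg_constant M Y \<alpha> R < \<infinity>" by (rule le_less_trans) simp
qed

text \<open>Both constants are suprema over horizons, so it suffices to match each horizon of one
  process with a suitable horizon of the other.\<close>

theorem theorem3p1:
  fixes M :: "'a measure" and Y :: "real \<Rightarrow> 'a \<Rightarrow> real"
    and \<alpha> \<kappa> c\<^sub>Y R :: real
  assumes "\<alpha> > 0" and "0 < \<kappa>" and "\<kappa> \<le> 2" and "c\<^sub>Y > 0"
    and "class_S M \<alpha> \<kappa> c\<^sub>Y Y"
    and "R > 0"
  shows "(piterbarg_expectation M Y \<alpha> R \<longlongrightarrow> piterbarg_constant M Y \<alpha> R) at_top \<and>
     0 < piterbarg_constant M Y \<alpha> R \<and> piterbarg_constant M Y \<alpha> R < \<infinity> \<and>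
     (let c1 = (INF x\<in>{0..<1}. V_Y M Y 1 (x powr (\<kappa> / \<alpha>)) / \<bar>1 - x\<bar> powr \<kappa>);
          c2 = (SUP x\<in>{0..<1}. V_Y M Y 1 (x powr (\<kappa> / \<alpha>)) / \<bar>1 - x\<bar> powr \<kappa>)
      in \<forall>(N :: 'b measure) B. fractional_bm N \<kappa> B \<longrightarrow>
           piterbarg_constant N B \<kappa> (R / c1) \<le> piterbarg_constant M Y \<alpha> R \<and>
           piterbarg_constant M Y \<alpha> R \<le> piterbarg_constant N B \<kappa> (R / c2))"
proof -
  note \<alpha> = assms(1) and \<kappa> = assms(2) and c = assms(4) and S = assms(5) and R = assms(6)
  have cY: "as_continuous_paths M Y" using S by (auto simp: class_S_def)
  define c1 where "c1 = (INF x\<in>{0..<1}. variogram_ratio M Y \<alpha> \<kappa> x)"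
  define c2 where "c2 = (SUP x\<in>{0..<1}. variogram_ratio M Y \<alpha> \<kappa> x)"
  obtain \<delta> where \<delta>: "\<delta> > 0" "\<And>x. x \<in> {0..<1} \<Longrightarrow> \<delta> \<le> variogram_ratio M Y \<alpha> \<kappa> x"
    using variogram_ratio_bounds(1)[OF S \<alpha> \<kappa> c] by blast
  obtain K where K: "\<And>x. x \<in> {0..<1} \<Longrightarrow> variogram_ratio M Y \<alpha> \<kappa> x \<le> K"
    using variogram_ratio_bounds(2)[OF S \<alpha> \<kappa> c] by blast
  \<comment> \<open>A uniform positive lower bound is needed here: an infimum equal to 0 would turn
    \<open>R / c1\<close> into the default value 0.\<close>
  have "\<delta> \<le> c1" unfolding c1_def by (rule cINF_greatest) (use \<delta> in auto)
  then have c1: "c1 > 0" using \<delta>(1) by simp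
  have c1_le: "c1 \<le> variogram_ratio M Y \<alpha> \<kappa> x" if "x \<in> {0..<1}" for x
    unfolding c1_def by (rule cINF_lower[OF _ that]) (rule bdd_belowI2[OF \<delta>(2)])
  have le_c2: "variogram_ratio M Y \<alpha> \<kappa> x \<le> c2" if "x \<in> {0..<1}" for x
    unfolding c2_def by (rule cSUP_upper[OF that]) (rule bdd_aboveI2[OF K])
  have c2: "c2 > 0" using le_c2[of 0] \<delta>(2)[of 0] \<delta>(1) by simp
  have PCY: "piterbarg_constant M Y \<alpha> R = (SUP T\<in>{0..}. piterbarg_expectation M Y \<alpha> R T)"
    by (rule piterbarg_constant_limit[OF cY \<alpha>])
  have "piterbarg_constant N B \<kappa> (R / c1) \<le> piterbarg_constant M Y \<alpha> R \<and>
      piterbarg_constant M Y \<alpha> R \<le> piterbarg_constant N B \<kappa> (R / c2)"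
    if B: "fractional_bm N \<kappa> B" for N :: "'b measure" and B
  proof
    have cB: "as_continuous_paths N B" using B by (auto simp: fractional_bm_def)
    note PCB = piterbarg_constant_limit(2)[OF cB \<kappa>]
    show "piterbarg_constant N B \<kappa> (R / c1) \<le> piterbarg_constant M Y \<alpha> R"
      unfolding PCB
    proof (rule SUP_least)
      fix T :: real assume "T \<in> {0..}"
      \<comment> \<open>The parameter interval whose image under the speed
        \<open>c1 powr (1 / \<kappa>)\<close> is exactly \<open>{0..T}\<close>.\<close>
      then have T: "T / c1 powr (1 / \<kappa>) \<ge> 0" by simp
      have "piterbarg_expectation N B \<kappa> (R / c1) T = piterbarg_expectation N B \<kappa> (R / c1) (c1 powr (1 / \<kappa>) * (T / c1 powr (1 / \<kappa>)))"
        using c1 by simp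
      also have "\<dots> \<le> piterbarg_expectation M Y \<alpha> R ((T / c1 powr (1 / \<kappa>)) powr (\<kappa> / \<alpha>))"
        by (rule piterbarg_expectation_compare_fbm(1)[OF S \<alpha> \<kappa> B c1 T c1_le])
      also have "\<dots> \<le> piterbarg_constant M Y \<alpha> R" unfolding PCY by (rule SUP_upper) simp
      finally show "piterbarg_expectation N B \<kappa> (R / c1) T \<le> piterbarg_constant M Y \<alpha> R" .
    qed
    show "piterbarg_constant M Y \<alpha> R \<le> piterbarg_constant N B \<kappa> (R / c2)"
      unfolding PCY
    proof (rule SUP_least)
      fix T :: real assume T: "T \<in> {0..}"
      have "piterbarg_expectation M Y \<alpha> R T = piterbarg_expectation M Y \<alpha> R ((T powr (\<alpha> / \<kappa>)) powr (\<kappa> / \<alpha>))"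
        using T \<alpha> \<kappa> by (simp add: powr_powr)
      also have "\<dots> \<le> piterbarg_expectation N B \<kappa> (R / c2) (c2 powr (1 / \<kappa>) * T powr (\<alpha> / \<kappa>))"
        by (rule piterbarg_expectation_compare_fbm(2)[OF S \<alpha> \<kappa> B c2 _ le_c2]) simp
      also have "\<dots> \<le> piterbarg_constant N B \<kappa> (R / c2)" unfolding PCB by (rule SUP_upper) simp
      finally show "piterbarg_expectation M Y \<alpha> R T \<le> piterbarg_constant N B \<kappa> (R / c2)" .
    qed
  qed
  then show ?thesis
    using piterbarg_constant_limit(1)[OF cY \<alpha>] piterbarg_constant_pos_finite[OF S \<alpha> \<kappa> c R]
    unfolding Let_def c1_def c2_def variogram_ratio_def by blast
qed

end
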